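(* Let $f\in\mathcal{P}_n$, let $0<p<1$ and let $N>n$ be an integer. Then $$|Z_p^{\diamondsuit}(f)|\le |Z_p^{\diamondsuit}(f^* )|.$$ Moreover, $$\mathbb{E}\,|\mathcal{Z}^{\diamondsuit}_{p,N}(f)|\le \mathbb{E}\,|\mathcal{Z}^{\diamondsuit}_{p,N}(f^* )|.$$
   Context: $\mathcal{P}_n$ denotes the set of measurable functions $f:\mathbb{R}^n\to[0,\infty)$ with $\int_{\mathbb{R}^n}f=1$ and finite essential supremum $\|f\|_\infty$. For a measurable set $A\subseteq\mathbb{R}^n$ of finite volume, $A^*$ is the open Euclidean ball centered at the origin with $|A^*|=|A|$; the symmetric decreasing rearrangement of $f$ is $f^*(x)=\int_0^\infty \chi_{\{f>t\}^*}(x)\,dt$. A set $K\subseteq\mathbb{R}^n$ is star-shaped if $0\in K$ and $\lambda x\in K$ whenever $x\in K$, $\lambda\in[0,1]$; its radial function is $\rho(K,u)=\sup\{\lambda\ge 0:\lambda u\in K\}\in[0,\infty]$, $u\in S^{n-1}$. Star-shaped sets below are specified through their radial functions (values $+\infty$ allowed), and their volume is $|K|=\omega_n\int_{S^{n-1}}\rho(K,u)^n\,d\sigma(u)\in[0,\infty]$, where $\sigma$ is the normalized rotation-invariant probability measure on $S^{n-1}$ and $\omega_n$ is the volume of the Euclidean unit ball. For $f\in\mathcal{P}_n$ and $p\in(0,1)$, $Z_p^\diamondsuit(f)$ is the star-shaped set with $\rho(Z_p^\diamondsuit(f),u)^{-p}=\int_{\mathbb{R}^n}|\langle x,u\rangle|^p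 f(x)\,dx$. For $N>n$, let $X_1,\dots,X_N$ be independent random vectors with density $f$; $\mathcal{Z}^\diamondsuit_{p,N}(f)$ is the random star-shaped set with $\rho(\mathcal{Z}^\diamondsuit_{p,N}(f),u)^{-p}=\frac1N\sum_{i=1}^N|\langle X_i,u\rangle|^p$. *)

theory Defs
  imports "HOL-Analysis.Analysis" "HOL-Probability.Probability"
begin

definition Pn :: "('a::euclidean_space \<Rightarrow> real) set" where
  "Pn = {f. f \<in> borel_measurable lebesgue \<and> (\<forall>x. 0 \<le> f x)
            \<and> (\<integral>\<^sup>+ x. ennreal (f x) \<partial>lebesgue) = 1
            \<and> esssup lebesgue (\<lambda>x. ereal (f x)) < \<infinity>}"

text \<open>A^*: open ball centred at the origin with the same volume as A (A of finite volume).\<close>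
definition sym_ball :: "'a::euclidean_space set \<Rightarrow> 'a set" where
  "sym_ball A = ball 0 (SOME r. 0 \<le> r \<and> emeasure lebesgue (ball (0::'a) r) = emeasure lebesgue A)"

definition sym_rearr :: "('a::euclidean_space \<Rightarrow> real) \<Rightarrow> 'a \<Rightarrow> real" where
  "sym_rearr f x = enn2real (\<integral>\<^sup>+ t\<in>{0<..}. indicator (sym_ball {y. f y > t}) x \<partial>lborel)"

definition star_set :: "('a::euclidean_space \<Rightarrow> ennreal) \<Rightarrow> 'a set" where
  "star_set \<rho> = {x. x = 0 \<or> ennreal (norm x) < \<rho> (x /\<^sub>R norm x)}"

text \<open>Radial function determined by rho(u)^(-p) = I(u), with I(u) in [0,infty]:
  I(u) = 0 gives rho = infty, I(u) = infty gives rho = 0.\<close>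
definition radial_from_moment :: "real \<Rightarrow> ennreal \<Rightarrow> ennreal" where
  "radial_from_moment p I =
     (if I = 0 then \<infinity> else if I = \<infinity> then 0 else ennreal (enn2real I powr (- 1 / p)))"

definition Zp_dia :: "real \<Rightarrow> ('a::euclidean_space \<Rightarrow> real) \<Rightarrow> 'a set" where
  "Zp_dia p f = star_set (\<lambda>u. radial_from_moment p
       (\<integral>\<^sup>+ x. ennreal (\<bar>x \<bullet> u\<bar> powr p * f x) \<partial>lebesgue))"

definition Zp_dia_emp :: "real \<Rightarrow> nat \<Rightarrow> (nat \<Rightarrow> 'a::euclidean_space) \<Rightarrow> 'a set" where
  "Zp_dia_emp p N X = star_set (\<lambda>u. radial_from_moment p
       (ennreal ((1 / real N) * (\<Sum>i<N. \<bar>X i \<bullet> u\<bar> powr p))))"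

definition sample_space :: "nat \<Rightarrow> ('a::euclidean_space \<Rightarrow> real) \<Rightarrow> (nat \<Rightarrow> 'a) measure" where
  "sample_space N f = (\<Pi>\<^sub>M i\<in>{..<N}. density lebesgue (\<lambda>x. ennreal (f x)))"

definition exp_vol_emp :: "real \<Rightarrow> nat \<Rightarrow> ('a::euclidean_space \<Rightarrow> real) \<Rightarrow> ennreal" where
  "exp_vol_emp p N f = (\<integral>\<^sup>+ X. emeasure lebesgue (Zp_dia_emp p N X) \<partial>sample_space N f)"

end

theory Submission
  imports Defs
begin

text \<open>
  A level set of a \<open>p\<close>-homogeneous function \<open>I\<close> has volume proportional to the integral of
  \<open>exp (- I)\<close>, so by independence the expected volume is a constant multiple of the integral of
  \<open>G y ^ N\<close>, where \<open>G y\<close> is the mean of \<open>exp (- \<bar>x \<bullet> y\<bar> powr p / N)\<close> under the density. The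
  deterministic inequality is the limit \<open>N \<rightarrow> \<infinity>\<close>. Writing both the density and the exponential as
  superpositions of indicators reduces everything to sets: the integral over \<open>y\<close> in a ball of the
  product of the volumes of \<open>A i \<inter> {x. \<bar>x \<bullet> y\<bar> < \<alpha> i}\<close> does not decrease when every \<open>A i\<close> is
  replaced by the centred ball of equal volume.

  It suffices to symmetrise in one direction \<open>e\<close> at a time. For fixed \<open>y \<bullet> e\<close> the functional becomes
  one of Brascamp-Lieb-Luttinger type in the coordinates along \<open>e\<close>. For intervals it is an even
  log-concave function of a common dilation of the centres (Prekopa-Leindler), so it grows when all
  intervals slide towards the origin, merging on contact. Finally, among tuples of sets on which the
  functional is at least as large as on the given one, the overlap with the balls has no supremum
  short of full overlap, because a Steiner symmetrisation along a suitable direction would still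
  enlarge it by a definite amount.
\<close>

subsection \<open>Midpoint Prekopa-Leindler inequality\<close>

text \<open>For p < 1 the star-shaped sets need not be convex, so arguments for convex bodies do not
  apply to them. The layers of the exponential, however, are slabs for every exponent, and p
  survives only in their widths. The obstacle is that the slab condition is bilinear in x and y.
  With r the coordinate of y along \<open>e\<close>, w its remaining coordinates, s the coordinate
  of x along \<open>e\<close> and v the remaining ones, the inner product is r * (s + v \<bullet> w
  / r). For frozen r and v this confines s to a window whose centre is linear in w, while w runs
  over a ball. Sliding uses that this ball is convex, even and of finite measure; rotating to other
  directions uses the rotation invariance of the ball in y. This is why y stays confined to a ball
  until the very end. The extremal argument needs no convergent sequence of symmetrisations, because
  the guaranteed gain in overlap depends only on the missing overlap, the number of sets and a fixed
  enclosing radius.\<close>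

lemma emeasure_le_cofinal_atMost:
  fixes A :: "real set" and c m :: ennreal
  assumes [measurable]: "A \<in> sets borel" and "A \<noteq> {}"
    and bound: "\<And>a. a \<in> A \<Longrightarrow> emeasure lborel (A \<inter> {..a}) + c \<le> m"
  shows "emeasure lborel A + c \<le> m"
proof (cases "\<exists>a\<in>A. \<forall>x\<in>A. x \<le> a")
  case True
  then obtain a where "a \<in> A" "A \<inter> {..a} = A" by auto
  with bound[of a] show ?thesis by simp
next
  case False
  \<comment> \<open>Without a largest element, the supremum is approached along countably many
    rationals, each strictly below some element of \<open>A\<close>; running maxima of an
    enumeration make the half-lines increase.\<close>
  define Q where "Q = {q \<in> \<rat>. \<exists>a\<in>A. q < a}"
  have cov: "\<exists>q\<in>Q. x \<le> q" if x: "x \<in> A" for x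
  proof -
    obtain a where a: "a \<in> A" "x < a" using False x by (meson not_le)
    then obtain q where "q \<in> \<rat>" "x < q" "q < a" using Rats_dense_in_real by blast
    with a have "q \<in> Q" by (auto simp: Q_def)
    with \<open>x < q\<close> show ?thesis by (intro bexI[of _ q]) auto
  qed
  have "Q \<noteq> {}" using cov \<open>A \<noteq> {}\<close> by blast
  have "countable Q" unfolding Q_def by (intro countable_Collect countable_rat)
  define s where "s n = Max (from_nat_into Q ` {..n})" for n
  have sQ: "s n \<in> Q" for n
  proof -
    have "s n \<in> from_nat_into Q ` {..n}" unfolding s_def by (intro Max_in) auto
    then show ?thesis using from_nat_into[OF \<open>Q \<noteq> {}\<close>] by auto
  qed
  have "incseq s" unfolding s_def incseq_def by (auto intro!: Max_mono)
  define E where "E n = A \<inter> {..s n}" for n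
  have E_meas: "range E \<subseteq> sets lborel" by (auto simp: E_def)
  have E_inc: "incseq E" using \<open>incseq s\<close> by (force simp: E_def incseq_def)
  have "(\<Union>n. E n) = A"
  proof (intro equalityI subsetI)
    fix x assume x: "x \<in> A"
    obtain q where q: "q \<in> Q" "x \<le> q" using cov x by blast
    obtain n where "from_nat_into Q n = q"
      using from_nat_into_surj[OF \<open>countable Q\<close> q(1)] by blast
    then have "q \<le> s n" unfolding s_def by (intro Max_ge) auto
    then show "x \<in> (\<Union>n. E n)" using x q by (auto simp: E_def intro: order_trans)
  qed (auto simp: E_def)
  then have "emeasure lborel A = (SUP n. emeasure lborel (E n))"
    using SUP_emeasure_incseq[OF E_meas E_inc] by simp
  then have "emeasure lborel A + c = (SUP n. emeasure lborel (E n) + c)"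
    by (simp add: ennreal_SUP_add_left)
  also have "\<dots> \<le> m"
  proof (rule SUP_least)
    fix n
    obtain a where a: "a \<in> A" "s n < a" using sQ[of n] by (auto simp: Q_def)
    have "emeasure lborel (E n) \<le> emeasure lborel (A \<inter> {..a})"
      using a by (intro emeasure_mono) (auto simp: E_def)
    then show "emeasure lborel (E n) + c \<le> m"
      using bound[OF a(1)] by (meson add_right_mono order_trans)
  qed
  finally show ?thesis .
qed

lemma emeasure_lborel_uminus_vimage:
  fixes A :: "real set"
  assumes [measurable]: "A \<in> sets borel"
  shows "emeasure lborel (uminus -` A) = emeasure lborel A"
proof -
  have "emeasure lborel A = emeasure (distr lborel borel uminus) A"
    by (simp add: lborel_distr_uminus)
  then show ?thesis by (simp add: emeasure_distr)
qed

lemma emeasure_le_cofinal_atLeast: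
  fixes A :: "real set" and c m :: ennreal
  assumes [measurable]: "A \<in> sets borel" and "A \<noteq> {}"
    and bound: "\<And>a. a \<in> A \<Longrightarrow> emeasure lborel (A \<inter> {a..}) + c \<le> m"
  shows "emeasure lborel A + c \<le> m"
proof -
  have "emeasure lborel (uminus -` A) + c \<le> m"
  proof (rule emeasure_le_cofinal_atMost)
    show "uminus -` A \<in> sets borel"
      using measurable_sets[of "uminus :: real \<Rightarrow> real" borel borel A] by simp
    show "uminus -` A \<noteq> {}" using \<open>A \<noteq> {}\<close> by (metis all_not_in_conv minus_minus vimageI)
    fix a assume "a \<in> uminus -` A"
    moreover have "uminus -` A \<inter> {..a} = uminus -` (A \<inter> {-a..})" by auto
    ultimately show "emeasure lborel (uminus -` A \<inter> {..a}) + c \<le> m"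
      using bound[of "-a"] by (simp add: emeasure_lborel_uminus_vimage del: vimage_Int)
  qed
  then show ?thesis by (simp add: emeasure_lborel_uminus_vimage)
qed

text \<open>The set on the left consists of the midpoints of \<open>b\<close> with the points of
  \<open>A\<close>, a copy of \<open>A\<close> at half scale.\<close>

lemma emeasure_lborel_double_vimage:
  fixes A :: "real set"
  assumes [measurable]: "A \<in> sets borel"
  shows "2 * emeasure lborel {z. 2 * z - b \<in> A} = emeasure lborel A"
proof -
  have [measurable]: "{z. 2 * z - b \<in> A} \<in> sets borel"
    by measurable
  have "emeasure lborel A = (\<integral>\<^sup>+ x. indicator A x \<partial>lborel)" by simp
  also have "\<dots> = 2 * (\<integral>\<^sup>+ z. indicator A (-b + 2 * z) \<partial>lborel)"
    by (subst nn_integral_real_affine[where c = 2 and t = "-b"]) auto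
  also have "(\<integral>\<^sup>+ z. indicator A (-b + 2 * z) \<partial>lborel) = (\<integral>\<^sup>+ z. indicator {z. 2 * z - b \<in> A} z \<partial>lborel)"
    by (intro nn_integral_cong) (auto split: split_indicator)
  finally show ?thesis by simp
qed

text \<open>Fix \<open>a\<close> in \<open>A\<close> and \<open>b\<close> in \<open>B\<close>.
  Midpoints of \<open>b\<close> with points of \<open>A\<close> up to \<open>a\<close> lie on the
  left of (a + b) / 2, midpoints of \<open>a\<close> with points of \<open>B\<close> from
  \<open>b\<close> on lie on its right, so two half-scale copies fit into \<open>C\<close> side by
  side. Letting \<open>a\<close> and \<open>b\<close> move through their sets exhausts both; the
  cut-off points must belong to the sets, hence the cofinal limits above. A given Borel set
  \<open>C\<close> in place of the set of all midpoints avoids the measurability of the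
  latter.\<close>

lemma brunn_minkowski_midpoint_real:
  fixes A B C :: "real set"
  assumes [measurable]: "A \<in> sets borel" "B \<in> sets borel" "C \<in> sets borel"
    and "A \<noteq> {}" "B \<noteq> {}"
    and mid: "\<And>x y. x \<in> A \<Longrightarrow> y \<in> B \<Longrightarrow> (x + y) / 2 \<in> C"
  shows "emeasure lborel A + emeasure lborel B \<le> 2 * emeasure lborel C"
proof -
  have key: "emeasure lborel (A \<inter> {..a}) + emeasure lborel (B \<inter> {b..}) \<le> 2 * emeasure lborel C"
    if "a \<in> A" "b \<in> B" for a b
  proof -
    define A1 where "A1 = {z. 2 * z - b \<in> A \<inter> {..a}}"
    define B1 where "B1 = {z. 2 * z - a \<in> B \<inter> {b..}}"
    have [measurable]: "A1 \<in> sets borel" "B1 \<in> sets borel"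
      unfolding A1_def B1_def by measurable
    \<comment> \<open>The two copies share at most the point (a + b) / 2, which is removed from one
      of them.\<close>
    have sub: "A1 \<union> (B1 - {(a + b) / 2}) \<subseteq> C"
      using mid[OF _ \<open>b \<in> B\<close>] mid[OF \<open>a \<in> A\<close>] by (fastforce simp: A1_def B1_def)
    have disj: "A1 \<inter> (B1 - {(a + b) / 2}) = {}" by (auto simp: A1_def B1_def)
    have "emeasure lborel (B1 - {(a + b) / 2}) = emeasure lborel B1"
      by (intro emeasure_Diff_null_set) (auto intro: finite_imp_null_set_lborel)
    then have "emeasure lborel A1 + emeasure lborel B1 = emeasure lborel (A1 \<union> (B1 - {(a + b) / 2}))"
      using disj by (subst plus_emeasure[symmetric]) auto
    also have "\<dots> \<le> emeasure lborel C" using sub by (intro emeasure_mono) auto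
    finally have "2 * (emeasure lborel A1 + emeasure lborel B1) \<le> 2 * emeasure lborel C"
      by (intro mult_left_mono) auto
    then show ?thesis
      unfolding distrib_left A1_def B1_def by (subst (asm) (1 2) emeasure_lborel_double_vimage) auto
  qed
  have "emeasure lborel A + emeasure lborel (B \<inter> {b..}) \<le> 2 * emeasure lborel C" if "b \<in> B" for b
    by (rule emeasure_le_cofinal_atMost[OF assms(1,4) key[OF _ that]])
  then have "emeasure lborel B + emeasure lborel A \<le> 2 * emeasure lborel C"
    by (intro emeasure_le_cofinal_atLeast[OF assms(2,5)]) (simp add: add.commute)
  then show ?thesis by (simp add: add.commute)
qed

lemma nn_integral_layer_cake:
  fixes F :: "'b \<Rightarrow> ennreal"
  assumes "sigma_finite_measure M" and [measurable]: "F \<in> borel_measurable M"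
  shows "(\<integral>\<^sup>+ x. F x \<partial>M) = (\<integral>\<^sup>+ t. indicator {0<..} t * emeasure M {x \<in> space M. ennreal t < F x} \<partial>lborel)"
proof -
  interpret sigma_finite_measure M by fact
  interpret P: pair_sigma_finite M "lborel :: real measure"
    by (intro pair_sigma_finite.intro assms lborel.sigma_finite_measure_axioms)
  have len: "F x = (\<integral>\<^sup>+ t. indicator {0<..} t * indicator {t. ennreal t < F x} t \<partial>lborel)" for x
  proof (cases "F x")
    case (real r)
    have "(\<integral>\<^sup>+ t. indicator {0<..} t * indicator {t. ennreal t < F x} t \<partial>lborel)
        = (\<integral>\<^sup>+ t. indicator {0<..<r} t \<partial>lborel)"
      using real by (intro nn_integral_cong) (auto split: split_indicator simp: ennreal_less_iff)
    then show ?thesis using real by simp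
  next
    case top
    have "(\<integral>\<^sup>+ t. indicator {0<..} t * indicator {t. ennreal t < F x} t \<partial>lborel)
        = (\<integral>\<^sup>+ t. indicator {0<..} t \<partial>(lborel :: real measure))"
      using top by (intro nn_integral_cong) (auto split: split_indicator)
    also have "\<dots> = emeasure lborel ({0<..}::real set)" by simp
    also have "\<dots> = \<infinity>"
    proof (rule ccontr)
      assume "emeasure lborel ({0<..}::real set) \<noteq> \<infinity>"
      then obtain r where r: "emeasure lborel ({0<..}::real set) = ennreal r" "r \<ge> 0"
        by (cases "emeasure lborel ({0<..}::real set)") auto
      have "emeasure lborel {0<..<r+1} \<le> emeasure lborel ({0<..}::real set)"
        by (intro emeasure_mono) auto
      then show False using r by auto
    qed
    finally show ?thesis using top by simp
  qed
  have "(\<integral>\<^sup>+ x. F x \<partial>M) = (\<integral>\<^sup>+ x. \<integral>\<^sup>+ t. indicator {0<..} t * indicator {t. ennreal t < F x} t \<partial>lborel \<partial>M)"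
    by (subst len) simp
  also have "\<dots> = (\<integral>\<^sup>+ t. \<integral>\<^sup>+ x. indicator {0<..} t * indicator {t. ennreal t < F x} t \<partial>M \<partial>lborel)"
    by (intro P.Fubini'[symmetric]) measurable
  also have "\<dots> = (\<integral>\<^sup>+ t. indicator {0<..} t * emeasure M {x \<in> space M. ennreal t < F x} \<partial>lborel)"
  proof (intro nn_integral_cong)
    fix t :: real
    have "(\<integral>\<^sup>+ x. indicator {0<..} t * indicator {t. ennreal t < F x} t \<partial>M)
       = (\<integral>\<^sup>+ x. indicator {0<..} t * indicator {x \<in> space M. ennreal t < F x} x \<partial>M)"
      by (intro nn_integral_cong) (auto split: split_indicator)
    then show "(\<integral>\<^sup>+ x. indicator {0<..} t * indicator {t. ennreal t < F x} t \<partial>M)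
        = indicator {0<..} t * emeasure M {x \<in> space M. ennreal t < F x}"
      by (simp add: nn_integral_cmult)
  qed
  finally show ?thesis .
qed

lemma ennreal_am_gm: "4 * (x * y) \<le> (x + y) * (x + y :: ennreal)"
proof (cases "x = \<infinity> \<or> y = \<infinity>")
  case True
  then show ?thesis by (auto simp: ennreal_top_mult ennreal_mult_top)
next
  case False
  then obtain a b where ab: "x = ennreal a" "y = ennreal b" "a \<ge> 0" "b \<ge> 0"
    by (metis ennreal_cases infinity_ennreal_def)
  have "4 * (a * b) \<le> (a + b) * (a + b)"
    using zero_le_square[of "a - b"] by (simp add: algebra_simps)
  then have "ennreal (4 * (a * b)) \<le> ennreal ((a + b) * (a + b))" by (rule ennreal_leI)
  then show ?thesis using ab by (simp add: ennreal_mult ennreal_plus[symmetric] del: ennreal_plus)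
qed

text \<open>Equal suprema make the superlevel sets of \<open>F\<close> and \<open>G\<close>
  non-empty for the same positive levels, those below 1, as the Brunn-Minkowski inequality requires.
  Integrating it over the levels gives the additive bound \<integral>F + \<integral>G \<le> 2
  \<integral>H, and the arithmetic-geometric mean inequality turns this into the product
  form.\<close>

lemma prekopa_leindler_real_normalized:
  fixes F G H :: "real \<Rightarrow> ennreal"
  assumes [measurable]: "F \<in> borel_measurable borel" "G \<in> borel_measurable borel" "H \<in> borel_measurable borel"
    and FGH: "\<And>x y. F x * G y \<le> H ((x + y) / 2) * H ((x + y) / 2)"
    and F: "(SUP x. F x) = 1" and G: "(SUP x. G x) = 1"
  shows "(\<integral>\<^sup>+ x. F x \<partial>lborel) * (\<integral>\<^sup>+ x. G x \<partial>lborel) \<le> (\<integral>\<^sup>+ x. H x \<partial>lborel) * (\<integral>\<^sup>+ x. H x \<partial>lborel)"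
proof -
  let ?L = "\<lambda>F t. indicator {0<..} t * emeasure lborel {x \<in> space lborel. ennreal t < F x}"
  have lc: "(\<integral>\<^sup>+ x. F' x \<partial>lborel) = (\<integral>\<^sup>+ t. ?L F' t \<partial>lborel)"
    if [measurable]: "F' \<in> borel_measurable borel" for F' :: "real \<Rightarrow> ennreal"
    by (intro nn_integral_layer_cake) (auto intro: lborel.sigma_finite_measure_axioms)
  have [measurable]: "(\<lambda>t. emeasure lborel {x \<in> space lborel. ennreal t < F' x}) \<in> borel_measurable borel"
    if [measurable]: "F' \<in> borel_measurable borel" for F' :: "real \<Rightarrow> ennreal"
    by measurable
  have "(\<integral>\<^sup>+ x. F x \<partial>lborel) + (\<integral>\<^sup>+ x. G x \<partial>lborel) = (\<integral>\<^sup>+ t. ?L F t + ?L G t \<partial>lborel)"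
    unfolding lc[OF assms(1)] lc[OF assms(2)] by (rule nn_integral_add[symmetric]) auto
  also have "\<dots> \<le> (\<integral>\<^sup>+ t. 2 * ?L H t \<partial>lborel)"
  proof (intro nn_integral_mono)
    fix t :: real
    show "?L F t + ?L G t \<le> 2 * ?L H t"
    proof (cases "0 < t \<and> t < 1")
      case True
      then have "ennreal t < 1" by (simp add: ennreal_less_one_iff)
      then have "\<exists>x. ennreal t < F x" "\<exists>x. ennreal t < G x"
        using less_SUP_iff[of "ennreal t" F UNIV] less_SUP_iff[of "ennreal t" G UNIV]
        unfolding F G by blast+
      then have ne: "{x. ennreal t < F x} \<noteq> {}" "{x. ennreal t < G x} \<noteq> {}" by blast+
      have "emeasure lborel {x. ennreal t < F x} + emeasure lborel {x. ennreal t < G x}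
         \<le> 2 * emeasure lborel {x. ennreal t < H x}"
      proof (rule brunn_minkowski_midpoint_real[OF _ _ _ ne])
        fix x y assume "x \<in> {x. ennreal t < F x}" "y \<in> {x. ennreal t < G x}"
        then have lt: "ennreal t < F x" "ennreal t < G y" by auto
        have "ennreal t * ennreal t < F x * ennreal t"
          using lt True by (intro ennreal_mult_strict_right_mono) auto
        also have "\<dots> \<le> F x * G y" using lt by (intro mult_left_mono) auto
        also have "\<dots> \<le> H ((x + y) / 2) * H ((x + y) / 2)" by (rule FGH)
        finally show "(x + y) / 2 \<in> {x. ennreal t < H x}"
          by (metis mem_Collect_eq mult_mono not_le zero_le)
      qed measurable
      then show ?thesis using True by simp
    next
      case False
      have le1: "F x \<le> 1" "G x \<le> 1" for x
        using SUP_upper[of x UNIV F] SUP_upper[of x UNIV G] unfolding F G by simp_all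
      have "{x. ennreal t < F x} = {}" "{x. ennreal t < G x} = {}" if "t \<ge> 1"
      proof -
        have "\<not> ennreal t < F x \<and> \<not> ennreal t < G x" for x
          using le1[of x] order_trans[of _ 1 "ennreal t"] that by (simp add: not_less)
        then show "{x. ennreal t < F x} = {}" "{x. ennreal t < G x} = {}" by auto
      qed
      with False show ?thesis by (cases "t \<ge> 1") auto
    qed
  qed
  also have "\<dots> = 2 * (\<integral>\<^sup>+ x. H x \<partial>lborel)"
    unfolding lc[OF assms(3)] by (rule nn_integral_cmult) auto
  finally have le: "(\<integral>\<^sup>+ x. F x \<partial>lborel) + (\<integral>\<^sup>+ x. G x \<partial>lborel) \<le> 2 * (\<integral>\<^sup>+ x. H x \<partial>lborel)" .
  have "4 * ((\<integral>\<^sup>+ x. F x \<partial>lborel) * (\<integral>\<^sup>+ x. G x \<partial>lborel))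
     \<le> 4 * ((\<integral>\<^sup>+ x. H x \<partial>lborel) * (\<integral>\<^sup>+ x. H x \<partial>lborel))"
    using order_trans[OF ennreal_am_gm mult_mono[OF le le]] by (simp add: ac_simps)
  then show ?thesis
    by (subst (asm) ennreal_mult_le_mult_iff) auto
qed


lemma prekopa_leindler_real_bounded:
  fixes F G H :: "real \<Rightarrow> ennreal"
  assumes [measurable]: "F \<in> borel_measurable borel" "G \<in> borel_measurable borel" "H \<in> borel_measurable borel"
    and FGH: "\<And>x y. F x * G y \<le> H ((x + y) / 2) * H ((x + y) / 2)"
    and F: "\<And>x. F x \<le> ennreal K" and G: "\<And>x. G x \<le> ennreal K"
  shows "(\<integral>\<^sup>+ x. F x \<partial>lborel) * (\<integral>\<^sup>+ x. G x \<partial>lborel) \<le> (\<integral>\<^sup>+ x. H x \<partial>lborel) * (\<integral>\<^sup>+ x. H x \<partial>lborel)"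
proof -
  have "(SUP x. F x) \<le> ennreal K" "(SUP x. G x) \<le> ennreal K" using F G by (auto intro!: SUP_least)
  then have "(SUP x. F x) < top" "(SUP x. G x) < top" by (auto intro: le_less_trans)
  then obtain a b where ab: "(SUP x. F x) = ennreal a" "a \<ge> 0" "(SUP x. G x) = ennreal b" "b \<ge> 0"
    by (cases "SUP x. F x"; cases "SUP x. G x") auto
  show ?thesis
  proof (cases "a = 0 \<or> b = 0")
    case True
    then have "(\<forall>x. F x = 0) \<or> (\<forall>x. G x = 0)"
      using ab by (metis SUP_upper UNIV_I ennreal_0 le_zero_eq)
    then show ?thesis by auto
  next
    case False
    then have pos: "a > 0" "b > 0" using ab by auto
    \<comment> \<open>Factors 1 / a and 1 / b normalise the suprema of \<open>F\<close> and
      \<open>G\<close>; homogeneity of the hypothesis then dictates the factor for \<open>H\<close>,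
      whose square must be their product.\<close>
    define c where "c = 1 / sqrt (a * b)"
    have "c \<ge> 0" "c * c = (1 / a) * (1 / b)" using pos by (auto simp: c_def field_simps)
    then have cc: "ennreal c * ennreal c = ennreal (1 / a) * ennreal (1 / b)"
      using pos by (subst (1 2) ennreal_mult[symmetric]) auto
    have norm: "ennreal (1 / r) * ennreal r = 1" if "r > 0" for r :: real
      using that by (subst ennreal_mult[symmetric]) auto
    have "(\<integral>\<^sup>+ x. ennreal (1 / a) * F x \<partial>lborel) * (\<integral>\<^sup>+ x. ennreal (1 / b) * G x \<partial>lborel)
       \<le> (\<integral>\<^sup>+ x. ennreal c * H x \<partial>lborel) * (\<integral>\<^sup>+ x. ennreal c * H x \<partial>lborel)"
    proof (rule prekopa_leindler_real_normalized)
      show "(SUP x. ennreal (1 / a) * F x) = 1" "(SUP x. ennreal (1 / b) * G x) = 1"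
        using ab norm pos by (simp_all add: SUP_mult_left_ennreal[symmetric])
      fix x y
      have "ennreal (1 / a) * F x * (ennreal (1 / b) * G y) = ennreal c * ennreal c * (F x * G y)"
        unfolding cc by (simp add: ac_simps)
      also have "\<dots> \<le> ennreal c * ennreal c * (H ((x + y) / 2) * H ((x + y) / 2))"
        by (intro mult_left_mono FGH) auto
      finally show "ennreal (1 / a) * F x * (ennreal (1 / b) * G y)
          \<le> ennreal c * H ((x + y) / 2) * (ennreal c * H ((x + y) / 2))"
        by (simp add: ac_simps)
    qed measurable
    then have "(ennreal (1 / a) * ennreal (1 / b)) * ((\<integral>\<^sup>+ x. F x \<partial>lborel) * (\<integral>\<^sup>+ x. G x \<partial>lborel))
       \<le> (ennreal c * ennreal c) * ((\<integral>\<^sup>+ x. H x \<partial>lborel) * (\<integral>\<^sup>+ x. H x \<partial>lborel))"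
      by (simp add: nn_integral_cmult) (simp add: ac_simps)
    then show ?thesis unfolding cc using pos
      by (subst (asm) ennreal_mult_le_mult_iff) (auto simp: ennreal_mult_eq_top_iff ennreal_eq_0_iff)
  qed
qed

text \<open>Only \<open>F\<close> and \<open>G\<close> are truncated. This lowers the left-hand side
  of the hypothesis, so the same \<open>H\<close> serves all truncation levels. The two levels are
  independent because the suprema of the two integrals are taken separately.\<close>

lemma prekopa_leindler_real:
  fixes F G H :: "real \<Rightarrow> ennreal"
  assumes [measurable]: "F \<in> borel_measurable borel" "G \<in> borel_measurable borel" "H \<in> borel_measurable borel"
    and FGH: "\<And>x y. F x * G y \<le> H ((x + y) / 2) * H ((x + y) / 2)"
  shows "(\<integral>\<^sup>+ x. F x \<partial>lborel) * (\<integral>\<^sup>+ x. G x \<partial>lborel) \<le> (\<integral>\<^sup>+ x. H x \<partial>lborel) * (\<integral>\<^sup>+ x. H x \<partial>lborel)"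
proof -
  define T where "T E k x = min (E x) (of_nat k)" for E :: "real \<Rightarrow> ennreal" and k :: nat and x
  have T_meas[measurable]: "T E k \<in> borel_measurable borel" if [measurable]: "E \<in> borel_measurable borel" for E k
    unfolding T_def by measurable
  have inc: "incseq (T E)" for E
    unfolding T_def incseq_def le_fun_def by (intro allI impI min.mono order_refl of_nat_mono)
  have SUP_T: "(SUP k. T E k x) = E x" for E x
    using inf_SUP[of "E x" "of_nat :: nat \<Rightarrow> ennreal" UNIV] ennreal_SUP_of_nat_eq_top
    by (simp add: T_def inf_min)
  have int: "(\<integral>\<^sup>+ x. E x \<partial>lborel) = (SUP k. \<integral>\<^sup>+ x. T E k x \<partial>lborel)" if [measurable]: "E \<in> borel_measurable borel" for E
    using nn_integral_monotone_convergence_SUP[OF inc[of E], where M = lborel] by (simp add: SUP_T)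
  have le: "(\<integral>\<^sup>+ x. T F i x \<partial>lborel) * (\<integral>\<^sup>+ x. T G j x \<partial>lborel) \<le> (\<integral>\<^sup>+ x. H x \<partial>lborel) * (\<integral>\<^sup>+ x. H x \<partial>lborel)" for i j
  proof (rule prekopa_leindler_real_bounded)
    show "T F i x * T G j y \<le> H ((x + y) / 2) * H ((x + y) / 2)" for x y
      by (rule order_trans[OF mult_mono FGH]) (auto simp: T_def)
    show "T F i x \<le> ennreal (of_nat (max i j))" "T G j x \<le> ennreal (of_nat (max i j))" for x
      by (auto simp: T_def ennreal_of_nat_eq_real_of_nat intro!: min.coboundedI2 ennreal_leI)
  qed measurable
  show ?thesis
    unfolding int[OF assms(1)] int[OF assms(2)]
    by (subst SUP_mult_right_ennreal, subst SUP_mult_left_ennreal) (intro SUP_least le)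
qed

section \<open>Prekopa-Leindler inequality in finitely many coordinates\<close>

interpretation lborel_product: product_sigma_finite "\<lambda>_ :: 'i. lborel :: real measure"
  by standard

text \<open>Tensorisation: for fixed remaining coordinates the one-dimensional inequality in the new
  coordinate says that the inner integrals again satisfy the hypothesis, so the induction hypothesis
  applies to them.\<close>

lemma prekopa_leindler_PiM:
  fixes I :: "'i set" and F G H :: "('i \<Rightarrow> real) \<Rightarrow> ennreal"
  defines "V \<equiv> Pi\<^sub>M I (\<lambda>_. lborel :: real measure)"
  assumes "finite I"
    and "F \<in> borel_measurable V" "G \<in> borel_measurable V" "H \<in> borel_measurable V"
    and "\<And>x y. x \<in> space V \<Longrightarrow> y \<in> space V \<Longrightarrow>
        F x * G y \<le> H (\<lambda>i\<in>I. (x i + y i) / 2) * H (\<lambda>i\<in>I. (x i + y i) / 2)"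
  shows "(\<integral>\<^sup>+ x. F x \<partial>V) * (\<integral>\<^sup>+ x. G x \<partial>V) \<le> (\<integral>\<^sup>+ x. H x \<partial>V) * (\<integral>\<^sup>+ x. H x \<partial>V)"
  using assms(2-) unfolding V_def
proof (induction I arbitrary: F G H rule: finite_induct)
  case empty
  show ?case
    using empty(4)[of "\<lambda>_. undefined" "\<lambda>_. undefined"] by (simp add: lborel_product.nn_integral_empty space_PiM restrict_def)
next
  case (insert i I)
  let ?V = "Pi\<^sub>M I (\<lambda>_. lborel :: real measure)" and ?W = "Pi\<^sub>M (insert i I) (\<lambda>_. lborel :: real measure)"
  have meas1: "(\<lambda>x. \<integral>\<^sup>+ s. E (x(i := s)) \<partial>lborel) \<in> borel_measurable ?V"
    if [measurable]: "E \<in> borel_measurable ?W" for E :: "('i \<Rightarrow> real) \<Rightarrow> ennreal"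
    by measurable
  have meas2: "(\<lambda>s. E (x(i := s))) \<in> borel_measurable borel"
    if "E \<in> borel_measurable ?W" "x \<in> space ?V" for E :: "('i \<Rightarrow> real) \<Rightarrow> ennreal" and x
    using measurable_compose[OF measurable_component_update[OF that(2) insert(2)] that(1)] by simp
  have "(\<integral>\<^sup>+ x. \<integral>\<^sup>+ s. F (x(i := s)) \<partial>lborel \<partial>?V) * (\<integral>\<^sup>+ x. \<integral>\<^sup>+ s. G (x(i := s)) \<partial>lborel \<partial>?V)
     \<le> (\<integral>\<^sup>+ x. \<integral>\<^sup>+ s. H (x(i := s)) \<partial>lborel \<partial>?V) * (\<integral>\<^sup>+ x. \<integral>\<^sup>+ s. H (x(i := s)) \<partial>lborel \<partial>?V)"
  proof (rule insert.IH[OF meas1 meas1 meas1])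
    fix x y assume xy: "x \<in> space ?V" "y \<in> space ?V"
    let ?m = "\<lambda>i\<in>I. (x i + y i) / 2"
    have m: "?m \<in> space ?V" by (auto simp: space_PiM)
    show "(\<integral>\<^sup>+ s. F (x(i := s)) \<partial>lborel) * (\<integral>\<^sup>+ s. G (y(i := s)) \<partial>lborel)
        \<le> (\<integral>\<^sup>+ s. H (?m(i := s)) \<partial>lborel) * (\<integral>\<^sup>+ s. H (?m(i := s)) \<partial>lborel)"
    proof (rule prekopa_leindler_real)
      fix s t
      have "x(i := s) \<in> space ?W" "y(i := t) \<in> space ?W"
        using xy by (auto simp: space_PiM PiE_def extensional_def)
      moreover have "(\<lambda>j\<in>insert i I. ((x(i := s)) j + (y(i := t)) j) / 2) = ?m(i := (s + t) / 2)"
        using insert(2) by (auto simp: fun_eq_iff)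
      ultimately show "F (x(i := s)) * G (y(i := t)) \<le> H (?m(i := (s + t) / 2)) * H (?m(i := (s + t) / 2))"
        using insert.prems(4)[of "x(i := s)" "y(i := t)"] by metis
    qed (use meas2 insert.prems xy m in auto)
  qed (use insert.prems in auto)
  then show ?case
    using insert.hyps insert.prems by (simp add: lborel_product.product_nn_integral_insert)
qed

subsection \<open>Integrals over sliding boxes\<close>

text \<open>For non-negative \<open>a\<close> and \<open>b\<close>, the length of the part of
  [t - b, t + b] inside the window (-a, a). Writing it as a minimum of concave functions cut off at
  0 exposes the concavity used below.\<close>

definition trapezoid :: "real \<Rightarrow> real \<Rightarrow> real \<Rightarrow> real" where
  "trapezoid b a t = max 0 (min (2 * b) (min (2 * a) (b + a - \<bar>t\<bar>)))"

lemma trapezoid_nonneg [simp]: "0 \<le> trapezoid b a t"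
  and trapezoid_le: "0 \<le> a \<Longrightarrow> trapezoid b a t \<le> 2 * a"
  and trapezoid_minus [simp]: "trapezoid b a (- t) = trapezoid b a t"
  and trapezoid_0 [simp]: "trapezoid 0 a t = 0"
  and trapezoid_mono: "b \<le> b' \<Longrightarrow> trapezoid b a t \<le> trapezoid b' a t"
  by (auto simp: trapezoid_def)

text \<open>The cut-off at 0 destroys concavity, but if one factor vanishes there is nothing to
  show. If both are positive, the minimum of concave functions is concave along the segment, and the
  arithmetic-geometric mean inequality passes to products.\<close>

lemma trapezoid_midpoint:
  "trapezoid b a s * trapezoid b a t \<le> trapezoid b a ((s + t) / 2) * trapezoid b a ((s + t) / 2)"
proof (cases "trapezoid b a s = 0 \<or> trapezoid b a t = 0")
  case False
  define m where "m = trapezoid b a ((s + t) / 2)"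
  have "\<bar>(s + t) / 2\<bar> \<le> (\<bar>s\<bar> + \<bar>t\<bar>) / 2" by (simp add: abs_triangle_ineq)
  then have m: "trapezoid b a s + trapezoid b a t \<le> 2 * m"
  proof -
    have le: "trapezoid b a r \<le> 2 * b \<and> trapezoid b a r \<le> 2 * a \<and> trapezoid b a r \<le> b + a - \<bar>r\<bar>"
      if "trapezoid b a r \<noteq> 0" for r
      using that by (auto simp: trapezoid_def max_def)
    define S T where "S = trapezoid b a s" and "T = trapezoid b a t"
    have ST: "S \<le> 2 * b" "S \<le> 2 * a" "S \<le> b + a - \<bar>s\<bar>" "T \<le> 2 * b" "T \<le> 2 * a" "T \<le> b + a - \<bar>t\<bar>"
      using le[of s] le[of t] False by (auto simp: S_def T_def)
    have "(S + T) / 2 \<le> b + a - m'"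
      if "S \<le> b + a - s'" "T \<le> b + a - t'" "m' \<le> (s' + t') / 2" for s' t' m' :: real
      using that by argo
    from this[OF ST(3,6) \<open>\<bar>(s + t) / 2\<bar> \<le> (\<bar>s\<bar> + \<bar>t\<bar>) / 2\<close>]
    have "(S + T) / 2 \<le> min (2 * b) (min (2 * a) (b + a - \<bar>(s + t) / 2\<bar>))"
      using ST by simp
    also have "\<dots> \<le> m" by (simp add: m_def trapezoid_def)
    finally show ?thesis by (simp add: S_def T_def)
  qed
  have "4 * (trapezoid b a s * trapezoid b a t) \<le> (trapezoid b a s + trapezoid b a t) * (trapezoid b a s + trapezoid b a t)"
    using zero_le_square[of "trapezoid b a s - trapezoid b a t"] by (simp add: algebra_simps)
  also have "\<dots> \<le> (2 * m) * (2 * m)" by (intro mult_mono m) (auto simp: m_def)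
  finally show ?thesis by (simp add: m_def)
qed auto

lemma continuous_on_trapezoid [continuous_intros]:
  "continuous_on S f \<Longrightarrow> continuous_on S (\<lambda>x. trapezoid b a (f x))"
  unfolding trapezoid_def by (intro continuous_intros)

lemma trapezoid_measurable [measurable]: "trapezoid b a \<in> borel_measurable borel"
  unfolding trapezoid_def by measurable

lemma emeasure_Icc_Int_slab:
  assumes "0 \<le> b" "0 \<le> a"
  shows "emeasure lborel ({c - b..c + b} \<inter> {s. \<bar>s + l\<bar> < a}) = ennreal (trapezoid b a (c + l))"
proof -
  define p q where "p = max (c - b) (- l - a)" and "q = min (c + b) (a - l)"
  have eq: "trapezoid b a (c + l) = max 0 (q - p)"
    using assms by (auto simp: trapezoid_def p_def q_def max_def min_def abs_if)
  have "emeasure lborel {p<..<q} \<le> emeasure lborel ({c - b..c + b} \<inter> {s. \<bar>s + l\<bar> < a})"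
    by (intro emeasure_mono) (auto simp: p_def q_def)
  moreover have "emeasure lborel ({c - b..c + b} \<inter> {s. \<bar>s + l\<bar> < a}) \<le> emeasure lborel {p..q}"
    by (intro emeasure_mono) (auto simp: p_def q_def)
  moreover have "emeasure lborel {p<..<q} = ennreal (max 0 (q - p))" "emeasure lborel {p..q} = ennreal (max 0 (q - p))"
    by (cases "p \<le> q"; simp)+
  ultimately show ?thesis unfolding eq by (metis antisym)
qed

text \<open>The nearest points of \<open>S\<close> on either side of x have their midpoint in
  \<open>S\<close>; unless they coincide, that midpoint would be nearer to x.\<close>

lemma closed_midpoint_closed_contains_Icc:
  fixes S :: "real set"
  assumes "closed S" "a \<in> S" "b \<in> S" "\<And>x y. x \<in> S \<Longrightarrow> y \<in> S \<Longrightarrow> (x + y) / 2 \<in> S"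
  shows "{a..b} \<subseteq> S"
proof
  fix x assume x: "x \<in> {a..b}"
  define l u where "l = Sup (S \<inter> {..x})" and "u = Inf (S \<inter> {x..})"
  have l: "l \<in> S \<inter> {..x}" unfolding l_def
    using x assms by (intro closed_contains_Sup closed_Int) auto
  have u: "u \<in> S \<inter> {x..}" unfolding u_def
    using x assms by (intro closed_contains_Inf closed_Int) auto
  have m: "(l + u) / 2 \<in> S" using assms(4) l u by auto
  show "x \<in> S"
  proof (cases "(l + u) / 2 \<le> x")
    case True
    then have "(l + u) / 2 \<le> l" unfolding l_def[of] using m
      by (intro cSup_upper) (auto simp: l_def[symmetric])
    then have "u \<le> l" by simp
    then have "x = l" using l u by auto
    then show ?thesis using l by simp
  next
    case False
    then have "u \<le> (l + u) / 2" unfolding u_def using m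
      by (intro cInf_lower) (auto simp: u_def[symmetric])
    then have "u \<le> l" by simp
    then have "x = l" using l u by auto
    then show ?thesis using l by simp
  qed
qed

section \<open>One interval per index: dilating the centres\<close>

definition lin :: "'i set \<Rightarrow> ('i \<Rightarrow> real) \<Rightarrow> ('i \<Rightarrow> real) \<Rightarrow> real" where
  "lin I x v = (\<Sum>j\<in>I. x j * v j)"

abbreviation coords :: "'i set \<Rightarrow> ('i \<Rightarrow> real) measure" where
  "coords I \<equiv> Pi\<^sub>M I (\<lambda>_. lborel)"

text \<open>The parameter of \<open>ball_sq\<close> is the squared radius; the ball is empty if it is negative.\<close>

definition ball_sq :: "'i set \<Rightarrow> real \<Rightarrow> ('i \<Rightarrow> real) set" where
  "ball_sq I \<rho> = {v \<in> space (coords I). (\<Sum>j\<in>I. (v j)\<^sup>2) < \<rho>}"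

lemma lin_measurable [measurable]: "lin I x \<in> borel_measurable (coords I)"
  unfolding lin_def by measurable

lemma ball_sq_measurable [measurable]: "ball_sq I \<rho> \<in> sets (coords I)"
  unfolding ball_sq_def by measurable

lemma emeasure_cball2_finite:
  assumes "finite I" shows "emeasure (coords I) (ball_sq I \<rho>) < \<infinity>"
proof -
  \<comment> \<open>The lower bound 1 ensures \<open>\<rho> \<le> r\<^sup>2\<close>, so that
    \<open>r\<close> bounds every coordinate.\<close>
  define r where "r = max 1 \<rho>"
  have "ball_sq I \<rho> \<subseteq> Pi\<^sub>E I (\<lambda>_. {-r..r})"
  proof
    fix v assume v: "v \<in> ball_sq I \<rho>"
    have "\<bar>v j\<bar> \<le> r" if "j \<in> I" for j
    proof -
      have "(v j)\<^sup>2 \<le> (\<Sum>j\<in>I. (v j)\<^sup>2)" using assms that by (intro member_le_sum) auto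
      also have "\<dots> \<le> r" using v by (auto simp: ball_sq_def r_def)
      also have "\<dots> \<le> r\<^sup>2" by (auto simp: r_def power2_eq_square mult_le_cancel_left1)
      finally show ?thesis using abs_le_square_iff[of "v j" r] by (simp add: r_def)
    qed
    then show "v \<in> Pi\<^sub>E I (\<lambda>_. {-r..r})"
      using v by (auto simp: ball_sq_def space_PiM PiE_def Pi_def abs_le_iff) (smt (verit))+
  qed
  then have "emeasure (coords I) (ball_sq I \<rho>) \<le> emeasure (coords I) (Pi\<^sub>E I (\<lambda>_. {-r..r}))"
    by (intro emeasure_mono sets_PiM_I_finite) (auto simp: assms)
  also have "\<dots> = (\<Prod>j\<in>I. emeasure lborel {-r..r})"
    using assms by (intro lborel_product.emeasure_PiM) auto
  also have "\<dots> < \<infinity>" by (auto simp: r_def ennreal_prod_eq_top prod_constant power_less_top_ennreal)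
  finally show ?thesis .
qed

lemma nn_integral_coords_uminus:
  assumes "finite I" and [measurable]: "F \<in> borel_measurable (coords I)"
  shows "(\<integral>\<^sup>+ v. F (\<lambda>j\<in>I. - v j) \<partial>coords I) = (\<integral>\<^sup>+ v. F v \<partial>coords I)"
proof -
  have [measurable]: "(\<lambda>v. \<lambda>j\<in>I. - v j) \<in> coords I \<rightarrow>\<^sub>M coords I" by measurable
  have "distr (coords I) (coords I) (\<lambda>v. \<lambda>j\<in>I. - v j) = coords I"
  proof (rule lborel_product.PiM_eqI[OF \<open>finite I\<close>])
    fix A :: "'a \<Rightarrow> real set" assume A: "\<And>i. i \<in> I \<Longrightarrow> A i \<in> sets lborel"
    then have [measurable]: "Pi\<^sub>E I A \<in> sets (coords I)" using \<open>finite I\<close> by (intro sets_PiM_I_finite)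
    have "(\<lambda>v. \<lambda>j\<in>I. - v j) -` Pi\<^sub>E I A \<inter> space (coords I) = Pi\<^sub>E I (\<lambda>i. uminus -` A i)"
      by (auto simp: space_PiM PiE_def Pi_def)
    then have "emeasure (distr (coords I) (coords I) (\<lambda>v. \<lambda>j\<in>I. - v j)) (Pi\<^sub>E I A)
        = emeasure (coords I) (Pi\<^sub>E I (\<lambda>i. uminus -` A i))"
      by (simp add: emeasure_distr)
    also have "\<dots> = (\<Prod>i\<in>I. emeasure lborel (uminus -` A i))"
    proof (rule lborel_product.emeasure_PiM[OF \<open>finite I\<close>])
      fix i assume "i \<in> I"
      then show "uminus -` A i \<in> sets lborel"
        using measurable_sets[of "uminus :: real \<Rightarrow> real" borel borel "A i"] A by simp
    qed
    also have "\<dots> = (\<Prod>i\<in>I. emeasure lborel (A i))"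
      using A by (intro prod.cong) (auto simp: emeasure_lborel_uminus_vimage)
    finally show "emeasure (distr (coords I) (coords I) (\<lambda>v. \<lambda>j\<in>I. - v j)) (Pi\<^sub>E I A) = (\<Prod>i\<in>I. emeasure lborel (A i))" .
  qed simp
  then have "(\<integral>\<^sup>+ v. F v \<partial>coords I) = (\<integral>\<^sup>+ v. F v \<partial>distr (coords I) (coords I) (\<lambda>v. \<lambda>j\<in>I. - v j))"
    by simp
  also have "\<dots> = (\<integral>\<^sup>+ v. F (\<lambda>j\<in>I. - v j) \<partial>coords I)" by (intro nn_integral_distr) auto
  finally show ?thesis by simp
qed

text \<open>What remains in the transverse variable \<open>v\<close> of y once the coordinates along
  the direction are integrated out, when the i-th set is an interval with centre \<open>c i\<close>
  and half-length \<open>b i\<close>. The linear form displaces the window of half-width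
  \<open>\<alpha> i\<close>.\<close>

definition box_integrand ::
    "'i set \<Rightarrow> real \<Rightarrow> nat \<Rightarrow> (nat \<Rightarrow> 'i \<Rightarrow> real) \<Rightarrow> (nat \<Rightarrow> real) \<Rightarrow> (nat \<Rightarrow> real) \<Rightarrow> (nat \<Rightarrow> real) \<Rightarrow> ('i \<Rightarrow> real) \<Rightarrow> real" where
  "box_integrand I \<rho> N x \<alpha> b c v =
     indicator (ball_sq I \<rho>) v * (\<Prod>i<N. trapezoid (b i) (\<alpha> i) (c i + lin I (x i) v))"

lemma box_integrand_measurable [measurable]: "box_integrand I \<rho> N x \<alpha> b c \<in> borel_measurable (coords I)"
  unfolding box_integrand_def by measurable

lemma box_integrand_nonneg [simp]: "0 \<le> box_integrand I \<rho> N x \<alpha> b c v"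
  unfolding box_integrand_def by (auto intro!: mult_nonneg_nonneg prod_nonneg)

lemma ball_sq_midpoint:
  assumes "u \<in> ball_sq I \<rho>" "v \<in> ball_sq I \<rho>"
  shows "(\<lambda>j\<in>I. (u j + v j) / 2) \<in> ball_sq I \<rho>"
proof -
  have "(\<Sum>j\<in>I. ((u j + v j) / 2)\<^sup>2) \<le> (\<Sum>j\<in>I. ((u j)\<^sup>2 + (v j)\<^sup>2) / 2)"
  proof (rule sum_mono)
    fix j show "((u j + v j) / 2)\<^sup>2 \<le> ((u j)\<^sup>2 + (v j)\<^sup>2) / 2"
      using zero_le_square[of "u j - v j"] by (simp add: power2_eq_square field_simps)
  qed
  also have "\<dots> = ((\<Sum>j\<in>I. (u j)\<^sup>2) + (\<Sum>j\<in>I. (v j)\<^sup>2)) / 2"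
    by (simp add: sum_divide_distrib[symmetric] sum.distrib)
  also have "\<dots> < \<rho>" using assms by (simp add: ball_sq_def)
  finally show ?thesis by (simp add: ball_sq_def space_PiM)
qed

text \<open>The argument of each trapezoid is linear in the pair of dilation factor and
  \<open>v\<close>, so log-concavity holds jointly in this pair; convexity of the ball takes care of
  the indicator.\<close>

lemma box_integrand_midpoint:
  assumes "u \<in> space (coords I)" "v \<in> space (coords I)"
  shows "box_integrand I \<rho> N x \<alpha> b (\<lambda>i. s * c i) u * box_integrand I \<rho> N x \<alpha> b (\<lambda>i. t * c i) v
    \<le> (box_integrand I \<rho> N x \<alpha> b (\<lambda>i. (s + t) / 2 * c i) (\<lambda>j\<in>I. (u j + v j) / 2))\<^sup>2"
proof (cases "u \<in> ball_sq I \<rho> \<and> v \<in> ball_sq I \<rho>")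
  case True
  let ?m = "\<lambda>j\<in>I. (u j + v j) / 2"
  have lin: "(s + t) / 2 * c i + lin I (x i) ?m = ((s * c i + lin I (x i) u) + (t * c i + lin I (x i) v)) / 2" for i
  proof -
    have "lin I (x i) ?m = (lin I (x i) u + lin I (x i) v) / 2"
      unfolding lin_def by (simp add: sum.distrib[symmetric] sum_divide_distrib algebra_simps)
    then show ?thesis by (simp add: field_simps)
  qed
  have "(\<Prod>i<N. trapezoid (b i) (\<alpha> i) (s * c i + lin I (x i) u)) * (\<Prod>i<N. trapezoid (b i) (\<alpha> i) (t * c i + lin I (x i) v))
      \<le> (\<Prod>i<N. trapezoid (b i) (\<alpha> i) ((s + t) / 2 * c i + lin I (x i) ?m)) * (\<Prod>i<N. trapezoid (b i) (\<alpha> i) ((s + t) / 2 * c i + lin I (x i) ?m))"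
    unfolding lin prod.distrib[symmetric]
    by (intro prod_mono conjI trapezoid_midpoint) auto
  then show ?thesis using True ball_sq_midpoint[of u I \<rho> v]
    by (simp add: box_integrand_def power2_eq_square)
qed (auto simp: box_integrand_def)

text \<open>The marginal \<phi> inherits midpoint log-concavity, and the substitution of -v for v
  makes it even since trapezoids are even. Continuity upgrades midpoints to whole segments: the
  dilation factors at which \<phi> is at least its value at 1 form a closed set that contains -1 and
  1 and is stable under midpoints.\<close>

lemma box_integral_antimono:
  fixes N :: nat
  assumes "finite I" and \<alpha>: "\<And>i. 0 \<le> \<alpha> i" and \<sigma>: "0 \<le> \<sigma>" "\<sigma> \<le> 1"
  shows "(\<integral>\<^sup>+ v. ennreal (box_integrand I \<rho> N x \<alpha> b c v) \<partial>coords I)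
       \<le> (\<integral>\<^sup>+ v. ennreal (box_integrand I \<rho> N x \<alpha> b (\<lambda>i. \<sigma> * c i) v) \<partial>coords I)"
proof -
  define \<phi> where "\<phi> \<tau> = (\<integral>\<^sup>+ v. ennreal (box_integrand I \<rho> N x \<alpha> b (\<lambda>i. \<tau> * c i) v) \<partial>coords I)" for \<tau>
  have mid: "\<phi> s * \<phi> t \<le> \<phi> ((s + t) / 2) * \<phi> ((s + t) / 2)" for s t
    unfolding \<phi>_def
  proof (rule prekopa_leindler_PiM[OF \<open>finite I\<close>])
    fix u v assume "u \<in> space (coords I)" "v \<in> space (coords I)"
    from ennreal_leI[OF box_integrand_midpoint[OF this, of \<rho> N x \<alpha> b s c t]]
    show "ennreal (box_integrand I \<rho> N x \<alpha> b (\<lambda>i. s * c i) u) * ennreal (box_integrand I \<rho> N x \<alpha> b (\<lambda>i. t * c i) v)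
      \<le> ennreal (box_integrand I \<rho> N x \<alpha> b (\<lambda>i. (s + t) / 2 * c i) (\<lambda>j\<in>I. (u j + v j) / 2))
        * ennreal (box_integrand I \<rho> N x \<alpha> b (\<lambda>i. (s + t) / 2 * c i) (\<lambda>j\<in>I. (u j + v j) / 2))"
      by (simp add: ennreal_mult power2_eq_square)
  qed measurable
  have even: "\<phi> (- \<tau>) = \<phi> \<tau>" for \<tau>
  proof -
    have "\<phi> \<tau> = (\<integral>\<^sup>+ v. ennreal (box_integrand I \<rho> N x \<alpha> b (\<lambda>i. \<tau> * c i) (\<lambda>j\<in>I. - v j)) \<partial>coords I)"
      unfolding \<phi>_def by (intro nn_integral_coords_uminus[symmetric] \<open>finite I\<close>) measurable
    also have "\<dots> = \<phi> (- \<tau>)" unfolding \<phi>_def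
    proof (intro nn_integral_cong arg_cong[of _ _ ennreal])
      fix v assume v: "v \<in> space (coords I)"
      have lin: "\<tau> * c i + lin I (x i) (\<lambda>j\<in>I. - v j) = - (- \<tau> * c i + lin I (x i) v)" for i
        by (simp add: lin_def sum_negf)
      have ball: "(\<lambda>j\<in>I. - v j) \<in> ball_sq I \<rho> \<longleftrightarrow> v \<in> ball_sq I \<rho>"
        using v by (auto simp: ball_sq_def space_PiM)
      show "box_integrand I \<rho> N x \<alpha> b (\<lambda>i. \<tau> * c i) (\<lambda>j\<in>I. - v j) = box_integrand I \<rho> N x \<alpha> b (\<lambda>i. - \<tau> * c i) v"
        unfolding box_integrand_def lin trapezoid_minus by (auto simp: ball split: split_indicator)
    qed
    finally show ?thesis by simp
  qed
  have cont: "(\<lambda>n. \<phi> (X n)) \<longlonglongrightarrow> \<phi> t" if X: "X \<longlonglongrightarrow> t" for X t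
    unfolding \<phi>_def
  proof (rule nn_integral_dominated_convergence)
    let ?w = "\<lambda>v. ennreal (\<Prod>i<N. 2 * \<alpha> i) * indicator (ball_sq I \<rho>) v"
    show "(\<integral>\<^sup>+ v. ?w v \<partial>coords I) < \<infinity>"
      using emeasure_cball2_finite[OF \<open>finite I\<close>, of \<rho>] by (simp add: nn_integral_cmult ennreal_mult_less_top)
    show "AE v in coords I. ennreal (box_integrand I \<rho> N x \<alpha> b (\<lambda>i. X n * c i) v) \<le> ?w v" for n
    proof (rule AE_I2)
      fix v
      have "(\<Prod>i<N. trapezoid (b i) (\<alpha> i) (X n * c i + lin I (x i) v)) \<le> (\<Prod>i<N. 2 * \<alpha> i)"
        by (intro prod_mono conjI trapezoid_le \<alpha>) auto
      then show "ennreal (box_integrand I \<rho> N x \<alpha> b (\<lambda>i. X n * c i) v) \<le> ?w v"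
        by (auto simp: box_integrand_def split: split_indicator intro!: ennreal_leI)
    qed
    show "AE v in coords I. (\<lambda>n. ennreal (box_integrand I \<rho> N x \<alpha> b (\<lambda>i. X n * c i) v))
        \<longlonglongrightarrow> ennreal (box_integrand I \<rho> N x \<alpha> b (\<lambda>i. t * c i) v)"
    proof (rule AE_I2)
      fix v
      have "continuous_on UNIV (\<lambda>t. box_integrand I \<rho> N x \<alpha> b (\<lambda>i. t * c i) v)"
        unfolding box_integrand_def by (intro continuous_intros)
      then have "isCont (\<lambda>t. box_integrand I \<rho> N x \<alpha> b (\<lambda>i. t * c i) v) t"
        by (simp add: continuous_on_eq_continuous_at)
      from isCont_tendsto_compose[OF this X]
      show "(\<lambda>n. ennreal (box_integrand I \<rho> N x \<alpha> b (\<lambda>i. X n * c i) v))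
        \<longlonglongrightarrow> ennreal (box_integrand I \<rho> N x \<alpha> b (\<lambda>i. t * c i) v)"
        by (intro tendsto_ennrealI)
    qed
  qed measurable
  have "{-1..1} \<subseteq> {t. \<phi> 1 \<le> \<phi> t}"
  proof (rule closed_midpoint_closed_contains_Icc)
    show "closed {t. \<phi> 1 \<le> \<phi> t}"
      unfolding closed_sequential_limits
    proof (intro allI impI, elim conjE)
      fix X l assume "\<forall>n. X n \<in> {t. \<phi> 1 \<le> \<phi> t}" "X \<longlonglongrightarrow> l"
      then show "l \<in> {t. \<phi> 1 \<le> \<phi> t}" using LIMSEQ_le_const[OF cont[of X l]] by auto
    qed
    show "-1 \<in> {t. \<phi> 1 \<le> \<phi> t}" using even[of 1] by simp
    fix s t assume st: "s \<in> {t. \<phi> 1 \<le> \<phi> t}" "t \<in> {t. \<phi> 1 \<le> \<phi> t}"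
    show "(s + t) / 2 \<in> {t. \<phi> 1 \<le> \<phi> t}"
    proof (rule ccontr)
      assume "\<not> ?thesis"
      then have lt: "\<phi> ((s + t) / 2) < \<phi> 1" by simp
      have "\<phi> 1 * \<phi> 1 \<le> \<phi> s * \<phi> t" using st by (intro mult_mono) auto
      also note mid
      finally have le: "\<phi> 1 * \<phi> 1 \<le> \<phi> ((s + t) / 2) * \<phi> ((s + t) / 2)" .
      \<comment> \<open>Finiteness is what lets the strict inequality survive squaring.\<close>
      have "\<phi> 1 < \<infinity>"
      proof -
        have "\<phi> 1 \<le> (\<integral>\<^sup>+ v. ennreal (\<Prod>i<N. 2 * \<alpha> i) * indicator (ball_sq I \<rho>) v \<partial>coords I)"
          unfolding \<phi>_def
        proof (rule nn_integral_mono)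
          fix v
          have "(\<Prod>i<N. trapezoid (b i) (\<alpha> i) (1 * c i + lin I (x i) v)) \<le> (\<Prod>i<N. 2 * \<alpha> i)"
            by (intro prod_mono conjI trapezoid_le \<alpha>) auto
          then show "ennreal (box_integrand I \<rho> N x \<alpha> b (\<lambda>i. 1 * c i) v) \<le> ennreal (\<Prod>i<N. 2 * \<alpha> i) * indicator (ball_sq I \<rho>) v"
            by (auto simp: box_integrand_def split: split_indicator intro!: ennreal_leI)
        qed
        also have "\<dots> < \<infinity>"
          using emeasure_cball2_finite[OF \<open>finite I\<close>, of \<rho>] by (simp add: nn_integral_cmult ennreal_mult_less_top)
        finally show ?thesis .
      qed
      then obtain p q where pq: "\<phi> 1 = ennreal p" "\<phi> ((s + t) / 2) = ennreal q" "p \<ge> 0" "q \<ge> 0"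
        using lt by (cases "\<phi> 1"; cases "\<phi> ((s + t) / 2)") auto
      have "q < p" using lt pq by (simp add: ennreal_less_iff)
      then have "q * q < p * p" using pq by (intro mult_strict_mono') auto
      then show False using le pq by (simp add: ennreal_mult[symmetric])
    qed
  qed simp
  from subsetD[OF this, of \<sigma>] have "\<phi> 1 \<le> \<phi> \<sigma>" using \<sigma> by simp
  then show ?thesis by (simp add: \<phi>_def)
qed

section \<open>Several intervals per index: sliding and merging\<close>

definition multi_integrand ::
    "'i set \<Rightarrow> real \<Rightarrow> nat \<Rightarrow> (nat \<Rightarrow> 'i \<Rightarrow> real) \<Rightarrow> (nat \<Rightarrow> real) \<Rightarrow> (nat \<Rightarrow> nat set) \<Rightarrow> (nat \<Rightarrow> nat \<Rightarrow> real)
      \<Rightarrow> (nat \<Rightarrow> nat \<Rightarrow> real) \<Rightarrow> ('i \<Rightarrow> real) \<Rightarrow> real" where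
  "multi_integrand I \<rho> N x \<alpha> J b c v =
     indicator (ball_sq I \<rho>) v * (\<Prod>i<N. \<Sum>j\<in>J i. trapezoid (b i j) (\<alpha> i) (c i j + lin I (x i) v))"

text \<open>Expanding the product of sums, a choice function \<open>g\<close> picks one interval for
  each index. Every term has single intervals, so one dilation factor common to all centres can be
  applied to all terms simultaneously.\<close>

lemma multi_integrand_eq_sum_box:
  assumes "\<And>i. i < N \<Longrightarrow> finite (J i)"
  shows "multi_integrand I \<rho> N x \<alpha> J b c v =
    (\<Sum>g\<in>Pi\<^sub>E {..<N} J. box_integrand I \<rho> N x \<alpha> (\<lambda>i. b i (g i)) (\<lambda>i. c i (g i)) v)"
  unfolding multi_integrand_def box_integrand_def sum_distrib_left[symmetric]
  using assms by (subst prod_sum_PiE) auto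

lemma multi_integral_slide:
  assumes "finite I" "\<And>i. 0 \<le> \<alpha> i" "0 \<le> \<sigma>" "\<sigma> \<le> 1" and J: "\<And>i. i < N \<Longrightarrow> finite (J i)"
  shows "(\<integral>\<^sup>+ v. ennreal (multi_integrand I \<rho> N x \<alpha> J b c v) \<partial>coords I)
       \<le> (\<integral>\<^sup>+ v. ennreal (multi_integrand I \<rho> N x \<alpha> J b (\<lambda>i j. \<sigma> * c i j) v) \<partial>coords I)"
proof -
  have eq: "(\<integral>\<^sup>+ v. ennreal (multi_integrand I \<rho> N x \<alpha> J b c' v) \<partial>coords I)
      = (\<Sum>g\<in>Pi\<^sub>E {..<N} J. \<integral>\<^sup>+ v. ennreal (box_integrand I \<rho> N x \<alpha> (\<lambda>i. b i (g i)) (\<lambda>i. c' i (g i)) v) \<partial>coords I)" for c'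
  proof -
    have "(\<integral>\<^sup>+ v. ennreal (multi_integrand I \<rho> N x \<alpha> J b c' v) \<partial>coords I)
      = (\<integral>\<^sup>+ v. (\<Sum>g\<in>Pi\<^sub>E {..<N} J. ennreal (box_integrand I \<rho> N x \<alpha> (\<lambda>i. b i (g i)) (\<lambda>i. c' i (g i)) v)) \<partial>coords I)"
      using J by (simp add: multi_integrand_eq_sum_box)
    also have "\<dots> = (\<Sum>g\<in>Pi\<^sub>E {..<N} J. \<integral>\<^sup>+ v. ennreal (box_integrand I \<rho> N x \<alpha> (\<lambda>i. b i (g i)) (\<lambda>i. c' i (g i)) v) \<partial>coords I)"
      by (rule nn_integral_sum) measurable
    finally show ?thesis .
  qed
  show ?thesis
    unfolding eq using assms by (intro sum_mono box_integral_antimono) auto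
qed

text \<open>The two intervals abut at \<open>t + b1\<close>; their union has half-length
  \<open>b1 + b2\<close> and centre \<open>t + b2\<close>. Clipped lengths add up over abutting
  intervals.\<close>

lemma trapezoid_merge:
  assumes "0 \<le> a" "0 \<le> b1" "0 \<le> b2"
  shows "trapezoid b1 a t + trapezoid b2 a (t + b1 + b2) = trapezoid (b1 + b2) a (t + b2)"
proof -
  have eq: "trapezoid b a t = max 0 (min (t + b) a - max (t - b) (- a))" if "0 \<le> b" for b t
    using that assms(1) by (auto simp: trapezoid_def max_def min_def abs_if)
  have "max 0 (min v a - max u (- a)) + max 0 (min w a - max v (- a)) = max 0 (min w a - max u (- a))"
    if "u \<le> v" "v \<le> w" for u v w :: real
    using that assms(1) by (auto simp: max_def min_def)
  from this[of "t - b1" "t + b1" "t + b1 + 2 * b2"]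
  show ?thesis using assms by (simp add: eq algebra_simps)
qed

text \<open>Sliding beyond a contact would make intervals overlap and count lengths twice. So the
  centres are dilated only until some pair touches; that pair becomes one interval, total lengths
  are unchanged, and the number of intervals drops, which drives the induction.\<close>

lemma multi_integral_le_merged:
  assumes "finite I" and \<alpha>: "\<And>i. 0 \<le> \<alpha> i"
    and "\<And>i. i < N \<Longrightarrow> finite (J i)"
    and "\<And>i j. i < N \<Longrightarrow> j \<in> J i \<Longrightarrow> 0 < b i j"
    and "\<And>i j k. i < N \<Longrightarrow> j \<in> J i \<Longrightarrow> k \<in> J i \<Longrightarrow> j \<noteq> k \<Longrightarrow> b i j + b i k \<le> \<bar>c i j - c i k\<bar>"
  shows "(\<integral>\<^sup>+ v. ennreal (multi_integrand I \<rho> N x \<alpha> J b c v) \<partial>coords I)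
       \<le> (\<integral>\<^sup>+ v. ennreal (box_integrand I \<rho> N x \<alpha> (\<lambda>i. \<Sum>j\<in>J i. b i j) (\<lambda>_. 0) v) \<partial>coords I)"
  using assms(3-)
proof (induction "\<Sum>i<N. card (J i)" arbitrary: J b c rule: less_induct)
  case less
  note fin = less.prems(1) and pos = less.prems(2) and sep = less.prems(3)
  define P where "P = {(i, j, k). i < N \<and> j \<in> J i \<and> k \<in> J i \<and> j \<noteq> k}"
  show ?case
  proof (cases "P = {}")
    case True
    \<comment> \<open>With at most one interval per index, the centred configuration is already the
      merged one, and dilation by 0 ends the induction. An index without intervals matches
      half-length 0.\<close>
    have "multi_integrand I \<rho> N x \<alpha> J b (\<lambda>i j. 0 * c i j) v = box_integrand I \<rho> N x \<alpha> (\<lambda>i. \<Sum>j\<in>J i. b i j) (\<lambda>_. 0) v" for v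
    proof -
      have "(\<Sum>j\<in>J i. trapezoid (b i j) (\<alpha> i) (0 * c i j + lin I (x i) v))
          = trapezoid (\<Sum>j\<in>J i. b i j) (\<alpha> i) (0 + lin I (x i) v)" if "i < N" for i
      proof (cases "J i = {}")
        case False
        then obtain j where "j \<in> J i" by blast
        then have "J i = {j}" using True that by (auto simp: P_def)
        then show ?thesis by simp
      qed simp
      then show ?thesis by (simp add: multi_integrand_def box_integrand_def)
    qed
    then show ?thesis
      using multi_integral_slide[where \<alpha> = \<alpha> and \<sigma> = 0 and J = J and c = c and N = N and \<rho> = \<rho> and x = x and b = b,
        OF \<open>finite I\<close> \<alpha> _ _ fin] by simp
  next
    case False
    have "finite P"
    proof (rule finite_subset)
      show "P \<subseteq> (SIGMA i:{..<N}. J i \<times> J i)" by (auto simp: P_def)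
    qed (use fin in auto)
    define h where "h = (\<lambda>(i, j, k). (b i j + b i k) / \<bar>c i j - c i k\<bar>)"
    define \<sigma> where "\<sigma> = Max (h ` P)"  \<comment> \<open>dilating the centres by \<open>\<sigma>\<close> produces the first contact\<close>
    have \<sigma>_ge: "h q \<le> \<sigma>" if "q \<in> P" for q
      unfolding \<sigma>_def using \<open>finite P\<close> that by (intro Max_ge) auto
    have "\<sigma> \<in> h ` P" unfolding \<sigma>_def using \<open>finite P\<close> False by (intro Max_in) auto
    then obtain i0 j1 k1 where q1: "(i0, j1, k1) \<in> P" "h (i0, j1, k1) = \<sigma>" by auto
    have dpos: "0 < \<bar>c i j - c i k\<bar>" "0 < b i j + b i k" if "(i, j, k) \<in> P" for i j k
      using that sep[of i j k] pos[of i j] pos[of i k] by (auto simp: P_def)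
    have \<sigma>: "0 < \<sigma>" "\<sigma> \<le> 1"
      using q1 dpos[OF q1(1)] sep[of i0 j1 k1] by (auto simp: h_def P_def divide_le_eq)
    define c' where "c' i j = \<sigma> * c i j" for i j
    have sep': "b i j + b i k \<le> \<bar>c' i j - c' i k\<bar>" if "i < N" "j \<in> J i" "k \<in> J i" "j \<noteq> k" for i j k
    proof -
      have q: "(i, j, k) \<in> P" using that by (auto simp: P_def)
      have "b i j + b i k \<le> \<sigma> * \<bar>c i j - c i k\<bar>"
        using \<sigma>_ge[OF q] dpos[OF q] by (simp add: h_def divide_le_eq)
      also have "\<dots> = \<bar>c' i j - c' i k\<bar>"
        using \<sigma> by (simp add: c'_def right_diff_distrib[symmetric] abs_mult)
      finally show ?thesis .
    qed
    have "\<bar>c' i0 j1 - c' i0 k1\<bar> = b i0 j1 + b i0 k1"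
    proof -
      have "\<bar>c' i0 j1 - c' i0 k1\<bar> = \<sigma> * \<bar>c i0 j1 - c i0 k1\<bar>"
        using \<sigma> by (simp add: c'_def right_diff_distrib[symmetric] abs_mult)
      then show ?thesis using q1 dpos[OF q1(1)] by (simp add: h_def field_simps)
    qed
    then have "c' i0 k1 - c' i0 j1 = b i0 j1 + b i0 k1 \<or> c' i0 j1 - c' i0 k1 = b i0 k1 + b i0 j1"
      by linarith
    then obtain j0 k0 where jk: "(i0, j0, k0) \<in> P" and touch: "c' i0 k0 - c' i0 j0 = b i0 j0 + b i0 k0"
      using q1(1) by (auto simp: P_def)
    have i0: "i0 < N" "j0 \<in> J i0" "k0 \<in> J i0" "j0 \<noteq> k0" using jk by (auto simp: P_def)
    \<comment> \<open>The label \<open>j0\<close> takes over the merged interval, whose centre lies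
      \<open>b i0 k0\<close> to the right of the old one; the label \<open>k0\<close>
      disappears.\<close>
    define J2 where "J2 = J(i0 := J i0 - {k0})"
    define b2 where "b2 = b(i0 := (b i0)(j0 := b i0 j0 + b i0 k0))"
    define c2 where "c2 = c'(i0 := (c' i0)(j0 := c' i0 j0 + b i0 k0))"
    have split: "(\<Sum>j\<in>J i0. g j) = g j0 + g k0 + (\<Sum>j\<in>J i0 - {k0} - {j0}. g j)" for g :: "nat \<Rightarrow> real"
      using i0 fin[of i0] by (simp add: sum.remove[of "J i0" k0] sum.remove[of "J i0 - {k0}" j0])
    have split2: "(\<Sum>j\<in>J2 i0. g j) = g j0 + (\<Sum>j\<in>J i0 - {k0} - {j0}. g j)" for g :: "nat \<Rightarrow> real"
      using i0 fin[of i0] by (simp add: J2_def sum.remove[of "J i0 - {k0}" j0])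
    have trap_eq: "(\<Sum>j\<in>J i. trapezoid (b i j) (\<alpha> i) (c' i j + l)) = (\<Sum>j\<in>J2 i. trapezoid (b2 i j) (\<alpha> i) (c2 i j + l))" for i l
    proof (cases "i = i0")
      case True
      have "trapezoid (b i0 j0) (\<alpha> i0) (c' i0 j0 + l) + trapezoid (b i0 k0) (\<alpha> i0) (c' i0 k0 + l)
          = trapezoid (b i0 j0 + b i0 k0) (\<alpha> i0) (c' i0 j0 + b i0 k0 + l)"
        using trapezoid_merge[OF \<alpha>[of i0], of "b i0 j0" "b i0 k0" "c' i0 j0 + l"] touch pos[of i0 j0] pos[of i0 k0] i0
        by (simp add: algebra_simps)
      then show ?thesis unfolding True split split2 by (simp add: b2_def c2_def)
    qed (simp add: J2_def b2_def c2_def)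
    have b_eq: "(\<Sum>j\<in>J i. b i j) = (\<Sum>j\<in>J2 i. b2 i j)" for i
    proof (cases "i = i0")
      case True
      then show ?thesis unfolding True split split2 by (simp add: b2_def)
    qed (simp add: J2_def b2_def)
    have "(\<integral>\<^sup>+ v. ennreal (multi_integrand I \<rho> N x \<alpha> J b c v) \<partial>coords I)
       \<le> (\<integral>\<^sup>+ v. ennreal (multi_integrand I \<rho> N x \<alpha> J b c' v) \<partial>coords I)"
      unfolding c'_def using \<sigma> by (intro multi_integral_slide \<open>finite I\<close> \<alpha> fin) auto
    also have "\<dots> = (\<integral>\<^sup>+ v. ennreal (multi_integrand I \<rho> N x \<alpha> J2 b2 c2 v) \<partial>coords I)"
      by (simp add: multi_integrand_def trap_eq)
    also have "\<dots> \<le> (\<integral>\<^sup>+ v. ennreal (box_integrand I \<rho> N x \<alpha> (\<lambda>i. \<Sum>j\<in>J2 i. b2 i j) (\<lambda>_. 0) v) \<partial>coords I)"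
    proof (rule less.hyps)
      show "(\<Sum>i<N. card (J2 i)) < (\<Sum>i<N. card (J i))"
      proof (rule sum_strict_mono_ex1)
        show "\<forall>i\<in>{..<N}. card (J2 i) \<le> card (J i)" using fin by (auto simp: J2_def card_mono card_Diff_subset)
        show "\<exists>i\<in>{..<N}. card (J2 i) < card (J i)"
          using i0 card_Diff1_less[OF fin[of i0], of k0] by (intro bexI[of _ i0]) (auto simp: J2_def)
      qed simp
      show "finite (J2 i)" if "i < N" for i using fin[OF that] by (auto simp: J2_def)
      show "0 < b2 i j" if "i < N" "j \<in> J2 i" for i j
        using that pos[of i j] pos[of i0 j0] pos[of i0 k0] i0 by (auto simp: J2_def b2_def split: if_splits)
      \<comment> \<open>An interval of positive length that avoids both partners cannot sit between
        them, since they touch; hence it lies on one side of their union.\<close>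
      have new: "b2 i0 j0 + b2 i0 l \<le> \<bar>c2 i0 j0 - c2 i0 l\<bar>" if l: "l \<in> J i0" "l \<noteq> j0" "l \<noteq> k0" for l
      proof -
        have "b i0 j0 + b i0 l \<le> \<bar>c' i0 j0 - c' i0 l\<bar>" "b i0 k0 + b i0 l \<le> \<bar>c' i0 k0 - c' i0 l\<bar>"
          using sep'[of i0 j0 l] sep'[of i0 k0 l] i0 l by auto
        moreover have "0 < b i0 l" "0 < b i0 j0" "0 < b i0 k0" using pos i0 l by auto
        ultimately have "b i0 j0 + b i0 k0 + b i0 l \<le> \<bar>c' i0 j0 + b i0 k0 - c' i0 l\<bar>"
          using touch by linarith
        then show ?thesis using l by (simp add: b2_def c2_def)
      qed
      show "b2 i j + b2 i k \<le> \<bar>c2 i j - c2 i k\<bar>" if "i < N" "j \<in> J2 i" "k \<in> J2 i" "j \<noteq> k" for i j k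
      proof (cases "i = i0 \<and> (j = j0 \<or> k = j0)")
        case True
        then show ?thesis using that new[of k] new[of j] by (auto simp: J2_def add.commute abs_minus_commute)
      next
        case False
        then have "b2 i j = b i j" "b2 i k = b i k" "c2 i j = c' i j" "c2 i k = c' i k"
          by (auto simp: b2_def c2_def)
        then show ?thesis using sep'[of i j k] that by (auto simp: J2_def split: if_splits)
      qed
    qed
    finally show ?thesis by (simp add: b_eq)
  qed
qed

section \<open>From finite unions of intervals to Borel sets of finite length\<close>

definition slab :: "real set \<Rightarrow> real \<Rightarrow> real \<Rightarrow> ennreal" where
  "slab A a l = emeasure lborel {s \<in> A. \<bar>s + l\<bar> < a}"

lemma slab_measurable [measurable]:
  assumes [measurable]: "A \<in> sets borel" shows "slab A a \<in> borel_measurable borel"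
proof -
  have "(\<lambda>l. emeasure lborel {s \<in> space lborel. s \<in> A \<and> \<bar>s + l\<bar> < a}) \<in> borel_measurable borel"
    by measurable
  then show ?thesis unfolding slab_def[abs_def] by simp
qed

lemma slab_mono: "A \<subseteq> B \<Longrightarrow> B \<in> sets borel \<Longrightarrow> slab A a l \<le> slab B a l"
  unfolding slab_def by (intro emeasure_mono) auto

lemma slab_SUP:
  assumes "incseq E" "\<And>n. E n \<in> sets borel"
  shows "slab (\<Union>n. E n) a l = (SUP n. slab (E n) a l)"
proof -
  have [measurable]: "E n \<in> sets borel" for n by fact
  have "{s \<in> (\<Union>n. E n). \<bar>s + l\<bar> < a} = (\<Union>n. {s \<in> E n. \<bar>s + l\<bar> < a})" by auto
  moreover have "incseq (\<lambda>n. {s \<in> E n. \<bar>s + l\<bar> < a})" using assms(1) by (auto simp: incseq_def)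
  ultimately show ?thesis
    unfolding slab_def by (subst SUP_emeasure_incseq) auto
qed

lemma prod_mono_ennreal:
  fixes f g :: "'b \<Rightarrow> ennreal"
  assumes "\<And>i. i \<in> S \<Longrightarrow> f i \<le> g i"
  shows "(\<Prod>i\<in>S. f i) \<le> (\<Prod>i\<in>S. g i)"
  using assms by (induction S rule: infinite_finite_induct) (auto intro!: mult_mono)

text \<open>Each factor increases with n, so different indices in different factors can be replaced
  by their maximum.\<close>

lemma SUP_prod_ennreal:
  fixes f :: "'b \<Rightarrow> nat \<Rightarrow> ennreal"
  assumes "finite S" "\<And>i. i \<in> S \<Longrightarrow> incseq (f i)"
  shows "(\<Prod>i\<in>S. SUP n. f i n) = (SUP n. \<Prod>i\<in>S. f i n)"
  using assms
proof (induction S rule: finite_induct)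
  case (insert i S)
  have inc: "incseq (\<lambda>n. \<Prod>i\<in>S. f i n)"
    using insert by (auto simp: incseq_def intro!: prod_mono_ennreal)
  have "(SUP n. f i n) * (SUP n. \<Prod>i\<in>S. f i n) = (SUP n. f i n * (\<Prod>i\<in>S. f i n))"
  proof (rule antisym)
    show "(SUP n. f i n) * (SUP n. \<Prod>i\<in>S. f i n) \<le> (SUP n. f i n * (\<Prod>i\<in>S. f i n))"
      unfolding SUP_mult_right_ennreal SUP_mult_left_ennreal
    proof (intro SUP_least)
      fix k n
      have "f i n \<le> f i (max k n)" "(\<Prod>i\<in>S. f i k) \<le> (\<Prod>i\<in>S. f i (max k n))"
        using insert.prems[of i] inc by (auto simp: incseq_def)
      then have "f i n * (\<Prod>i\<in>S. f i k) \<le> f i (max k n) * (\<Prod>i\<in>S. f i (max k n))"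
        by (intro mult_mono) auto
      also have "\<dots> \<le> (SUP n. f i n * (\<Prod>i\<in>S. f i n))" by (intro SUP_upper) auto
      finally show "f i n * (\<Prod>i\<in>S. f i k) \<le> (SUP n. f i n * (\<Prod>i\<in>S. f i n))" .
    qed
  qed (intro SUP_least mult_mono SUP_upper; simp)
  then show ?case using insert by simp
qed simp

text \<open>A division of the union into intervals with disjoint interiors supplies centres at least
  as far apart as the sum of the half-lengths. Degenerate pieces are dropped: merging wants positive
  half-lengths, and single points add no length to any window.\<close>

lemma elementary_separated_intervals:
  fixes \<F> :: "real set set"
  assumes "finite \<F>" "\<And>K. K \<in> \<F> \<Longrightarrow> \<exists>a b. K = cbox a b"
  obtains J :: "nat set" and b c where "finite J" "\<And>j. j \<in> J \<Longrightarrow> 0 < b j"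
    "\<And>j k. j \<in> J \<Longrightarrow> k \<in> J \<Longrightarrow> j \<noteq> k \<Longrightarrow> b j + b k \<le> \<bar>c j - c k\<bar>"
    "ennreal (2 * (\<Sum>j\<in>J. b j)) \<le> emeasure lborel (\<Union>\<F>)"
    "\<And>a l. 0 \<le> a \<Longrightarrow> slab (\<Union>\<F>) a l \<le> ennreal (\<Sum>j\<in>J. trapezoid (b j) a (c j + l))"
proof -
  obtain p where p: "p division_of (\<Union>\<F>)" using elementary_unions_intervals[OF assms] .
  define lo up :: "real set \<Rightarrow> real" where "lo K = Inf K" and "up K = Sup K" for K
  have K: "K = {lo K..up K}" "lo K \<le> up K" if "K \<in> p" for K
  proof -
    obtain a b where ab: "K = cbox a b" "K \<noteq> {}" using division_ofD(3,4)[OF p \<open>K \<in> p\<close>] by blast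
    then have "a \<le> b" "K = {a..b}" by auto
    then show "K = {lo K..up K}" "lo K \<le> up K" by (auto simp: lo_def up_def)
  qed
  define p' where "p' = {K \<in> p. lo K < up K}"
  have "finite p" using p by auto
  then have "finite p'" by (simp add: p'_def)
  then obtain h where h: "bij_betw h {0..<card p'} p'" using ex_bij_betw_nat_finite by blast
  define J where "J = {0..<card p'}"
  define b where "b j = (up (h j) - lo (h j)) / 2" for j
  define c where "c j = (up (h j) + lo (h j)) / 2" for j
  have hJ: "h j \<in> p'" if "j \<in> J" for j using that h by (auto simp: J_def bij_betw_def)
  have inj: "h j \<noteq> h k" if "j \<in> J" "k \<in> J" "j \<noteq> k" for j k
    using that h by (auto simp: J_def bij_betw_def inj_on_def)
  have disj: "{lo K<..<up K} \<inter> {lo L<..<up L} = {}" if "K \<in> p" "L \<in> p" "K \<noteq> L" for K L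
  proof -
    have "interior K \<inter> interior L = {}" using division_ofD(5)[OF p] that by blast
    then show ?thesis using K(1)[OF that(1)] K(1)[OF that(2)] by (metis interior_atLeastAtMost_real)
  qed
  show thesis
  proof (rule that)
    show "finite J" by (simp add: J_def)
    show "0 < b j" if "j \<in> J" for j using hJ[OF that] by (simp add: p'_def b_def)
    show "b j + b k \<le> \<bar>c j - c k\<bar>" if "j \<in> J" "k \<in> J" "j \<noteq> k" for j k
    proof -
      define lj uj lk uk where "lj = lo (h j)" and "uj = up (h j)" and "lk = lo (h k)" and "uk = up (h k)"
      have lt: "lj < uj" "lk < uk" using hJ that by (auto simp: p'_def lj_def uj_def lk_def uk_def)
      have "{lj<..<uj} \<inter> {lk<..<uk} = {}"
        using disj[of "h j" "h k"] hJ inj that by (auto simp: p'_def lj_def uj_def lk_def uk_def)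
      then have "max lj lk \<ge> min uj uk"
        using lt dense[of "max lj lk" "min uj uk"] by (force simp: not_less)
      then have "uj \<le> lk \<or> uk \<le> lj" using lt by linarith
      then show ?thesis unfolding b_def c_def lj_def[symmetric] uj_def[symmetric] lk_def[symmetric] uk_def[symmetric] using lt by (auto simp: field_simps)
    qed
    have "ennreal (2 * (\<Sum>j\<in>J. b j)) = (\<Sum>j\<in>J. ennreal (up (h j) - lo (h j)))"
      using hJ by (subst sum_ennreal) (auto simp: b_def p'_def sum_divide_distrib[symmetric] less_imp_le)
    also have "\<dots> = (\<Sum>j\<in>J. emeasure lborel {lo (h j)<..<up (h j)})"
      using hJ by (intro sum.cong) (auto simp: p'_def less_imp_le)
    also have "\<dots> = (\<Sum>K\<in>p'. emeasure lborel {lo K<..<up K})"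
      using h unfolding J_def by (rule sum.reindex_bij_betw)
    also have "\<dots> = emeasure lborel (\<Union>K\<in>p'. {lo K<..<up K})"
      using \<open>finite p'\<close> disj by (intro sum_emeasure) (auto simp: disjoint_family_on_def p'_def)
    also have "\<dots> \<le> emeasure lborel (\<Union>\<F>)"
    proof (intro emeasure_mono)
      have "\<Union>\<F> = \<Union>p" using division_ofD(6)[OF p] by simp
      then show "(\<Union>K\<in>p'. {lo K<..<up K}) \<subseteq> \<Union>\<F>"
        using K(1) by (fastforce simp: p'_def)
      show "\<Union>\<F> \<in> sets lborel" using assms by (intro sets.finite_Union) (auto, metis atLeastAtMost_borel cbox_interval)
    qed
    finally show "ennreal (2 * (\<Sum>j\<in>J. b j)) \<le> emeasure lborel (\<Union>\<F>)" .
    fix a l :: real assume "0 \<le> a"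
    have Kslab: "slab K a l = ennreal (trapezoid ((up K - lo K) / 2) a ((up K + lo K) / 2 + l))" if "K \<in> p" for K
    proof -
      have "{s \<in> K. \<bar>s + l\<bar> < a} = {(up K + lo K) / 2 - (up K - lo K) / 2..(up K + lo K) / 2 + (up K - lo K) / 2} \<inter> {s. \<bar>s + l\<bar> < a}"
        by (subst K(1)[OF that]) (auto simp: field_simps)
      then show ?thesis
        unfolding slab_def using emeasure_Icc_Int_slab[of "(up K - lo K) / 2" a "(up K + lo K) / 2" l] K(2)[OF that] \<open>0 \<le> a\<close>
        by simp
    qed
    have "slab (\<Union>\<F>) a l = emeasure lborel (\<Union>K\<in>p. {s \<in> K. \<bar>s + l\<bar> < a})"
      unfolding slab_def using division_ofD(6)[OF p] by (intro arg_cong[where f = "emeasure lborel"]) blast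
    also have "\<dots> \<le> (\<Sum>K\<in>p. slab K a l)"
    proof -
      have "{s \<in> K. \<bar>s + l\<bar> < a} \<in> sets lborel" if "K \<in> p" for K
        by (subst K(1)[OF that]) measurable
      then show ?thesis unfolding slab_def using \<open>finite p\<close>
        by (intro emeasure_subadditive_finite) auto
    qed
    also have "\<dots> = (\<Sum>K\<in>p'. slab K a l)"
      using \<open>finite p\<close> K(2) by (intro sum.mono_neutral_right) (force simp: p'_def Kslab)+
    also have "\<dots> = (\<Sum>j\<in>J. slab (h j) a l)"
      using h unfolding J_def by (rule sum.reindex_bij_betw[symmetric])
    also have "\<dots> = (\<Sum>j\<in>J. ennreal (trapezoid (b j) a (c j + l)))"
      using hJ by (intro sum.cong) (auto simp: Kslab p'_def b_def c_def)
    finally show "slab (\<Union>\<F>) a l \<le> ennreal (\<Sum>j\<in>J. trapezoid (b j) a (c j + l))"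
      by (simp add: sum_ennreal)
  qed
qed

text \<open>The functional of Brascamp-Lieb-Luttinger type in one coordinate per set, with those
  coordinates already integrated out: only the common transverse variable remains.\<close>

definition slab_integral :: "'i set \<Rightarrow> real \<Rightarrow> nat \<Rightarrow> (nat \<Rightarrow> 'i \<Rightarrow> real) \<Rightarrow> (nat \<Rightarrow> real) \<Rightarrow> (nat \<Rightarrow> real set) \<Rightarrow> ennreal" where
  "slab_integral I \<rho> N x \<alpha> A = (\<integral>\<^sup>+ v. indicator (ball_sq I \<rho>) v * (\<Prod>i<N. slab (A i) (\<alpha> i) (lin I (x i) v)) \<partial>coords I)"

text \<open>The half-lengths \<open>m i\<close> may exceed half of the true lengths. This slack
  absorbs the error of the later approximation by open supersets.\<close>

lemma slab_integral_le_elementary: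
  assumes "finite I" and \<alpha>: "\<And>i. 0 \<le> \<alpha> i"
    and \<F>: "\<And>i. i < N \<Longrightarrow> finite (\<F> i)" "\<And>i K. i < N \<Longrightarrow> K \<in> \<F> i \<Longrightarrow> \<exists>a b. K = cbox a b"
    and m: "\<And>i. i < N \<Longrightarrow> emeasure lborel (\<Union>(\<F> i)) \<le> ennreal (2 * m i)" "\<And>i. 0 \<le> m i"
  shows "slab_integral I \<rho> N x \<alpha> (\<lambda>i. \<Union>(\<F> i))
    \<le> (\<integral>\<^sup>+ v. ennreal (box_integrand I \<rho> N x \<alpha> m (\<lambda>_. 0) v) \<partial>coords I)"
proof -
  define P where "P i J b c \<longleftrightarrow> finite J \<and> (\<forall>j\<in>J. 0 < b j) \<and> (\<forall>j\<in>J. \<forall>k\<in>J. j \<noteq> k \<longrightarrow> b j + b k \<le> \<bar>c j - c k\<bar>)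
      \<and> ennreal (2 * (\<Sum>j\<in>J. b j)) \<le> emeasure lborel (\<Union>(\<F> i))
      \<and> (\<forall>a\<ge>0. \<forall>l. slab (\<Union>(\<F> i)) a l \<le> ennreal (\<Sum>j\<in>J. trapezoid (b j) a (c j + l)))"
    for i and J :: "nat set" and b c
  have "\<exists>J b c. P i J b c" if i: "i < N" for i
  proof (rule elementary_separated_intervals[OF \<F>(1)[OF i] \<F>(2)[OF i]])
    fix J :: "nat set" and b c
    assume "finite J" "\<And>j. j \<in> J \<Longrightarrow> 0 < b j"
      "\<And>j k. j \<in> J \<Longrightarrow> k \<in> J \<Longrightarrow> j \<noteq> k \<Longrightarrow> b j + b k \<le> \<bar>c j - c k\<bar>"
      "ennreal (2 * (\<Sum>j\<in>J. b j)) \<le> emeasure lborel (\<Union>(\<F> i))"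
      "\<And>a l. 0 \<le> a \<Longrightarrow> slab (\<Union>(\<F> i)) a l \<le> ennreal (\<Sum>j\<in>J. trapezoid (b j) a (c j + l))"
    then have "P i J b c" unfolding P_def by (intro conjI ballI allI impI)
    then show ?thesis by blast
  qed
  then obtain J b c where *: "\<forall>i<N. P i (J i) (b i) (c i)" by metis
  note * = *[unfolded P_def]
  have "slab_integral I \<rho> N x \<alpha> (\<lambda>i. \<Union>(\<F> i)) \<le> (\<integral>\<^sup>+ v. ennreal (multi_integrand I \<rho> N x \<alpha> J b c v) \<partial>coords I)"
    unfolding slab_integral_def
  proof (intro nn_integral_mono)
    fix v
    have "(\<Prod>i<N. slab (\<Union>(\<F> i)) (\<alpha> i) (lin I (x i) v))
        \<le> (\<Prod>i<N. ennreal (\<Sum>j\<in>J i. trapezoid (b i j) (\<alpha> i) (c i j + lin I (x i) v)))"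
      using * \<alpha> by (intro prod_mono_ennreal) auto
    also have "\<dots> = ennreal (\<Prod>i<N. \<Sum>j\<in>J i. trapezoid (b i j) (\<alpha> i) (c i j + lin I (x i) v))"
      by (intro prod_ennreal sum_nonneg) auto
    finally show "indicator (ball_sq I \<rho>) v * (\<Prod>i<N. slab (\<Union>(\<F> i)) (\<alpha> i) (lin I (x i) v))
        \<le> ennreal (multi_integrand I \<rho> N x \<alpha> J b c v)"
      by (auto simp: multi_integrand_def split: split_indicator)
  qed
  also have "\<dots> \<le> (\<integral>\<^sup>+ v. ennreal (box_integrand I \<rho> N x \<alpha> (\<lambda>i. \<Sum>j\<in>J i. b i j) (\<lambda>_. 0) v) \<partial>coords I)"
    using * by (intro multi_integral_le_merged \<open>finite I\<close> \<alpha>) auto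
  also have "\<dots> \<le> (\<integral>\<^sup>+ v. ennreal (box_integrand I \<rho> N x \<alpha> m (\<lambda>_. 0) v) \<partial>coords I)"
  proof (intro nn_integral_mono ennreal_leI)
    fix v
    have "(\<Sum>j\<in>J i. b i j) \<le> m i" if "i < N" for i
    proof -
      have "ennreal (2 * (\<Sum>j\<in>J i. b i j)) \<le> ennreal (2 * m i)"
        using * m(1)[OF that] that by (meson order_trans)
      then show ?thesis using m(2)[of i] by (simp add: ennreal_le_iff)
    qed
    then show "box_integrand I \<rho> N x \<alpha> (\<lambda>i. \<Sum>j\<in>J i. b i j) (\<lambda>_. 0) v \<le> box_integrand I \<rho> N x \<alpha> m (\<lambda>_. 0) v"
      unfolding box_integrand_def by (intro mult_left_mono prod_mono conjI trapezoid_mono) auto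
  qed
  finally show ?thesis .
qed

lemma slab_integral_le_open:
  assumes "finite I" and \<alpha>: "\<And>i. 0 \<le> \<alpha> i" and U: "\<And>i. open (U i)"
    and m: "\<And>i. i < N \<Longrightarrow> emeasure lborel (U i) \<le> ennreal (2 * m i)" "\<And>i. 0 \<le> m i"
  shows "slab_integral I \<rho> N x \<alpha> U \<le> (\<integral>\<^sup>+ v. ennreal (box_integrand I \<rho> N x \<alpha> m (\<lambda>_. 0) v) \<partial>coords I)"
proof -
  have "\<exists>D. countable D \<and> (\<forall>X\<in>D. \<exists>a b. X = cbox a b) \<and> \<Union>D = U i" for i
    using open_countable_Union_open_cbox[OF U[of i]] by metis
  then obtain D where D: "\<And>i. countable (D i)" "\<And>i X. X \<in> D i \<Longrightarrow> \<exists>a b. X = cbox a b" "\<And>i. \<Union>(D i) = U i"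
    by metis
  \<comment> \<open>The empty set is added so that the family can be enumerated even if
    \<open>U i\<close> is empty.\<close>
  define D' where "D' i = insert {} (D i)" for i
  have D': "countable (D' i)" "D' i \<noteq> {}" "\<Union>(D' i) = U i" for i using D by (auto simp: D'_def)
  have D'cbox: "\<exists>a b. X = cbox a b" if "X \<in> D' i" for X i
  proof (cases "X = {}")
    case True
    have "{} = cbox 1 (0::real)" by simp
    then show ?thesis using True by metis
  qed (use D(2) that in \<open>auto simp: D'_def\<close>)
  define \<F> where "\<F> n i = from_nat_into (D' i) ` {..n}" for n :: nat and i
  have \<F>sub: "\<F> n i \<subseteq> D' i" for n i using from_nat_into[OF D'(2)] by (auto simp: \<F>_def)
  define E where "E n i = \<Union>(\<F> n i)" for n i
  have \<F>cbox: "\<exists>a b. K = cbox a b" if "K \<in> \<F> n i" for K n i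
    using D'cbox \<F>sub that by blast
  have E_meas[measurable]: "E n i \<in> sets borel" for n i
  proof -
    have "K \<in> sets borel" if "K \<in> \<F> n i" for K using \<F>cbox[OF that] by auto
    then show ?thesis unfolding E_def by (intro sets.finite_Union) (auto simp: \<F>_def)
  qed
  have E_inc: "incseq (\<lambda>n. E n i)" for i by (force simp: incseq_def E_def \<F>_def)
  have UE: "U i = (\<Union>n. E n i)" for i
  proof -
    have "(\<Union>n. E n i) = \<Union>(range (from_nat_into (D' i)))" by (force simp: E_def \<F>_def)
    then show ?thesis using D' by (simp add: range_from_nat_into)
  qed
  have E_sub: "E n i \<subseteq> U i" for n i using UE by blast
  have "slab_integral I \<rho> N x \<alpha> U = (\<integral>\<^sup>+ v. (SUP n. indicator (ball_sq I \<rho>) v * (\<Prod>i<N. slab (E n i) (\<alpha> i) (lin I (x i) v))) \<partial>coords I)"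
    unfolding slab_integral_def
  proof (intro nn_integral_cong)
    fix v
    have "(\<Prod>i<N. slab (U i) (\<alpha> i) (lin I (x i) v)) = (\<Prod>i<N. SUP n. slab (E n i) (\<alpha> i) (lin I (x i) v))"
      unfolding UE using slab_SUP[OF E_inc E_meas] by simp
    also have "\<dots> = (SUP n. \<Prod>i<N. slab (E n i) (\<alpha> i) (lin I (x i) v))"
      using E_inc by (intro SUP_prod_ennreal) (auto simp: incseq_def intro!: slab_mono)
    finally show "indicator (ball_sq I \<rho>) v * (\<Prod>i<N. slab (U i) (\<alpha> i) (lin I (x i) v))
       = (SUP n. indicator (ball_sq I \<rho>) v * (\<Prod>i<N. slab (E n i) (\<alpha> i) (lin I (x i) v)))"
      by (simp add: SUP_mult_left_ennreal)
  qed
  also have "\<dots> = (SUP n. slab_integral I \<rho> N x \<alpha> (E n))"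
    unfolding slab_integral_def
  proof (rule nn_integral_monotone_convergence_SUP)
    show "incseq (\<lambda>n v. indicator (ball_sq I \<rho>) v * (\<Prod>i<N. slab (E n i) (\<alpha> i) (lin I (x i) v)))"
      using E_inc by (auto simp: incseq_def le_fun_def intro!: mult_left_mono prod_mono_ennreal slab_mono)
  qed measurable
  also have "\<dots> \<le> (\<integral>\<^sup>+ v. ennreal (box_integrand I \<rho> N x \<alpha> m (\<lambda>_. 0) v) \<partial>coords I)"
  proof (rule SUP_least)
    fix n
    show "slab_integral I \<rho> N x \<alpha> (E n) \<le> (\<integral>\<^sup>+ v. ennreal (box_integrand I \<rho> N x \<alpha> m (\<lambda>_. 0) v) \<partial>coords I)"
      unfolding E_def
    proof (rule slab_integral_le_elementary[OF \<open>finite I\<close> \<alpha>])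
      show "emeasure lborel (\<Union>(\<F> n i)) \<le> ennreal (2 * m i)" if "i < N" for i
      proof -
        have "emeasure lborel (E n i) \<le> emeasure lborel (U i)"
          using E_sub U by (intro emeasure_mono) auto
        then show ?thesis using m(1)[OF that] by (simp add: E_def)
      qed
    qed (use \<F>cbox m in \<open>auto simp: \<F>_def\<close>)
  qed
  finally show ?thesis .
qed

text \<open>The functional is monotone in the sets, so an open superset of nearly the same length
  may replace each set on the left; the bound for centred intervals depends continuously on their
  half-lengths.\<close>

lemma slab_integral_le:
  assumes "finite I" and \<alpha>: "\<And>i. 0 \<le> \<alpha> i" and A[measurable]: "\<And>i. A i \<in> sets borel"
    and fin: "\<And>i. emeasure lborel (A i) < \<infinity>"
  shows "slab_integral I \<rho> N x \<alpha> A
    \<le> (\<integral>\<^sup>+ v. ennreal (box_integrand I \<rho> N x \<alpha> (\<lambda>i. measure lborel (A i) / 2) (\<lambda>_. 0) v) \<partial>coords I)"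
proof -
  define \<delta> where "\<delta> k = 1 / real (Suc k)" for k
  \<comment> \<open>Twice this exceeds the length of \<open>A i\<close> by
    \<open>2 * \<delta> k\<close>, enough room for an open superset with excess below
    \<open>\<delta> k\<close>.\<close>
  define m where "m k i = measure lborel (A i) / 2 + \<delta> k" for k i
  have \<delta>: "\<delta> k > 0" for k by (simp add: \<delta>_def)
  have lim_\<delta>: "\<delta> \<longlonglongrightarrow> 0"
    unfolding \<delta>_def using LIMSEQ_inverse_real_of_nat by (simp add: inverse_eq_divide)
  have le: "slab_integral I \<rho> N x \<alpha> A \<le> (\<integral>\<^sup>+ v. ennreal (box_integrand I \<rho> N x \<alpha> (m k) (\<lambda>_. 0) v) \<partial>coords I)" for k
  proof -
    have "\<exists>U. open U \<and> A i \<subseteq> U \<and> emeasure lborel (U - A i) < ennreal (\<delta> k)" for i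
      using outer_regular_lborel[OF A \<delta>] by metis
    then obtain U where U: "\<And>i. open (U i)" "\<And>i. A i \<subseteq> U i" "\<And>i. emeasure lborel (U i - A i) < ennreal (\<delta> k)"
      by metis
    have "slab_integral I \<rho> N x \<alpha> A \<le> slab_integral I \<rho> N x \<alpha> U"
      unfolding slab_integral_def using U by (intro nn_integral_mono mult_left_mono prod_mono_ennreal slab_mono) auto
    also have "\<dots> \<le> (\<integral>\<^sup>+ v. ennreal (box_integrand I \<rho> N x \<alpha> (m k) (\<lambda>_. 0) v) \<partial>coords I)"
    proof (rule slab_integral_le_open[OF \<open>finite I\<close> \<alpha> U(1)])
      fix i
      have "emeasure lborel (U i) = emeasure lborel (A i) + emeasure lborel (U i - A i)"
        using U by (subst plus_emeasure) (auto intro!: arg_cong[where f = "emeasure lborel"])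
      also have "\<dots> \<le> ennreal (measure lborel (A i)) + ennreal (\<delta> k)"
        using U(3)[of i] fin[of i] by (intro add_mono) (auto simp: emeasure_eq_ennreal_measure less_imp_le)
      also have "\<dots> \<le> ennreal (2 * m k i)"
        using \<delta>[of k] by (subst ennreal_plus[symmetric]) (auto simp: m_def intro!: ennreal_leI)
      finally show "emeasure lborel (U i) \<le> ennreal (2 * m k i)" .
      show "0 \<le> m k i" using \<delta>[of k] by (simp add: m_def)
    qed
    finally show ?thesis .
  qed
  have "(\<lambda>k. \<integral>\<^sup>+ v. ennreal (box_integrand I \<rho> N x \<alpha> (m k) (\<lambda>_. 0) v) \<partial>coords I)
    \<longlonglongrightarrow> (\<integral>\<^sup>+ v. ennreal (box_integrand I \<rho> N x \<alpha> (\<lambda>i. measure lborel (A i) / 2) (\<lambda>_. 0) v) \<partial>coords I)"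
  proof (rule nn_integral_dominated_convergence)
    let ?w = "\<lambda>v. ennreal (\<Prod>i<N. 2 * \<alpha> i) * indicator (ball_sq I \<rho>) v"
    show "(\<integral>\<^sup>+ v. ?w v \<partial>coords I) < \<infinity>"
      using emeasure_cball2_finite[OF \<open>finite I\<close>, of \<rho>] by (simp add: nn_integral_cmult ennreal_mult_less_top)
    show "AE v in coords I. ennreal (box_integrand I \<rho> N x \<alpha> (m k) (\<lambda>_. 0) v) \<le> ?w v" for k
    proof (rule AE_I2)
      fix v
      have "(\<Prod>i<N. trapezoid (m k i) (\<alpha> i) (0 + lin I (x i) v)) \<le> (\<Prod>i<N. 2 * \<alpha> i)"
        by (intro prod_mono conjI trapezoid_le \<alpha>) auto
      then show "ennreal (box_integrand I \<rho> N x \<alpha> (m k) (\<lambda>_. 0) v) \<le> ?w v"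
        by (auto simp: box_integrand_def split: split_indicator intro!: ennreal_leI)
    qed
    have "(\<lambda>k. m k i) \<longlonglongrightarrow> measure lborel (A i) / 2" for i
      unfolding m_def using tendsto_add[OF tendsto_const lim_\<delta>] by simp
    then show "AE v in coords I. (\<lambda>k. ennreal (box_integrand I \<rho> N x \<alpha> (m k) (\<lambda>_. 0) v))
      \<longlonglongrightarrow> ennreal (box_integrand I \<rho> N x \<alpha> (\<lambda>i. measure lborel (A i) / 2) (\<lambda>_. 0) v)"
      unfolding box_integrand_def trapezoid_def
      by (intro AE_I2 tendsto_ennrealI tendsto_intros)
  qed measurable
  then show ?thesis using le by (intro LIMSEQ_le_const) auto
qed

subsection \<open>Steiner symmetrisation\<close>

definition emb :: "'a::euclidean_space \<Rightarrow> ('a \<Rightarrow> real) \<Rightarrow> real \<Rightarrow> 'a" where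
  "emb e v s = (\<Sum>b\<in>Basis - {e}. v b *\<^sub>R b) + s *\<^sub>R e"

lemma emb_measurable [measurable (raw)]:
  assumes "f \<in> M \<rightarrow>\<^sub>M coords (Basis - {e})" and [measurable]: "g \<in> borel_measurable M"
  shows "(\<lambda>x. emb e (f x) (g x)) \<in> borel_measurable M"
proof -
  have [measurable]: "(\<lambda>x. f x b) \<in> borel_measurable M" if "b \<in> Basis - {e}" for b
    using measurable_compose[OF assms(1) measurable_component_singleton[OF that]] by simp
  show ?thesis unfolding emb_def by measurable
qed

lemma nn_integral_emb:
  fixes F :: "'a::euclidean_space \<Rightarrow> ennreal"
  assumes e: "e \<in> Basis" and [measurable]: "F \<in> borel_measurable borel"
  shows "(\<integral>\<^sup>+ x. F x \<partial>lborel) = (\<integral>\<^sup>+ v. \<integral>\<^sup>+ s. F (emb e v s) \<partial>lborel \<partial>coords (Basis - {e}))"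
proof -
  let ?h = "\<lambda>f. \<Sum>b\<in>Basis. f b *\<^sub>R (b :: 'a)"
  have Basis: "(Basis :: 'a set) = insert e (Basis - {e})" using e by auto
  have [measurable]: "?h \<in> borel_measurable (coords Basis)" by measurable
  have "(\<integral>\<^sup>+ x. F x \<partial>lborel) = (\<integral>\<^sup>+ f. F (?h f) \<partial>coords (insert e (Basis - {e})))"
    unfolding Basis[symmetric] by (subst lborel_eq[where 'a = 'a], subst nn_integral_distr) auto
  also have "\<dots> = (\<integral>\<^sup>+ v. \<integral>\<^sup>+ s. F (?h (v(e := s))) \<partial>lborel \<partial>coords (Basis - {e}))"
    by (rule lborel_product.product_nn_integral_insert) (auto simp: Basis[symmetric])
  finally have *: "(\<integral>\<^sup>+ x. F x \<partial>lborel) = (\<integral>\<^sup>+ v. \<integral>\<^sup>+ s. F (?h (v(e := s))) \<partial>lborel \<partial>coords (Basis - {e}))" .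
  have "?h (v(e := s)) = emb e v s" for v s
  proof -
    have "?h (v(e := s)) = s *\<^sub>R e + (\<Sum>b\<in>Basis - {e}. (v(e := s)) b *\<^sub>R b)"
      using e by (subst sum.remove[of _ e]) auto
    also have "(\<Sum>b\<in>Basis - {e}. (v(e := s)) b *\<^sub>R b) = (\<Sum>b\<in>Basis - {e}. v b *\<^sub>R b)"
      by (intro sum.cong) auto
    finally show ?thesis by (simp add: emb_def)
  qed
  then show ?thesis unfolding * by simp
qed

lemma emb_inner_e: "e \<in> Basis \<Longrightarrow> emb e v s \<bullet> e = s"
  by (simp add: emb_def inner_add_left inner_sum_left inner_Basis if_distrib sum.delta cong: if_cong)

lemma emb_shift: "e \<in> Basis \<Longrightarrow> emb e v t + (s - t) *\<^sub>R e = emb e v s"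
  by (simp add: emb_def algebra_simps)

lemma emb_inner_emb:
  assumes e: "e \<in> Basis"
  shows "emb e v s \<bullet> emb e w r = lin (Basis - {e}) v w + s * r"
proof -
  have "b \<bullet> (\<Sum>c\<in>Basis - {e}. w c *\<^sub>R c) = w b" if "b \<in> Basis - {e}" for b
  proof -
    have "b \<bullet> (\<Sum>c\<in>Basis - {e}. w c *\<^sub>R c) = (\<Sum>c\<in>Basis - {e}. if c = b then w b else 0)"
      unfolding inner_sum_right using that by (intro sum.cong) (auto simp: inner_Basis)
    then show ?thesis using that by simp
  qed
  then have 1: "(\<Sum>b\<in>Basis - {e}. v b *\<^sub>R b) \<bullet> (\<Sum>b\<in>Basis - {e}. w b *\<^sub>R b) = lin (Basis - {e}) v w"
    by (simp add: inner_sum_left lin_def)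
  have 2: "(\<Sum>b\<in>Basis - {e}. u b *\<^sub>R b) \<bullet> e = 0" for u :: "'a \<Rightarrow> real"
    using e by (auto simp: inner_sum_left inner_Basis intro!: sum.neutral)
  have 3: "e \<bullet> (\<Sum>b\<in>Basis - {e}. u b *\<^sub>R b) = 0" for u :: "'a \<Rightarrow> real"
    by (subst inner_commute) (rule 2)
  show ?thesis
    using e by (simp add: emb_def inner_add_left inner_add_right 1 2 3)
qed

lemma norm_emb:
  assumes e: "e \<in> Basis"
  shows "(norm (emb e w r))\<^sup>2 = (\<Sum>b\<in>Basis - {e}. (w b)\<^sup>2) + r\<^sup>2"
  unfolding power2_norm_eq_inner emb_inner_emb[OF e] by (simp add: lin_def power2_eq_square)

definition slice :: "'a::euclidean_space \<Rightarrow> 'a set \<Rightarrow> ('a \<Rightarrow> real) \<Rightarrow> real set" where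
  "slice e A v = {s. emb e v s \<in> A}"

lemma slice_measurable [measurable]:
  assumes [measurable]: "A \<in> sets borel" shows "slice e A v \<in> sets borel"
proof -
  have "(\<lambda>s. emb e v s) \<in> borel_measurable borel" unfolding emb_def by measurable
  from measurable_sets[OF this assms] show ?thesis by (simp add: slice_def vimage_def)
qed

lemma slice_finite:
  assumes e: "e \<in> Basis" and "bounded A"
  shows "emeasure lborel (slice e A v) < \<infinity>"
proof -
  obtain B where B: "\<And>x. x \<in> A \<Longrightarrow> norm x \<le> B" using \<open>bounded A\<close> by (auto simp: bounded_iff)
  have "slice e A v \<subseteq> cball 0 B"
  proof
    fix s assume "s \<in> slice e A v"
    then have "norm (emb e v s) \<le> B" using B by (auto simp: slice_def)
    moreover have "\<bar>emb e v s \<bullet> e\<bar> \<le> norm (emb e v s)" using e by (rule Basis_le_norm)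
    ultimately show "s \<in> cball 0 B" using e by (simp add: emb_inner_e)
  qed
  then have "bounded (slice e A v)" using bounded_cball bounded_subset by blast
  then show ?thesis by (rule emeasure_bounded_finite)
qed

text \<open>The inner set is the trace of \<open>A\<close> on the line through x parallel to
  \<open>e\<close>, parametrised by the coordinate along \<open>e\<close>; it is replaced by the
  open centred interval of equal length. As \<open>measure\<close> sends infinite length to 0,
  volume preservation below is stated for bounded sets.\<close>

definition steiner :: "'a::euclidean_space \<Rightarrow> 'a set \<Rightarrow> 'a set" where
  "steiner e A = {x. 2 * \<bar>x \<bullet> e\<bar> < measure lborel {s. x + (s - x \<bullet> e) *\<^sub>R e \<in> A}}"

lemma steiner_measurable [measurable]:
  fixes A :: "'a::euclidean_space set"
  assumes [measurable]: "A \<in> sets borel" shows "steiner e A \<in> sets borel"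
proof -
  have [measurable]: "(\<lambda>x. emeasure lborel {s \<in> space lborel. x + (s - x \<bullet> e) *\<^sub>R e \<in> A}) \<in> borel_measurable borel"
    by measurable
  then have [measurable]: "(\<lambda>x. measure lborel {s. x + (s - x \<bullet> e) *\<^sub>R e \<in> A}) \<in> borel_measurable borel"
    unfolding measure_def by simp
  show ?thesis unfolding steiner_def by measurable
qed

lemma slice_steiner:
  assumes e: "e \<in> Basis"
  shows "slice e (steiner e A) v = {t. 2 * \<bar>t\<bar> < measure lborel (slice e A v)}"
  unfolding slice_def steiner_def by (simp add: emb_inner_e[OF e] emb_shift[OF e])

lemma slab_symmetric_interval:
  assumes "0 \<le> m" "0 \<le> a"
  shows "slab {t. 2 * \<bar>t\<bar> < m} a l = ennreal (trapezoid (m / 2) a (0 + l))"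
proof -
  have "slab {t. 2 * \<bar>t\<bar> < m} a l = emeasure lborel ({0 - m / 2..0 + m / 2} \<inter> {s. \<bar>s + l\<bar> < a})"
    unfolding slab_def
  proof (rule emeasure_eq_AE)
    have "AE s in lborel. s \<noteq> m / 2 \<and> s \<noteq> - (m / 2)" by (intro AE_conjI AE_lborel_singleton)
    then show "AE s in lborel. s \<in> {t \<in> {t. 2 * \<bar>t\<bar> < m}. \<bar>t + l\<bar> < a} \<longleftrightarrow> s \<in> {0 - m / 2..0 + m / 2} \<inter> {s. \<bar>s + l\<bar> < a}"
      by eventually_elim auto
  qed measurable
  then show ?thesis using assms by (simp add: emeasure_Icc_Int_slab[of "m / 2" a 0 l, simplified])
qed

section \<open>The slab functional of a tuple of sets\<close>

definition slab_vol :: "'a::euclidean_space set \<Rightarrow> real \<Rightarrow> 'a \<Rightarrow> ennreal" where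
  "slab_vol A a y = emeasure lborel {x \<in> A. \<bar>x \<bullet> y\<bar> < a}"

lemma slab_vol_measurable [measurable]:
  fixes A :: "'a::euclidean_space set"
  assumes [measurable]: "A \<in> sets borel"
  shows "slab_vol A a \<in> borel_measurable borel"
proof -
  have "(\<lambda>y. emeasure lborel {x \<in> space lborel. x \<in> A \<and> \<bar>x \<bullet> y\<bar> < a}) \<in> borel_measurable borel"
    by measurable
  then show ?thesis by (simp add: slab_vol_def[abs_def])
qed

text \<open>The sets interact only through the common y. Restricting y to a centred ball gives
  integrable majorants and is compatible both with rotations and with freezing one coordinate of
  y.\<close>

definition slab_product :: "real \<Rightarrow> nat \<Rightarrow> (nat \<Rightarrow> real) \<Rightarrow> (nat \<Rightarrow> 'a::euclidean_space set) \<Rightarrow> ennreal" where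
  "slab_product R N \<alpha> A = (\<integral>\<^sup>+ y. indicator (ball 0 R) y * (\<Prod>i<N. slab_vol (A i) (\<alpha> i) y) \<partial>lborel)"

lemma slab_slice_measurable [measurable (raw)]:
  fixes A :: "'a::euclidean_space set"
  assumes [measurable]: "A \<in> sets borel" and f: "f \<in> M \<rightarrow>\<^sub>M coords (Basis - {e})" and [measurable]: "g \<in> borel_measurable M"
  shows "(\<lambda>z. slab (slice e A (f z)) a (g z)) \<in> borel_measurable M"
proof -
  have "(\<lambda>z. emeasure lborel {s \<in> space lborel. emb e (f z) s \<in> A \<and> \<bar>s + g z\<bar> < a}) \<in> borel_measurable M"
    using f by measurable
  then show ?thesis by (simp add: slab_def slice_def)
qed

lemma lin_measurable2 [measurable (raw)]:
  assumes "f \<in> M \<rightarrow>\<^sub>M coords I" "g \<in> M \<rightarrow>\<^sub>M coords I"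
  shows "(\<lambda>z. lin I (f z) (g z)) \<in> borel_measurable M"
proof -
  have [measurable]: "(\<lambda>x. f x b) \<in> borel_measurable M" "(\<lambda>x. g x b) \<in> borel_measurable M" if "b \<in> I" for b
    using measurable_compose[OF assms(1) measurable_component_singleton[OF that]]
      measurable_compose[OF assms(2) measurable_component_singleton[OF that]] by simp_all
  show ?thesis unfolding lin_def by measurable
qed

text \<open>Splitting y into its coordinate r along \<open>e\<close> and the rest w, and the i-th
  point into s and \<open>X i\<close>, the slab condition becomes a condition on s with window
  half-width \<open>\<alpha> i / \<bar>r\<bar>\<close> and displacement linear in w. Fubini moves w
  to the innermost place, where it runs over the ball of squared radius
  \<open>R\<^sup>2 - r\<^sup>2\<close>; r and \<open>X\<close> are then mere parameters.\<close>

lemma slab_product_slices: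
  fixes A :: "nat \<Rightarrow> 'a::euclidean_space set"
  assumes e: "e \<in> Basis" and R: "0 < R" and A[measurable]: "\<And>i. A i \<in> sets borel"
  defines "I \<equiv> Basis - {e}"
  shows "slab_product R N \<alpha> A = (\<integral>\<^sup>+ r. \<integral>\<^sup>+ X. slab_integral I (R\<^sup>2 - r\<^sup>2) N (\<lambda>i j. X i j / r) (\<lambda>i. \<alpha> i / \<bar>r\<bar>) (\<lambda>i. slice e (A i) (X i))
           \<partial>Pi\<^sub>M {..<N} (\<lambda>_. coords I) \<partial>lborel)"
proof -
  have [simp]: "finite I" by (simp add: I_def)
  have [measurable]: "ball (0::'a) R \<in> sets borel" by simp
  interpret cI: sigma_finite_measure "coords I" by (rule lborel_product.sigma_finite) simp
  interpret PN: product_sigma_finite "\<lambda>_ :: nat. coords I" by standard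
  interpret VN: sigma_finite_measure "Pi\<^sub>M {..<N} (\<lambda>_. coords I)" by (rule PN.sigma_finite) simp
  interpret F1: pair_sigma_finite "coords I" "lborel :: real measure" by standard
  interpret F2: pair_sigma_finite "coords I" "Pi\<^sub>M {..<N} (\<lambda>_. coords I)" by standard
  have "slab_product R N \<alpha> A = (\<integral>\<^sup>+ w. \<integral>\<^sup>+ r. indicator (ball 0 R) (emb e w r) * (\<Prod>i<N. slab_vol (A i) (\<alpha> i) (emb e w r)) \<partial>lborel \<partial>coords I)"
    unfolding slab_product_def I_def by (rule nn_integral_emb[OF e]) measurable
  also have "\<dots> = (\<integral>\<^sup>+ r. \<integral>\<^sup>+ w. indicator (ball 0 R) (emb e w r) * (\<Prod>i<N. slab_vol (A i) (\<alpha> i) (emb e w r)) \<partial>coords I \<partial>lborel)"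
    unfolding I_def by (rule F1.Fubini'[symmetric, unfolded I_def]) measurable
  also have "\<dots> = (\<integral>\<^sup>+ r. \<integral>\<^sup>+ X. slab_integral I (R\<^sup>2 - r\<^sup>2) N (\<lambda>i j. X i j / r) (\<lambda>i. \<alpha> i / \<bar>r\<bar>) (\<lambda>i. slice e (A i) (X i))
           \<partial>Pi\<^sub>M {..<N} (\<lambda>_. coords I) \<partial>lborel)"
  proof (rule nn_integral_cong_AE)
    \<comment> \<open>The division by r fails only on the null set r = 0.\<close>
    have "AE r in lborel. r \<noteq> (0::real)" by (rule AE_lborel_singleton)
    then show "AE r in lborel. (\<integral>\<^sup>+ w. indicator (ball 0 R) (emb e w r) * (\<Prod>i<N. slab_vol (A i) (\<alpha> i) (emb e w r)) \<partial>coords I)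
      = (\<integral>\<^sup>+ X. slab_integral I (R\<^sup>2 - r\<^sup>2) N (\<lambda>i j. X i j / r) (\<lambda>i. \<alpha> i / \<bar>r\<bar>) (\<lambda>i. slice e (A i) (X i))
           \<partial>Pi\<^sub>M {..<N} (\<lambda>_. coords I))"
    proof eventually_elim
      case (elim r)
      have lin: "lin I (\<lambda>j. v j / r) w = lin I v w / r" for v w :: "'a \<Rightarrow> real"
        by (simp add: lin_def sum_divide_distrib)
      have vol: "slab_vol (A i) (\<alpha> i) (emb e w r)
          = (\<integral>\<^sup>+ v. slab (slice e (A i) v) (\<alpha> i / \<bar>r\<bar>) (lin I v w / r) \<partial>coords I)" for i w
      proof -
        have "slab_vol (A i) (\<alpha> i) (emb e w r) = (\<integral>\<^sup>+ x. indicator {x \<in> A i. \<bar>x \<bullet> emb e w r\<bar> < \<alpha> i} x \<partial>lborel)"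
          by (simp add: slab_vol_def)
        also have "\<dots> = (\<integral>\<^sup>+ v. \<integral>\<^sup>+ s. indicator {x \<in> A i. \<bar>x \<bullet> emb e w r\<bar> < \<alpha> i} (emb e v s) \<partial>lborel \<partial>coords I)"
          unfolding I_def by (rule nn_integral_emb[OF e]) measurable
        also have "\<dots> = (\<integral>\<^sup>+ v. slab (slice e (A i) v) (\<alpha> i / \<bar>r\<bar>) (lin I v w / r) \<partial>coords I)"
        proof (rule nn_integral_cong)
          fix v
          have iff: "\<bar>emb e v s \<bullet> emb e w r\<bar> < \<alpha> i \<longleftrightarrow> \<bar>s + lin I v w / r\<bar> < \<alpha> i / \<bar>r\<bar>" for s
          proof -
            have "emb e v s \<bullet> emb e w r = (s + lin I v w / r) * r"
              using elim by (simp add: emb_inner_emb[OF e] I_def field_simps)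
            then show ?thesis using elim by (simp add: abs_mult pos_less_divide_eq)
          qed
          have "(\<integral>\<^sup>+ s. indicator {x \<in> A i. \<bar>x \<bullet> emb e w r\<bar> < \<alpha> i} (emb e v s) \<partial>lborel)
             = (\<integral>\<^sup>+ s. indicator {s \<in> slice e (A i) v. \<bar>s + lin I v w / r\<bar> < \<alpha> i / \<bar>r\<bar>} s \<partial>lborel)"
            by (intro nn_integral_cong) (auto simp: slice_def iff split: split_indicator)
          then show "(\<integral>\<^sup>+ s. indicator {x \<in> A i. \<bar>x \<bullet> emb e w r\<bar> < \<alpha> i} (emb e v s) \<partial>lborel) = slab (slice e (A i) v) (\<alpha> i / \<bar>r\<bar>) (lin I v w / r)"
            by (simp add: slab_def)
        qed
        finally show ?thesis .
      qed
      have ball: "indicator (ball 0 R) (emb e w r) = (indicator (ball_sq I (R\<^sup>2 - r\<^sup>2)) w :: ennreal)" if "w \<in> space (coords I)" for w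
      proof -
        have "norm (emb e w r) < R \<longleftrightarrow> (norm (emb e w r))\<^sup>2 < R\<^sup>2"
          using R by (metis less_eq_real_def norm_ge_zero power2_less_imp_less power_strict_mono pos2)
        then show ?thesis using that
          by (auto simp: ball_sq_def norm_emb[OF e] I_def split: split_indicator)
      qed
      have "(\<integral>\<^sup>+ w. indicator (ball 0 R) (emb e w r) * (\<Prod>i<N. slab_vol (A i) (\<alpha> i) (emb e w r)) \<partial>coords I)
        = (\<integral>\<^sup>+ w. \<integral>\<^sup>+ X. indicator (ball_sq I (R\<^sup>2 - r\<^sup>2)) w * (\<Prod>i<N. slab (slice e (A i) (X i)) (\<alpha> i / \<bar>r\<bar>) (lin I (X i) w / r)) \<partial>Pi\<^sub>M {..<N} (\<lambda>_. coords I) \<partial>coords I)"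
      proof (rule nn_integral_cong)
        fix w assume w: "w \<in> space (coords I)"
        have [measurable]: "(\<lambda>v. slab (slice e (A i) v) (\<alpha> i / \<bar>r\<bar>) (lin I v w / r)) \<in> borel_measurable (coords I)" for i
          using w unfolding I_def by measurable
        have "(\<Prod>i<N. slab_vol (A i) (\<alpha> i) (emb e w r))
          = (\<integral>\<^sup>+ X. (\<Prod>i<N. slab (slice e (A i) (X i)) (\<alpha> i / \<bar>r\<bar>) (lin I (X i) w / r)) \<partial>Pi\<^sub>M {..<N} (\<lambda>_. coords I))"
          unfolding vol by (rule PN.product_nn_integral_prod[symmetric]) auto
        then show "indicator (ball 0 R) (emb e w r) * (\<Prod>i<N. slab_vol (A i) (\<alpha> i) (emb e w r))
          = (\<integral>\<^sup>+ X. indicator (ball_sq I (R\<^sup>2 - r\<^sup>2)) w * (\<Prod>i<N. slab (slice e (A i) (X i)) (\<alpha> i / \<bar>r\<bar>) (lin I (X i) w / r)) \<partial>Pi\<^sub>M {..<N} (\<lambda>_. coords I))"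
          unfolding ball[OF w] by (subst nn_integral_cmult) auto
      qed
      also have "\<dots> = (\<integral>\<^sup>+ X. \<integral>\<^sup>+ w. indicator (ball_sq I (R\<^sup>2 - r\<^sup>2)) w * (\<Prod>i<N. slab (slice e (A i) (X i)) (\<alpha> i / \<bar>r\<bar>) (lin I (X i) w / r)) \<partial>coords I \<partial>Pi\<^sub>M {..<N} (\<lambda>_. coords I))"
        by (rule F2.Fubini'[symmetric]) (unfold I_def, measurable)
      finally show ?case unfolding slab_integral_def lin .
    qed
  qed
  finally show ?thesis .
qed

text \<open>For every r and \<open>X\<close> the one-dimensional inequality applies to the slices.
  Its right-hand side is the same functional of centred intervals, and these are the slices of the
  symmetrised sets.\<close>

lemma slab_product_le_steiner:
  fixes A :: "nat \<Rightarrow> 'a::euclidean_space set"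
  assumes e: "e \<in> Basis" and R: "0 < R" and \<alpha>: "\<And>i. 0 \<le> \<alpha> i"
    and A: "\<And>i. A i \<in> sets borel" "\<And>i. bounded (A i)"
  shows "slab_product R N \<alpha> A \<le> slab_product R N \<alpha> (\<lambda>i. steiner e (A i))"
proof -
  let ?I = "Basis - {e}"
  have "slab_integral ?I \<rho> N x \<beta> (\<lambda>i. slice e (A i) (X i)) \<le> slab_integral ?I \<rho> N x \<beta> (\<lambda>i. slice e (steiner e (A i)) (X i))"
    if \<beta>: "\<And>i. 0 \<le> \<beta> i" for \<rho> x \<beta> X
  proof -
    have "slab_integral ?I \<rho> N x \<beta> (\<lambda>i. slice e (A i) (X i))
      \<le> (\<integral>\<^sup>+ v. ennreal (box_integrand ?I \<rho> N x \<beta> (\<lambda>i. measure lborel (slice e (A i) (X i)) / 2) (\<lambda>_. 0) v) \<partial>coords ?I)"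
      using slice_finite[OF e A(2)] A(1) \<beta> by (intro slab_integral_le) auto
    also have "\<dots> = slab_integral ?I \<rho> N x \<beta> (\<lambda>i. slice e (steiner e (A i)) (X i))"
      unfolding slab_integral_def slice_steiner[OF e] box_integrand_def
      using \<beta> by (intro nn_integral_cong)
        (auto simp: slab_symmetric_interval prod_ennreal simp del: add_0 split: split_indicator)
    finally show ?thesis .
  qed
  then show ?thesis
    unfolding slab_product_slices[OF e R A(1)] slab_product_slices[OF e R steiner_measurable[OF A(1)]]
    using \<alpha> by (intro nn_integral_mono) auto
qed

section \<open>Invariance under translations, reflections and orthogonal maps\<close>

lemma nn_integral_lborel_shift:
  fixes F :: "'a::euclidean_space \<Rightarrow> ennreal"
  assumes [measurable]: "F \<in> borel_measurable borel"
  shows "(\<integral>\<^sup>+ x. F (a + x) \<partial>lborel) = (\<integral>\<^sup>+ x. F x \<partial>lborel)"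
proof -
  have "(\<integral>\<^sup>+ x. F x \<partial>lborel) = (\<integral>\<^sup>+ x. F x \<partial>distr lborel borel ((+) a))"
    by (simp add: lborel_distr_plus)
  also have "\<dots> = (\<integral>\<^sup>+ x. F (a + x) \<partial>lborel)" by (intro nn_integral_distr) auto
  finally show ?thesis by simp
qed

lemma nn_integral_lborel_reflect:
  fixes F :: "'a::euclidean_space \<Rightarrow> ennreal"
  assumes [measurable]: "F \<in> borel_measurable borel"
  shows "(\<integral>\<^sup>+ x. F (a - x) \<partial>lborel) = (\<integral>\<^sup>+ x. F x \<partial>lborel)"
proof -
  have "lborel = density (distr lborel borel (\<lambda>x. a + (-1) *\<^sub>R x :: 'a)) (\<lambda>_. ennreal (\<bar>-1\<bar> ^ DIM('a)))"
    by (rule lborel_affine) simp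
  then have "distr lborel borel (\<lambda>x. a - x) = (lborel :: 'a measure)"
    by (simp add: density_1)
  then have "(\<integral>\<^sup>+ x. F x \<partial>lborel) = (\<integral>\<^sup>+ x. F x \<partial>distr lborel borel (\<lambda>x. a - x))" by simp
  also have "\<dots> = (\<integral>\<^sup>+ x. F (a - x) \<partial>lborel)" by (intro nn_integral_distr) auto
  finally show ?thesis by simp
qed

lemma orthogonal_transformation_borel_measurable:
  fixes U :: "'a::euclidean_space \<Rightarrow> 'a"
  assumes "orthogonal_transformation U" shows "U \<in> borel_measurable borel"
  using assms by (intro borel_measurable_continuous_onI linear_continuous_on linear_conv_bounded_linear[THEN iffD1])
    (simp add: orthogonal_transformation_def)

text \<open>The usual uniqueness argument for Haar measure: with \<open>B\<close> the unit ball, integrate the indicator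
  of \<open>A\<close> at \<open>U x\<close> times that of \<open>B\<close> at \<open>y + U x\<close> in both orders.\<close>

lemma emeasure_lborel_orthogonal_vimage:
  fixes U :: "'a::euclidean_space \<Rightarrow> 'a"
  assumes U: "orthogonal_transformation U" and [measurable]: "A \<in> sets borel"
  shows "emeasure lborel (U -` A) = emeasure lborel A"
proof -
  have linU: "linear U" using U by (simp add: orthogonal_transformation_def)
  note [measurable] = orthogonal_transformation_borel_measurable[OF U]
  define V where "V = inv U"
  have V: "U (V x) = x" for x
    unfolding V_def by (rule surj_f_inv_f[OF orthogonal_transformation_surj[OF U]])
  define B :: "'a set" where "B = ball 0 1"
  have [measurable]: "B \<in> sets borel" by (simp add: B_def)
  have [measurable]: "U -` A \<in> sets borel" "U -` B \<in> sets borel"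
    using measurable_sets[of U borel borel] by auto
  have UB: "U -` B = B" using orthogonal_transformation_norm[OF U] by (auto simp: B_def)
  have Bfin: "emeasure lborel B \<noteq> top" "emeasure lborel B \<noteq> 0"
  proof -
    show "emeasure lborel B \<noteq> top" unfolding B_def using emeasure_lborel_ball_finite[of 0 1] by (simp add: less_top)
    have "measure lborel (ball (0::'a) 1) > 0" by (rule content_ball_pos) simp
    then show "emeasure lborel B \<noteq> 0" unfolding B_def by (auto simp: measure_def)
  qed
  have "(\<integral>\<^sup>+ y. \<integral>\<^sup>+ x. indicator A (U x) * indicator B (y + U x) \<partial>lborel \<partial>lborel)
      = (\<integral>\<^sup>+ x. \<integral>\<^sup>+ y. indicator A (U x) * indicator B (y + U x) \<partial>lborel \<partial>lborel)"
    by (rule lborel_pair.Fubini') measurable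
  also have "\<dots> = (\<integral>\<^sup>+ x. indicator (U -` A) x * emeasure lborel B \<partial>lborel)"
  proof (rule nn_integral_cong)
    fix x
    have "(\<integral>\<^sup>+ y. indicator A (U x) * indicator B (y + U x) \<partial>lborel) = indicator A (U x) * (\<integral>\<^sup>+ y. indicator B (U x + y) \<partial>lborel)"
      by (subst nn_integral_cmult) (auto simp: add.commute)
    also have "\<dots> = indicator A (U x) * emeasure lborel B"
      by (subst nn_integral_lborel_shift) auto
    finally show "(\<integral>\<^sup>+ y. indicator A (U x) * indicator B (y + U x) \<partial>lborel) = indicator (U -` A) x * emeasure lborel B"
      by (simp add: indicator_def)
  qed
  also have "\<dots> = emeasure lborel (U -` A) * emeasure lborel B" by (simp add: nn_integral_multc)
  finally have 1: "(\<integral>\<^sup>+ y. \<integral>\<^sup>+ x. indicator A (U x) * indicator B (y + U x) \<partial>lborel \<partial>lborel) = emeasure lborel (U -` A) * emeasure lborel B" .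
  have "(\<integral>\<^sup>+ y. \<integral>\<^sup>+ x. indicator A (U x) * indicator B (y + U x) \<partial>lborel \<partial>lborel)
      = (\<integral>\<^sup>+ y. \<integral>\<^sup>+ x. indicator A (U x - y) * indicator B (U x) \<partial>lborel \<partial>lborel)"
  proof (rule nn_integral_cong)
    fix y
    have "(\<integral>\<^sup>+ x. indicator A (U x - y) * indicator B (U x) \<partial>lborel) = (\<integral>\<^sup>+ x. indicator A (U (V y + x) - y) * indicator B (U (V y + x)) \<partial>lborel)"
      by (rule nn_integral_lborel_shift[symmetric]) measurable
    then show "(\<integral>\<^sup>+ x. indicator A (U x) * indicator B (y + U x) \<partial>lborel) = (\<integral>\<^sup>+ x. indicator A (U x - y) * indicator B (U x) \<partial>lborel)"
      by (simp add: linear_add[OF linU] V)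
  qed
  also have "\<dots> = (\<integral>\<^sup>+ x. \<integral>\<^sup>+ y. indicator A (U x - y) * indicator B (U x) \<partial>lborel \<partial>lborel)"
    by (rule lborel_pair.Fubini') measurable
  also have "\<dots> = (\<integral>\<^sup>+ x. emeasure lborel A * indicator (U -` B) x \<partial>lborel)"
  proof (rule nn_integral_cong)
    fix x
    have "(\<integral>\<^sup>+ y. indicator A (U x - y) * indicator B (U x) \<partial>lborel) = (\<integral>\<^sup>+ y. indicator A (U x - y) \<partial>lborel) * indicator B (U x)"
      by (subst nn_integral_multc) auto
    also have "\<dots> = emeasure lborel A * indicator B (U x)"
      by (subst nn_integral_lborel_reflect) auto
    finally show "(\<integral>\<^sup>+ y. indicator A (U x - y) * indicator B (U x) \<partial>lborel) = emeasure lborel A * indicator (U -` B) x"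
      by (simp add: indicator_def)
  qed
  also have "\<dots> = emeasure lborel A * emeasure lborel (U -` B)" by (simp add: nn_integral_cmult)
  finally have "emeasure lborel B * emeasure lborel (U -` A) = emeasure lborel B * emeasure lborel A"
    using 1 by (simp add: UB mult.commute)
  then show ?thesis using Bfin by (simp add: ennreal_mult_cancel_left)
qed

lemma nn_integral_lborel_orthogonal:
  fixes U :: "'a::euclidean_space \<Rightarrow> 'a"
  assumes U: "orthogonal_transformation U" and [measurable]: "F \<in> borel_measurable borel"
  shows "(\<integral>\<^sup>+ x. F (U x) \<partial>lborel) = (\<integral>\<^sup>+ x. F x \<partial>lborel)"
proof -
  note [measurable] = orthogonal_transformation_borel_measurable[OF U]
  have "distr lborel borel U = lborel"
    by (intro measure_eqI) (auto simp: emeasure_distr emeasure_lborel_orthogonal_vimage[OF U])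
  then have "(\<integral>\<^sup>+ x. F x \<partial>lborel) = (\<integral>\<^sup>+ x. F x \<partial>distr lborel borel U)" by simp
  also have "\<dots> = (\<integral>\<^sup>+ x. F (U x) \<partial>lborel)" by (intro nn_integral_distr) auto
  finally show ?thesis by simp
qed

text \<open>One map must act on all sets at once, since they are coupled through y: substituting in
  x moves \<open>U\<close> onto y, and a second substitution removes it there.\<close>

lemma slab_product_orthogonal:
  fixes U :: "'a::euclidean_space \<Rightarrow> 'a"
  assumes U: "orthogonal_transformation U" and A: "\<And>i. A i \<in> sets borel"
  shows "slab_product R N \<alpha> (\<lambda>i. U -` A i) = slab_product R N \<alpha> A"
proof -
  note [measurable] = orthogonal_transformation_borel_measurable[OF U] A
  have [measurable]: "ball (0::'a) R \<in> sets borel" by simp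
  have "slab_vol (U -` A i) a y = slab_vol (A i) a (U y)" for i a y
  proof -
    have eq: "{x \<in> U -` A i. \<bar>x \<bullet> y\<bar> < a} = U -` {x \<in> A i. \<bar>x \<bullet> U y\<bar> < a}"
      using U by (auto simp: orthogonal_transformation_def)
    show ?thesis
      unfolding slab_vol_def eq by (rule emeasure_lborel_orthogonal_vimage[OF U]) measurable
  qed
  then have "slab_product R N \<alpha> (\<lambda>i. U -` A i) = (\<integral>\<^sup>+ y. indicator (ball 0 R) (U y) * (\<Prod>i<N. slab_vol (A i) (\<alpha> i) (U y)) \<partial>lborel)"
    unfolding slab_product_def using orthogonal_transformation_norm[OF U]
    by (intro nn_integral_cong) (simp add: indicator_def)
  also have "\<dots> = slab_product R N \<alpha> A"
    unfolding slab_product_def by (rule nn_integral_lborel_orthogonal[OF U]) measurable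
  finally show ?thesis .
qed

text \<open>For distinct vectors this is the Householder reflection in the hyperplane orthogonal to
  \<open>e - d\<close>.\<close>

lemma orthogonal_transformation_unit_vectors:
  fixes e d :: "'a::euclidean_space"
  assumes "norm e = 1" "norm d = 1"
  obtains U where "orthogonal_transformation U" "U e = d"
proof (cases "e = d")
  case True
  then show ?thesis using that[of "\<lambda>x. x"] by simp
next
  case False
  define w where "w = e - d"
  define U where "U x = x - (2 * (x \<bullet> w) / (w \<bullet> w)) *\<^sub>R w" for x
  have w: "w \<bullet> w \<noteq> 0" using False by (simp add: w_def)
  have ee: "e \<bullet> e = 1" "d \<bullet> d = 1" using assms by (simp_all add: dot_square_norm)
  have "linear U"
    by (rule linearI) (auto simp: U_def inner_add_left algebra_simps add_divide_distrib)
  moreover have "U x \<bullet> U y = x \<bullet> y" for x y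
  proof -
    have "U x \<bullet> U y = x \<bullet> y - 2 * (y \<bullet> w) / (w \<bullet> w) * (x \<bullet> w) - 2 * (x \<bullet> w) / (w \<bullet> w) * (w \<bullet> y)
        + 2 * (x \<bullet> w) / (w \<bullet> w) * (2 * (y \<bullet> w) / (w \<bullet> w)) * (w \<bullet> w)"
      by (simp add: U_def inner_diff_left inner_diff_right algebra_simps)
    also have "w \<bullet> y = y \<bullet> w" by (rule inner_commute)
    finally show ?thesis using w by (simp add: field_simps)
  qed
  moreover have "U e = d"
  proof -
    have ww: "w \<bullet> w = 2 * (e \<bullet> w)"
      using ee by (simp add: w_def inner_diff_left inner_diff_right inner_commute)
    have one: "2 * (e \<bullet> w) / (w \<bullet> w) = 1" unfolding ww[symmetric] using w by (rule divide_self)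
    show ?thesis unfolding U_def one by (simp add: w_def)
  qed
  ultimately show ?thesis using that by (auto simp: orthogonal_transformation_def)
qed

section \<open>Volume, containment and overlap under Steiner symmetrisation\<close>

lemma emeasure_lborel_slices:
  assumes e: "e \<in> Basis" and [measurable]: "A \<in> sets borel"
  shows "emeasure lborel A = (\<integral>\<^sup>+ v. emeasure lborel (slice e A v) \<partial>coords (Basis - {e}))"
proof -
  have "emeasure lborel A = (\<integral>\<^sup>+ x. indicator A x \<partial>lborel)" by simp
  also have "\<dots> = (\<integral>\<^sup>+ v. \<integral>\<^sup>+ s. indicator A (emb e v s) \<partial>lborel \<partial>coords (Basis - {e}))"
    by (rule nn_integral_emb[OF e]) measurable
  also have "\<dots> = (\<integral>\<^sup>+ v. emeasure lborel (slice e A v) \<partial>coords (Basis - {e}))"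
  proof (rule nn_integral_cong)
    fix v
    have "(\<integral>\<^sup>+ s. indicator A (emb e v s) \<partial>lborel) = (\<integral>\<^sup>+ s. indicator (slice e A v) s \<partial>lborel)"
      by (intro nn_integral_cong) (auto simp: slice_def split: split_indicator)
    then show "(\<integral>\<^sup>+ s. indicator A (emb e v s) \<partial>lborel) = emeasure lborel (slice e A v)" by simp
  qed
  finally show ?thesis .
qed

lemma slice_emeasure_measurable [measurable]:
  assumes [measurable]: "A \<in> sets borel"
  shows "(\<lambda>v. emeasure lborel (slice e A v)) \<in> borel_measurable (coords (Basis - {e}))"
proof -
  have "(\<lambda>v. emeasure lborel {s \<in> space lborel. emb e v s \<in> A}) \<in> borel_measurable (coords (Basis - {e}))"
    by measurable
  then show ?thesis by (simp add: slice_def)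
qed

lemma emeasure_symmetric_interval: "0 \<le> m \<Longrightarrow> emeasure lborel {t::real. 2 * \<bar>t\<bar> < m} = ennreal m"
proof -
  assume "0 \<le> m"
  have "{t::real. 2 * \<bar>t\<bar> < m} = {- (m / 2)<..<m / 2}" by auto
  then show ?thesis using \<open>0 \<le> m\<close> by simp
qed

lemma emeasure_steiner:
  assumes e: "e \<in> Basis" and [measurable]: "A \<in> sets borel" and "bounded A"
  shows "emeasure lborel (steiner e A) = emeasure lborel A"
proof -
  have "emeasure lborel (slice e (steiner e A) v) = emeasure lborel (slice e A v)" for v
  proof -
    have "emeasure lborel (slice e A v) = ennreal (measure lborel (slice e A v))"
      using slice_finite[OF e \<open>bounded A\<close>, of v] by (intro emeasure_eq_ennreal_measure) (simp add: less_top)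
    then show ?thesis unfolding slice_steiner[OF e] by (subst emeasure_symmetric_interval) simp_all
  qed
  then show ?thesis by (simp add: emeasure_lborel_slices[OF e])
qed

text \<open>On the line through a point x outside the ball, points of \<open>A\<close> have a
  coordinate along \<open>e\<close> no larger in absolute value than that of x. The slice is thus
  too short for x to belong to the symmetrised set.\<close>

lemma steiner_subset_cball:
  assumes e: "e \<in> Basis" and A: "A \<subseteq> cball 0 R"
  shows "steiner e A \<subseteq> cball 0 R"
proof
  fix x assume x: "x \<in> steiner e A"
  show "x \<in> cball 0 R"
  proof (rule ccontr)
    assume "x \<notin> cball 0 R"
    then have xR: "R < norm x" by simp
    have "{s. x + (s - x \<bullet> e) *\<^sub>R e \<in> A} \<subseteq> {-\<bar>x \<bullet> e\<bar>..\<bar>x \<bullet> e\<bar>}"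
    proof
      fix s assume "s \<in> {s. x + (s - x \<bullet> e) *\<^sub>R e \<in> A}"
      then have "norm (x + (s - x \<bullet> e) *\<^sub>R e) \<le> R" using A by auto
      then have lt: "norm (x + (s - x \<bullet> e) *\<^sub>R e) < norm x" using xR by simp
      define d where "d = s - x \<bullet> e"
      have "(norm (x + d *\<^sub>R e))\<^sup>2 = (norm x)\<^sup>2 + 2 * d * (x \<bullet> e) + d\<^sup>2"
        unfolding power2_norm_eq_inner using e inner_commute[of e x]
        by (simp add: inner_add_left inner_add_right power2_eq_square algebra_simps)
      then have "(norm (x + (s - x \<bullet> e) *\<^sub>R e))\<^sup>2 = (norm x)\<^sup>2 - (x \<bullet> e)\<^sup>2 + s\<^sup>2"
        unfolding d_def by (simp add: power2_eq_square algebra_simps)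
      moreover have "(norm (x + (s - x \<bullet> e) *\<^sub>R e))\<^sup>2 < (norm x)\<^sup>2"
        using lt by (intro power_strict_mono) auto
      ultimately have "s\<^sup>2 \<le> (x \<bullet> e)\<^sup>2" by simp
      then have "\<bar>s\<bar> \<le> \<bar>x \<bullet> e\<bar>" by (simp add: abs_le_square_iff)
      then show "s \<in> {-\<bar>x \<bullet> e\<bar>..\<bar>x \<bullet> e\<bar>}" by (auto simp: abs_le_iff)
    qed
    then have sub: "{s. x + (s - x \<bullet> e) *\<^sub>R e \<in> A} \<subseteq> cbox (-\<bar>x \<bullet> e\<bar>) \<bar>x \<bullet> e\<bar>" by simp
    have "measure lborel {s. x + (s - x \<bullet> e) *\<^sub>R e \<in> A} \<le> measure lborel (cbox (-\<bar>x \<bullet> e\<bar>) \<bar>x \<bullet> e\<bar>)"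
    \<comment> \<open>\<open>A\<close> is not assumed to be measurable; a non-measurable slice has
      \<open>measure\<close> 0.\<close>
    proof (cases "{s. x + (s - x \<bullet> e) *\<^sub>R e \<in> A} \<in> sets lborel")
      case True
      then show ?thesis by (rule measure_mono_fmeasurable[OF sub _ fmeasurable_cbox])
    qed (simp add: measure_notin_sets)
    then show False using x by (simp add: steiner_def)
  qed
qed

text \<open>Along each line the intersection with the ball grows by the amount of \<open>A - B\<close> that can be
  moved into \<open>B - A\<close>; the overlap of the shifted sets bounds this amount from below.\<close>

lemma emeasure_steiner_Int_ball_gain:
  fixes A :: "'a::euclidean_space set" and \<rho> :: real
  assumes e: "e \<in> Basis" and [measurable]: "A \<in> sets borel" and "bounded A"
  defines "B \<equiv> ball 0 \<rho>"
  shows "emeasure lborel (A \<inter> B) + emeasure lborel ((A - B) \<inter> {x. x - t *\<^sub>R e \<in> B - A})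
     \<le> emeasure lborel (steiner e A \<inter> B)"
proof -
  have [measurable]: "B \<in> sets borel" by (simp add: B_def)
  have [measurable]: "{x. x - t *\<^sub>R e \<in> B - A} \<in> sets borel" by measurable
  have "emeasure lborel (slice e (A \<inter> B) v) + emeasure lborel (slice e ((A - B) \<inter> {x. x - t *\<^sub>R e \<in> B - A}) v)
     \<le> emeasure lborel (slice e (steiner e A \<inter> B) v)" for v
  proof -
    define S T where "S = slice e A v" and "T = slice e B v"
    have [measurable]: "S \<in> sets borel" "T \<in> sets borel" by (simp_all add: S_def T_def)
    have shift: "emb e v s - t *\<^sub>R e = emb e v (s - t)" for s by (simp add: emb_def algebra_simps)
    have sl: "slice e (A \<inter> B) v = S \<inter> T" "slice e ((A - B) \<inter> {x. x - t *\<^sub>R e \<in> B - A}) v = (S - T) \<inter> {s. s - t \<in> T - S}"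
      by (auto simp: slice_def S_def T_def shift)
    have [measurable]: "{s. s - t \<in> T - S} \<in> sets borel" by measurable
    have move: "emeasure lborel {s. s - t \<in> T - S} = emeasure lborel (T - S)"
    proof -
      have "emeasure lborel {s. s - t \<in> T - S} = (\<integral>\<^sup>+ s. indicator {s. s - t \<in> T - S} s \<partial>lborel)" by simp
      also have "\<dots> = (\<integral>\<^sup>+ s. indicator (T - S) (-t + s) \<partial>lborel)"
        by (intro nn_integral_cong) (auto split: split_indicator)
      also have "\<dots> = emeasure lborel (T - S)" by (subst nn_integral_lborel_shift) auto
      finally show ?thesis .
    qed
    have le_S: "emeasure lborel (S \<inter> T) + emeasure lborel ((S - T) \<inter> {s. s - t \<in> T - S}) \<le> emeasure lborel S"
    proof -
      have "emeasure lborel (S \<inter> T) + emeasure lborel ((S - T) \<inter> {s. s - t \<in> T - S}) \<le> emeasure lborel (S \<inter> T) + emeasure lborel (S - T)"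
        by (intro add_left_mono emeasure_mono) auto
      also have "\<dots> = emeasure lborel S" by (subst plus_emeasure) (auto intro!: arg_cong[where f = "emeasure lborel"])
      finally show ?thesis .
    qed
    have le_T: "emeasure lborel (S \<inter> T) + emeasure lborel ((S - T) \<inter> {s. s - t \<in> T - S}) \<le> emeasure lborel T"
    proof -
      have "emeasure lborel (S \<inter> T) + emeasure lborel ((S - T) \<inter> {s. s - t \<in> T - S}) \<le> emeasure lborel (S \<inter> T) + emeasure lborel {s. s - t \<in> T - S}"
        by (intro add_left_mono emeasure_mono) auto
      also have "\<dots> = emeasure lborel (S \<inter> T) + emeasure lborel (T - S)" by (simp only: move)
      also have "\<dots> = emeasure lborel T" by (subst plus_emeasure) (auto intro!: arg_cong[where f = "emeasure lborel"])
      finally show ?thesis .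
    qed
    have S': "slice e (steiner e A \<inter> B) v = {t. 2 * \<bar>t\<bar> < measure lborel S} \<inter> T"
      using slice_steiner[OF e, of A v] by (auto simp: slice_def S_def T_def)
    have "emeasure lborel S < \<infinity>" unfolding S_def by (rule slice_finite[OF e \<open>bounded A\<close>])
    then have "emeasure lborel S = ennreal (measure lborel S)"
      by (intro emeasure_eq_ennreal_measure) (simp add: less_top)
    then have S_eq: "emeasure lborel {t. 2 * \<bar>t\<bar> < measure lborel S} = emeasure lborel S"
      by (subst emeasure_symmetric_interval) simp_all
    have T_sym: "u \<in> T" if "w \<in> T" "\<bar>u\<bar> \<le> \<bar>w\<bar>" for u w
    proof -
      have "(norm (emb e v u))\<^sup>2 \<le> (norm (emb e v w))\<^sup>2"
        unfolding norm_emb[OF e] using that(2) by (simp add: abs_le_square_iff)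
      then have "norm (emb e v u) \<le> norm (emb e v w)" by (rule power2_le_imp_le) simp
      then show ?thesis using that(1) by (auto simp: T_def slice_def B_def)
    qed
    \<comment> \<open>By \<open>T_sym\<close> the slice of the ball is also centred, and centred
      intervals are nested. The intersection is therefore one of the two, and \<open>le_S\<close>
      and \<open>le_T\<close> bound the same left-hand side in either case.\<close>
    have "{t. 2 * \<bar>t\<bar> < measure lborel S} \<subseteq> T \<or> T \<subseteq> {t. 2 * \<bar>t\<bar> < measure lborel S}"
    proof (rule ccontr)
      assume "\<not> ?thesis"
      then obtain u w where "2 * \<bar>u\<bar> < measure lborel S" "u \<notin> T" "w \<in> T" "\<not> 2 * \<bar>w\<bar> < measure lborel S" by auto
      then show False using T_sym[of w u] by auto
    qed
    then have "slice e (steiner e A \<inter> B) v = {t. 2 * \<bar>t\<bar> < measure lborel S} \<or> slice e (steiner e A \<inter> B) v = T"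
      unfolding S' by auto
    then show ?thesis unfolding sl using le_S le_T S_eq by metis
  qed
  then have "(\<integral>\<^sup>+ v. emeasure lborel (slice e (A \<inter> B) v) + emeasure lborel (slice e ((A - B) \<inter> {x. x - t *\<^sub>R e \<in> B - A}) v) \<partial>coords (Basis - {e}))
     \<le> (\<integral>\<^sup>+ v. emeasure lborel (slice e (steiner e A \<inter> B) v) \<partial>coords (Basis - {e}))"
    by (intro nn_integral_mono)
  then show ?thesis
    by (subst (asm) nn_integral_add) (auto simp: emeasure_lborel_slices[OF e, symmetric])
qed

subsection \<open>From Steiner symmetrisation to balls\<close>

lemma emeasure_eq_measure_bounded:
  "bounded X \<Longrightarrow> emeasure lborel X = ennreal (measure lborel X)"
  using emeasure_bounded_finite[of X] by (intro emeasure_eq_ennreal_measure) (simp add: less_top)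

lemma measure_Int_Diff_bounded:
  assumes "bounded X" "X \<in> sets borel" "Y \<in> sets borel"
  shows "measure lborel X = measure lborel (X \<inter> Y) + measure lborel (X - Y)"
proof -
  have "bounded (X \<inter> Y)" "bounded (X - Y)" using assms(1) by (auto intro: bounded_subset)
  then have "measure lborel ((X \<inter> Y) \<union> (X - Y)) = measure lborel (X \<inter> Y) + measure lborel (X - Y)"
    using assms by (intro measure_Union) (auto simp: emeasure_eq_measure_bounded)
  then show ?thesis by (simp add: Int_Diff_Un)
qed

section \<open>Finding a direction with a definite gain\<close>

text \<open>The overlap of \<open>P\<close> with the translate of \<open>Q\<close> by z integrates
  over z to the product of the volumes and vanishes unless norm z \<le> 2 R, so some z reaches the
  average. The factor 2 gives up half of it.\<close>

lemma exists_translation_overlap: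
  fixes P Q :: "'a::euclidean_space set"
  assumes [measurable]: "P \<in> sets borel" "Q \<in> sets borel" and sub: "P \<subseteq> cball 0 R" "Q \<subseteq> cball 0 R"
    and pos: "0 < measure lborel P" "0 < measure lborel Q"
  obtains z where "z \<noteq> 0"
    "measure lborel P * measure lborel Q \<le> 2 * measure lborel (cball (0::'a) (2 * R)) * measure lborel (P \<inter> {x. x - z \<in> Q})"
proof -
  have fin: "emeasure lborel X = ennreal (measure lborel X)" if "X \<subseteq> cball 0 R" for X :: "'a set"
    using that by (intro emeasure_eq_measure_bounded bounded_subset[OF bounded_cball])
  have [measurable]: "{x. x - z \<in> Q} \<in> sets borel" for z by measurable
  have [measurable]: "cball (0::'a) (2 * R) \<in> sets borel" by simp
  have "P \<noteq> {}" using pos by auto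
  then have "0 \<le> R" using sub by (force intro: order_trans[OF norm_ge_zero])
  define V where "V = measure lborel (cball (0::'a) (2 * R))"
  define c where "c = measure lborel P * measure lborel Q"
  have "c > 0" using pos by (simp add: c_def)
  have "measure lborel P \<le> V"
    unfolding V_def using sub \<open>0 \<le> R\<close> by (intro measure_mono_fmeasurable) (auto simp: subset_iff fmeasurable_compact)
  then have "V > 0" using pos by simp
  have "(\<integral>\<^sup>+ z. emeasure lborel (P \<inter> {x. x - z \<in> Q}) \<partial>lborel) = (\<integral>\<^sup>+ z. \<integral>\<^sup>+ x. indicator P x * indicator Q (x - z) \<partial>lborel \<partial>lborel)"
  proof (rule nn_integral_cong)
    fix z
    have "emeasure lborel (P \<inter> {x. x - z \<in> Q}) = (\<integral>\<^sup>+ x. indicator (P \<inter> {x. x - z \<in> Q}) x \<partial>lborel)" by simp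
    also have "\<dots> = (\<integral>\<^sup>+ x. indicator P x * indicator Q (x - z) \<partial>lborel)"
      by (intro nn_integral_cong) (auto split: split_indicator)
    finally show "emeasure lborel (P \<inter> {x. x - z \<in> Q}) = (\<integral>\<^sup>+ x. indicator P x * indicator Q (x - z) \<partial>lborel)" .
  qed
  also have "\<dots> = (\<integral>\<^sup>+ x. \<integral>\<^sup>+ z. indicator P x * indicator Q (x - z) \<partial>lborel \<partial>lborel)"
    by (rule lborel_pair.Fubini') measurable
  also have "\<dots> = (\<integral>\<^sup>+ x. indicator P x * emeasure lborel Q \<partial>lborel)"
    by (intro nn_integral_cong, subst nn_integral_cmult) (auto simp: nn_integral_lborel_reflect)
  also have "\<dots> = emeasure lborel P * emeasure lborel Q" by (simp add: nn_integral_multc)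
  also have "\<dots> = ennreal c" using sub by (simp add: fin c_def ennreal_mult)
  finally have total: "(\<integral>\<^sup>+ z. emeasure lborel (P \<inter> {x. x - z \<in> Q}) \<partial>lborel) = ennreal c" .
  have "\<exists>z. z \<noteq> 0 \<and> c \<le> 2 * V * measure lborel (P \<inter> {x. x - z \<in> Q})"
  proof (rule ccontr)
    assume "\<not> ?thesis"
    then have less: "2 * V * measure lborel (P \<inter> {x. x - z \<in> Q}) < c" if "z \<noteq> 0" for z using that by (meson not_le)
    have "(\<integral>\<^sup>+ z. emeasure lborel (P \<inter> {x. x - z \<in> Q}) \<partial>lborel) \<le> (\<integral>\<^sup>+ z. ennreal (c / (2 * V)) * indicator (cball (0::'a) (2 * R)) z \<partial>lborel)"
    proof (rule nn_integral_mono_AE)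
      have "AE z in lborel. z \<noteq> (0::'a)" by (rule AE_lborel_singleton)
      then show "AE z in lborel. emeasure lborel (P \<inter> {x. x - z \<in> Q}) \<le> ennreal (c / (2 * V)) * indicator (cball (0::'a) (2 * R)) z"
      proof eventually_elim
        case (elim z)
        show ?case
        proof (cases "z \<in> cball 0 (2 * R)")
          case True
          have "emeasure lborel (P \<inter> {x. x - z \<in> Q}) = ennreal (measure lborel (P \<inter> {x. x - z \<in> Q}))"
            using sub by (intro fin) auto
          also have "\<dots> \<le> ennreal (c / (2 * V))"
            using less[OF elim] \<open>V > 0\<close> by (intro ennreal_leI) (simp add: field_simps)
          finally show ?thesis using True by simp
        next
          case False
          have "P \<inter> {x. x - z \<in> Q} = {}"
          proof (rule equals0I)
            fix x assume "x \<in> P \<inter> {x. x - z \<in> Q}"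
            then have "norm x \<le> R" "norm (x - z) \<le> R" using sub by auto
            then have "norm z \<le> 2 * R" using norm_triangle_ineq4[of x "x - z"] by simp
            then show False using False by simp
          qed
          then show ?thesis by simp
        qed
      qed
    qed
    also have "\<dots> = ennreal (c / (2 * V)) * ennreal V"
      using emeasure_lborel_cball_finite[of "0::'a" "2 * R"]
      by (subst nn_integral_cmult) (auto simp: V_def emeasure_eq_ennreal_measure less_top)
    \<comment> \<open>Thanks to the factor 2 the total c would be at most c / 2. The point z = 0 is
      ignored as a null set, since z must determine a direction.\<close>
    also have "\<dots> = ennreal (c / 2)" using \<open>c > 0\<close> \<open>V > 0\<close> by (subst ennreal_mult[symmetric]) auto
    finally show False using \<open>c > 0\<close> by (simp add: total ennreal_le_iff)
  qed
  then show thesis using that by (auto simp: c_def V_def)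
qed

lemma steiner_improves_overlap:
  fixes A :: "nat \<Rightarrow> 'a::euclidean_space set" and \<rho> :: "nat \<Rightarrow> real"
  defines "B \<equiv> \<lambda>i. ball 0 (\<rho> i)"
  assumes R: "0 < R" and \<alpha>: "\<And>i. 0 \<le> \<alpha> i"
    and A[measurable]: "\<And>i. A i \<in> sets borel" and A_sub: "\<And>i. A i \<subseteq> cball 0 R0" and \<rho>: "\<And>i. \<rho> i \<le> R0"
    and eq: "\<And>i. measure lborel (A i) = measure lborel (B i)"
    and j: "0 < measure lborel (B j - A j)"
  obtains A' where "\<And>i. A' i \<in> sets borel" "\<And>i. A' i \<subseteq> cball 0 R0" "\<And>i. measure lborel (A' i) = measure lborel (A i)"
    "slab_product R N \<alpha> A \<le> slab_product R N \<alpha> A'"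
    "\<And>i. measure lborel (A i \<inter> B i) \<le> measure lborel (A' i \<inter> B i)"
    "measure lborel (A j \<inter> B j) + (measure lborel (B j - A j))\<^sup>2 / (2 * measure lborel (cball (0::'a) (2 * R0))) \<le> measure lborel (A' j \<inter> B j)"
proof -
  have B[measurable]: "B i \<in> sets borel" for i by (simp add: B_def)
  have B_sub: "B i \<subseteq> cball 0 R0" for i using \<rho>[of i] by (auto simp: B_def)
  have fin: "emeasure lborel X = ennreal (measure lborel X)" if "X \<subseteq> cball 0 R0" for X :: "'a set"
    using that by (intro emeasure_eq_measure_bounded bounded_subset[OF bounded_cball])
  have split: "measure lborel X = measure lborel (X \<inter> Y) + measure lborel (X - Y)"
    if "X \<subseteq> cball 0 R0" "X \<in> sets borel" "Y \<in> sets borel" for X Y :: "'a set"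
    using that by (intro measure_Int_Diff_bounded bounded_subset[OF bounded_cball])
  define P Q where "P = A j - B j" and "Q = B j - A j"
  have PQ: "measure lborel P = measure lborel Q"
    using split[OF A_sub[of j] A B[of j]] split[OF B_sub[of j] B A[of j]] eq[of j] by (simp add: P_def Q_def Int_commute)
  have [measurable]: "P \<in> sets borel" "Q \<in> sets borel" by (auto simp: P_def Q_def)
  have sub: "P \<subseteq> cball 0 R0" "Q \<subseteq> cball 0 R0" using A_sub B_sub by (auto simp: P_def Q_def)
  obtain z where z: "z \<noteq> 0"
    "measure lborel P * measure lborel Q \<le> 2 * measure lborel (cball (0::'a) (2 * R0)) * measure lborel (P \<inter> {x. x - z \<in> Q})"
    by (rule exists_translation_overlap[of P Q R0]) (use sub j PQ in \<open>auto simp: Q_def\<close>)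
  obtain e :: 'a where e: "e \<in> Basis" using nonempty_Basis by blast
  obtain U :: "'a \<Rightarrow> 'a" where U: "orthogonal_transformation U" and Ue: "U e = z /\<^sub>R norm z"
    using orthogonal_transformation_unit_vectors[of e "z /\<^sub>R norm z"] e z(1) by auto
  note [measurable] = orthogonal_transformation_borel_measurable[OF U]
  have linU: "linear U" using U by (simp add: orthogonal_transformation_def)
  have UX[measurable]: "U -` X \<in> sets borel" if "X \<in> sets borel" for X
    using measurable_sets[of U borel borel X] that by auto
  have UB: "U -` B i = B i" for i using orthogonal_transformation_norm[OF U] by (auto simp: B_def)
  have Ucball: "U -` X \<subseteq> cball 0 R0" if "X \<subseteq> cball 0 R0" for X
    using orthogonal_transformation_norm[OF U] that by (auto simp: subset_iff)
  have mU: "measure lborel (U -` X) = measure lborel X" if "X \<in> sets borel" for X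
    using emeasure_lborel_orthogonal_vimage[OF U that] by (simp add: measure_def)
  define A' where "A' i = steiner e (U -` A i)" for i
  have bdd: "bounded (U -` A i)" for i using Ucball[OF A_sub] bounded_cball bounded_subset by blast
  have gain: "measure lborel (A i \<inter> B i) + measure lborel ((U -` A i - B i) \<inter> {x. x - norm z *\<^sub>R e \<in> B i - U -` A i})
      \<le> measure lborel (A' i \<inter> B i)" for i
  proof -
    have [measurable]: "{x. x - norm z *\<^sub>R e \<in> B i - U -` A i} \<in> sets borel" by measurable
    have 1: "(U -` A i - B i) \<inter> {x. x - norm z *\<^sub>R e \<in> B i - U -` A i} \<subseteq> cball 0 R0"
      using Ucball[OF A_sub[of i]] by auto
    have 2: "A' i \<inter> B i \<subseteq> cball 0 R0" "U -` A i \<inter> B i \<subseteq> cball 0 R0" using B_sub by auto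
    have "emeasure lborel (U -` A i \<inter> B i) + emeasure lborel ((U -` A i - B i) \<inter> {x. x - norm z *\<^sub>R e \<in> B i - U -` A i})
       \<le> emeasure lborel (A' i \<inter> B i)"
      unfolding A'_def B_def by (rule emeasure_steiner_Int_ball_gain[OF e UX[OF A] bdd])
    then have "measure lborel (U -` A i \<inter> B i) + measure lborel ((U -` A i - B i) \<inter> {x. x - norm z *\<^sub>R e \<in> B i - U -` A i})
       \<le> measure lborel (A' i \<inter> B i)"
      unfolding fin[OF 1] fin[OF 2(1)] fin[OF 2(2)] by (subst (asm) ennreal_plus[symmetric]) (auto simp: ennreal_le_iff simp del: ennreal_plus)
    moreover have "measure lborel (U -` A i \<inter> B i) = measure lborel (A i \<inter> B i)"
      using mU[of "A i \<inter> B i"] UB[of i] by simp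
    ultimately show ?thesis by simp
  qed
  show thesis
  proof (rule that)
    show "A' i \<in> sets borel" for i unfolding A'_def using A by simp
    show "A' i \<subseteq> cball 0 R0" for i unfolding A'_def by (rule steiner_subset_cball[OF e Ucball[OF A_sub]])
    show "measure lborel (A' i) = measure lborel (A i)" for i
      using emeasure_steiner[OF e UX[OF A] bdd, of i] mU[OF A, of i] by (simp add: A'_def measure_def)
    have "slab_product R N \<alpha> A = slab_product R N \<alpha> (\<lambda>i. U -` A i)"
      by (rule slab_product_orthogonal[OF U A, symmetric])
    also have "\<dots> \<le> slab_product R N \<alpha> A'"
      unfolding A'_def using UX[OF A] bdd by (intro slab_product_le_steiner[OF e R \<alpha>]) auto
    finally show "slab_product R N \<alpha> A \<le> slab_product R N \<alpha> A'" .
    show "measure lborel (A i \<inter> B i) \<le> measure lborel (A' i \<inter> B i)" for i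
      by (rule order_trans[OF _ gain]) simp
    have [measurable]: "{x. x - z \<in> Q} \<in> sets borel" by measurable
    have shift: "U (x - norm z *\<^sub>R e) = U x - z" for x
      using z(1) by (simp add: linear_diff[OF linU] linear_scale[OF linU] Ue)
    have in_B: "x \<in> B j \<longleftrightarrow> U x \<in> B j" for x using UB[of j] by auto
    have "(U -` A j - B j) \<inter> {x. x - norm z *\<^sub>R e \<in> B j - U -` A j} = U -` (P \<inter> {x. x - z \<in> Q})"
    proof -
      have "x \<in> U -` A j - B j \<longleftrightarrow> U x \<in> P" for x using in_B[of x] by (auto simp: P_def)
      moreover have "x - norm z *\<^sub>R e \<in> B j - U -` A j \<longleftrightarrow> U x - z \<in> Q" for x
        using in_B[of "x - norm z *\<^sub>R e"] by (auto simp: Q_def shift)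
      ultimately show ?thesis by auto
    qed
    then have "measure lborel (A j \<inter> B j) + measure lborel (P \<inter> {x. x - z \<in> Q}) \<le> measure lborel (A' j \<inter> B j)"
      using gain[of j] mU[of "P \<inter> {x. x - z \<in> Q}"] by simp
    moreover have "(measure lborel (B j - A j))\<^sup>2 / (2 * measure lborel (cball (0::'a) (2 * R0))) \<le> measure lborel (P \<inter> {x. x - z \<in> Q})"
    proof (cases "measure lborel (cball (0::'a) (2 * R0)) = 0")
      case False
      then have "0 < measure lborel (cball (0::'a) (2 * R0))" using measure_nonneg[of lborel "cball (0::'a) (2 * R0)"] by linarith
      then show ?thesis using z(2) PQ by (simp add: divide_le_eq power2_eq_square Q_def mult.commute)
    next
      case True
      show ?thesis unfolding True by simp
    qed
    ultimately show "measure lborel (A j \<inter> B j) + (measure lborel (B j - A j))\<^sup>2 / (2 * measure lborel (cball (0::'a) (2 * R0))) \<le> measure lborel (A' j \<inter> B j)"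
      by linarith
  qed
qed

section \<open>From arbitrary sets to balls\<close>

lemma slab_vol_mono: "A \<subseteq> B \<Longrightarrow> B \<in> sets borel \<Longrightarrow> slab_vol A a y \<le> slab_vol B a y"
  unfolding slab_vol_def by (intro emeasure_mono) auto

lemma slab_vol_le: "A \<in> sets borel \<Longrightarrow> slab_vol A a y \<le> emeasure lborel A"
  unfolding slab_vol_def by (intro emeasure_mono) auto

text \<open>A uniform lower bound on the deficit S - h A would let a nearly maximal tuple be
  improved past the supremum. So tuples with arbitrarily small deficit exist on which the functional
  has not dropped; their slab volumes exceed those of the balls by at most the deficit, and
  dominated convergence removes this error.\<close>

lemma slab_product_le_balls_bounded:
  fixes A0 :: "nat \<Rightarrow> 'a::euclidean_space set"
  assumes R: "0 < R" and \<alpha>: "\<And>i. 0 \<le> \<alpha> i" and R0: "0 < R0"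
    and A0: "\<And>i. A0 i \<in> sets borel" "\<And>i. A0 i \<subseteq> cball 0 R0" and \<rho>: "\<And>i. \<rho> i \<le> R0"
    and eq: "\<And>i. emeasure lborel (A0 i) = emeasure lborel (ball (0::'a) (\<rho> i))"
  shows "slab_product R N \<alpha> A0 \<le> slab_product R N \<alpha> (\<lambda>i. ball (0::'a) (\<rho> i))"
proof -
  define B :: "nat \<Rightarrow> 'a set" where "B i = ball 0 (\<rho> i)" for i
  have B[measurable]: "B i \<in> sets borel" for i by (simp add: B_def)
  have B_sub: "B i \<subseteq> cball 0 R0" for i using \<rho>[of i] by (auto simp: B_def)
  have fin: "emeasure lborel X = ennreal (measure lborel X)" if "X \<subseteq> cball 0 R0" for X :: "'a set"
    using that by (intro emeasure_eq_measure_bounded bounded_subset[OF bounded_cball])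
  have fmeas: "X \<in> fmeasurable lborel" if "X \<subseteq> cball 0 R0" "X \<in> sets borel" for X :: "'a set"
    using fin[OF that(1)] that(2) by (auto simp: fmeasurable_def)
  have split: "measure lborel X = measure lborel (X \<inter> Y) + measure lborel (X - Y)"
    if "X \<subseteq> cball 0 R0" "X \<in> sets borel" "Y \<in> sets borel" for X Y :: "'a set"
    using that by (intro measure_Int_Diff_bounded bounded_subset[OF bounded_cball])
  define \<T> where "\<T> = {A :: nat \<Rightarrow> 'a set. (\<forall>i. A i \<in> sets borel \<and> A i \<subseteq> cball 0 R0 \<and> measure lborel (A i) = measure lborel (B i))
      \<and> slab_product R N \<alpha> A0 \<le> slab_product R N \<alpha> A}"
  define h where "h A = (\<Sum>i<N. measure lborel (A i \<inter> B i))" for A :: "nat \<Rightarrow> 'a set"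
  define S where "S = (\<Sum>i<N. measure lborel (B i))"
  have "A0 \<in> \<T>" using A0 eq by (auto simp: \<T>_def B_def measure_def)
  have hS: "h A \<le> S" if "A \<in> \<T>" for A
    unfolding h_def S_def using that by (intro sum_mono measure_mono_fmeasurable fmeas B_sub) (auto simp: \<T>_def)
  have deficit: "S - h A = (\<Sum>i<N. measure lborel (B i - A i))" if "A \<in> \<T>" for A
  proof -
    have "measure lborel (B i) = measure lborel (A i \<inter> B i) + measure lborel (B i - A i)" for i
      using split[OF B_sub B, of "A i" i] that by (simp add: \<T>_def Int_commute)
    then show ?thesis unfolding S_def h_def by (simp add: sum_subtractf[symmetric])
  qed
  have approx: "\<exists>A\<in>\<T>. S - h A < \<eta>" if "0 < \<eta>" for \<eta>
  proof (rule ccontr)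
    assume "\<not> ?thesis"
    then have far: "\<eta> \<le> S - h A" if "A \<in> \<T>" for A using that by force
    define V where "V = measure lborel (cball (0::'a) (2 * R0))"
    \<comment> \<open>The gain guaranteed by \<open>steiner_improves_overlap\<close> for an index
      that carries at least the average share \<eta> / N of the deficit. It is the same for all
      tuples.\<close>
    define \<kappa> where "\<kappa> = (\<eta> / real N)\<^sup>2 / (2 * V)"
    have "V > 0" unfolding V_def using R0 by (intro content_cball_pos) simp
    have "N > 0"
    proof (rule ccontr)
      assume "\<not> N > 0"
      then show False using far[OF \<open>A0 \<in> \<T>\<close>] \<open>0 < \<eta>\<close> by (simp add: S_def h_def)
    qed
    have "\<kappa> > 0" using \<open>V > 0\<close> \<open>N > 0\<close> \<open>0 < \<eta>\<close> by (simp add: \<kappa>_def)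
    have bdd: "bdd_above (h ` \<T>)" using hS by (rule bdd_aboveI2)
    have "Sup (h ` \<T>) - \<kappa> < Sup (h ` \<T>)" using \<open>\<kappa> > 0\<close> by simp
    then obtain A where A: "A \<in> \<T>" "Sup (h ` \<T>) - \<kappa> < h A"
      using less_cSup_iff[OF _ bdd] \<open>A0 \<in> \<T>\<close> by blast
    have "\<exists>j<N. \<eta> / real N \<le> measure lborel (B j - A j)"
    proof (rule ccontr)
      assume "\<not> ?thesis"
      then have "(\<Sum>i<N. measure lborel (B i - A i)) < (\<Sum>i<N. \<eta> / real N)"
        using \<open>N > 0\<close> by (intro sum_strict_mono) (auto simp: not_le)
      also have "\<dots> = \<eta>" using \<open>N > 0\<close> by simp
      finally show False using far[OF A(1)] deficit[OF A(1)] by simp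
    qed
    then obtain j where j: "j < N" "\<eta> / real N \<le> measure lborel (B j - A j)" by blast
    have pos: "0 < measure lborel (B j - A j)"
      using j \<open>N > 0\<close> \<open>0 < \<eta>\<close> by (meson divide_pos_pos less_le_trans of_nat_0_less_iff)
    have A_props: "\<And>i. A i \<in> sets borel" "\<And>i. A i \<subseteq> cball 0 R0" "\<And>i. measure lborel (A i) = measure lborel (B i)"
      "slab_product R N \<alpha> A0 \<le> slab_product R N \<alpha> A"
      using A(1) by (auto simp: \<T>_def)
    obtain A' where A': "\<And>i. A' i \<in> sets borel" "\<And>i. A' i \<subseteq> cball 0 R0" "\<And>i. measure lborel (A' i) = measure lborel (A i)"
      "slab_product R N \<alpha> A \<le> slab_product R N \<alpha> A'"
      "\<And>i. measure lborel (A i \<inter> B i) \<le> measure lborel (A' i \<inter> B i)"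
      "measure lborel (A j \<inter> B j) + (measure lborel (B j - A j))\<^sup>2 / (2 * V) \<le> measure lborel (A' j \<inter> B j)"
      unfolding B_def V_def
      using steiner_improves_overlap[where R = R and \<alpha> = \<alpha> and A = A and \<rho> = \<rho> and j = j and N = N, OF R \<alpha> A_props(1,2) \<rho>
          A_props(3)[unfolded B_def] pos[unfolded B_def]] by blast
    have "A' \<in> \<T>" using A' A_props order_trans[OF A_props(4) A'(4)] by (auto simp: \<T>_def)
    have "\<kappa> \<le> (measure lborel (B j - A j))\<^sup>2 / (2 * V)"
      unfolding \<kappa>_def using j(2) \<open>V > 0\<close> \<open>0 < \<eta>\<close> by (intro divide_right_mono power_mono) auto
    then have j_gain: "measure lborel (A j \<inter> B j) + \<kappa> \<le> measure lborel (A' j \<inter> B j)" using A'(6) by linarith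
    have "h A + \<kappa> = (\<Sum>i<N. measure lborel (A i \<inter> B i) + (if i = j then \<kappa> else 0))"
      using j(1) by (simp add: h_def sum.distrib)
    also have "\<dots> \<le> h A'" unfolding h_def using A'(5) j_gain by (intro sum_mono) auto
    also have "\<dots> \<le> Sup (h ` \<T>)" using \<open>A' \<in> \<T>\<close> bdd by (intro cSup_upper) auto
    finally show False using A(2) by simp
  qed
  define \<delta> where "\<delta> k = 1 / real (Suc k)" for k
  have \<delta>: "\<delta> k > 0" "\<delta> k \<le> 1" for k by (auto simp: \<delta>_def)
  have lim_\<delta>: "\<delta> \<longlonglongrightarrow> 0"
    unfolding \<delta>_def using LIMSEQ_inverse_real_of_nat by (simp add: inverse_eq_divide)
  define f where "f i y = enn2real (slab_vol (B i) (\<alpha> i) y)" for i y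
  have f: "slab_vol (B i) (\<alpha> i) y = ennreal (f i y)" "0 \<le> f i y" "f i y \<le> measure lborel (B i)" for i y
  proof -
    have "slab_vol (B i) (\<alpha> i) y \<le> ennreal (measure lborel (B i))"
      using slab_vol_le[OF B, of i] fin[OF B_sub, of i] by simp
    moreover from this have "slab_vol (B i) (\<alpha> i) y < top" by (rule le_less_trans) simp
    ultimately show "slab_vol (B i) (\<alpha> i) y = ennreal (f i y)" "0 \<le> f i y" "f i y \<le> measure lborel (B i)"
      by (auto simp: f_def enn2real_leI)
  qed
  have [measurable]: "f i \<in> borel_measurable borel" for i unfolding f_def by measurable
  have [measurable]: "ball (0::'a) R \<in> sets borel" by simp
  define G where "G \<epsilon> y = indicator (ball 0 R) y * (\<Prod>i<N. f i y + \<epsilon>)" for \<epsilon> y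
  have le: "slab_product R N \<alpha> A0 \<le> (\<integral>\<^sup>+ y. ennreal (G (\<delta> k) y) \<partial>lborel)" for k
  proof -
    obtain A where A: "A \<in> \<T>" "S - h A < \<delta> k" using approx[OF \<delta>(1)] by blast
    have A_props: "\<And>i. A i \<in> sets borel" "\<And>i. A i \<subseteq> cball 0 R0" "\<And>i. measure lborel (A i) = measure lborel (B i)"
      "slab_product R N \<alpha> A0 \<le> slab_product R N \<alpha> A"
      using A(1) by (auto simp: \<T>_def)
    note [measurable] = A_props(1)
    \<comment> \<open>Equal volumes make the excess \<open>A i - B i\<close> as large as
      \<open>B i - A i\<close>, which is a summand of the total deficit.\<close>
    have small: "measure lborel (A i - B i) \<le> \<delta> k" if "i < N" for i
    proof -
      have "measure lborel (A i - B i) = measure lborel (B i - A i)"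
        using split[OF A_props(2,1) B, of i i] split[OF B_sub B A_props(1), of i i] A_props(3)[of i] by (simp add: Int_commute)
      also have "\<dots> \<le> (\<Sum>i<N. measure lborel (B i - A i))" using that by (intro member_le_sum) auto
      finally show ?thesis using deficit[OF A(1)] A(2) by simp
    qed
    have "slab_vol (A i) (\<alpha> i) y \<le> ennreal (f i y + \<delta> k)" if "i < N" for i y
    proof -
      have "slab_vol (A i) (\<alpha> i) y \<le> emeasure lborel ({x \<in> B i. \<bar>x \<bullet> y\<bar> < \<alpha> i} \<union> (A i - B i))"
        unfolding slab_vol_def by (intro emeasure_mono) auto
      also have "\<dots> \<le> emeasure lborel {x \<in> B i. \<bar>x \<bullet> y\<bar> < \<alpha> i} + emeasure lborel (A i - B i)"
        by (intro emeasure_subadditive) auto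
      also have "\<dots> \<le> ennreal (f i y) + ennreal (\<delta> k)"
      proof (intro add_mono)
        show "emeasure lborel {x \<in> B i. \<bar>x \<bullet> y\<bar> < \<alpha> i} \<le> ennreal (f i y)" using f(1)[of i y] by (simp add: slab_vol_def)
        have "A i - B i \<subseteq> cball 0 R0" using A_props(2)[of i] by auto
        then show "emeasure lborel (A i - B i) \<le> ennreal (\<delta> k)" using small[OF that] by (simp add: fin ennreal_leI)
      qed
      also have "\<dots> = ennreal (f i y + \<delta> k)" using f(2) \<delta>(1)[of k] by (simp add: ennreal_plus less_imp_le)
      finally show ?thesis .
    qed
    then have "(\<Prod>i<N. slab_vol (A i) (\<alpha> i) y) \<le> (\<Prod>i<N. ennreal (f i y + \<delta> k))" for y
      by (intro prod_mono_ennreal) auto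
    moreover have "(\<Prod>i<N. ennreal (f i y + \<delta> k)) = ennreal (\<Prod>i<N. f i y + \<delta> k)" for y
      using f(2) \<delta>(1)[of k] by (intro prod_ennreal) (auto intro!: add_nonneg_nonneg less_imp_le)
    ultimately have "slab_product R N \<alpha> A \<le> (\<integral>\<^sup>+ y. ennreal (G (\<delta> k) y) \<partial>lborel)"
      unfolding slab_product_def G_def by (intro nn_integral_mono) (auto split: split_indicator)
    then show ?thesis using A_props(4) by simp
  qed
  have "(\<lambda>k. \<integral>\<^sup>+ y. ennreal (G (\<delta> k) y) \<partial>lborel) \<longlonglongrightarrow> (\<integral>\<^sup>+ y. ennreal (G 0 y) \<partial>lborel)"
  proof (rule nn_integral_dominated_convergence)
    let ?w = "\<lambda>y. ennreal (\<Prod>i<N. measure lborel (B i) + 1) * indicator (ball (0::'a) R) y"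
    show "(\<lambda>y. ennreal (G (\<delta> k) y)) \<in> borel_measurable lborel" for k unfolding G_def by measurable
    show "(\<lambda>y. ennreal (G 0 y)) \<in> borel_measurable lborel" unfolding G_def by measurable
    show "(\<integral>\<^sup>+ y. ?w y \<partial>lborel) < \<infinity>"
      using emeasure_lborel_ball_finite[of "0::'a" R] by (simp add: nn_integral_cmult ennreal_mult_less_top)
    show "AE y in lborel. ennreal (G (\<delta> k) y) \<le> ?w y" for k
    proof (rule AE_I2)
      fix y
      have "(\<Prod>i<N. f i y + \<delta> k) \<le> (\<Prod>i<N. measure lborel (B i) + 1)"
        using \<delta>(1)[of k] by (intro prod_mono conjI add_mono add_nonneg_nonneg f \<delta>) auto
      then show "ennreal (G (\<delta> k) y) \<le> ?w y"
        by (auto simp: G_def split: split_indicator intro!: ennreal_leI)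
    qed
    show "AE y in lborel. (\<lambda>k. ennreal (G (\<delta> k) y)) \<longlonglongrightarrow> ennreal (G 0 y)"
      unfolding G_def using lim_\<delta> by (intro AE_I2 tendsto_ennrealI tendsto_intros)
  qed measurable
  then have "slab_product R N \<alpha> A0 \<le> (\<integral>\<^sup>+ y. ennreal (G 0 y) \<partial>lborel)"
    using le by (intro LIMSEQ_le_const) auto
  also have "\<dots> = slab_product R N \<alpha> B"
    unfolding slab_product_def G_def f(1)
    by (intro nn_integral_cong) (auto simp: prod_ennreal f(2) split: split_indicator)
  finally show ?thesis by (simp add: B_def[abs_def])
qed

lemma emeasure_ball_exists:
  assumes "m < \<infinity>"
  shows "\<exists>r\<ge>0. emeasure lborel (ball (0::'a::euclidean_space) r) = m"
proof -
  obtain c where c: "m = ennreal c" "c \<ge> 0" using assms by (cases m) auto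
  define v where "v = unit_ball_vol (real DIM('a))"
  have "v > 0" by (simp add: v_def)
  define r where "r = root DIM('a) (c / v)"
  have r: "r \<ge> 0" "r ^ DIM('a) = c / v"
    unfolding r_def using c(2) \<open>v > 0\<close> by (auto simp: real_root_pow_pos2)
  have "emeasure lborel (ball (0::'a) r) = ennreal (v * r ^ DIM('a))"
    unfolding v_def using r(1) by (rule emeasure_ball)
  also have "\<dots> = m" using r(2) c \<open>v > 0\<close> by simp
  finally show ?thesis using r(1) by blast
qed

lemma radius_le_if_emeasure_ball_le:
  fixes r s :: real
  assumes "0 \<le> r" "0 \<le> s" "emeasure lborel (ball (0::'a::euclidean_space) r) \<le> emeasure lborel (ball (0::'a) s)"
  shows "r \<le> s"
proof (rule ccontr)
  assume "\<not> r \<le> s"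
  then have "unit_ball_vol (real DIM('a)) * s ^ DIM('a) < unit_ball_vol (real DIM('a)) * r ^ DIM('a)"
    using assms by (intro mult_strict_left_mono power_strict_mono) auto
  moreover have "ennreal (unit_ball_vol (real DIM('a)) * r ^ DIM('a)) \<le> ennreal (unit_ball_vol (real DIM('a)) * s ^ DIM('a))"
    using assms by (simp only: emeasure_ball)
  ultimately show False using assms \<open>\<not> r \<le> s\<close> by (subst (asm) ennreal_le_iff) auto
qed

text \<open>Unbounded sets are exhausted by their intersections with closed balls. The ball with the
  volume of such an intersection lies inside the final ball, so one bound serves every
  stage.\<close>

lemma slab_product_le_balls:
  fixes A :: "nat \<Rightarrow> 'a::euclidean_space set"
  assumes R: "0 < R" and \<alpha>: "\<And>i. 0 \<le> \<alpha> i"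
    and A[measurable]: "\<And>i. A i \<in> sets borel" and \<rho>: "\<And>i. 0 \<le> \<rho> i"
    and eq: "\<And>i. emeasure lborel (A i) = emeasure lborel (ball (0::'a) (\<rho> i))"
  shows "slab_product R N \<alpha> A \<le> slab_product R N \<alpha> (\<lambda>i. ball (0::'a) (\<rho> i))"
proof -
  define E where "E n i = A i \<inter> cball 0 (real n)" for n i
  have [measurable]: "E n i \<in> sets borel" for n i unfolding E_def by auto
  have E_inc: "incseq (\<lambda>n. E n i)" for i by (auto simp: incseq_def E_def)
  have UE: "(\<Union>n. E n i) = A i" for i
    by (auto simp: E_def) (meson real_arch_simple)
  have [measurable]: "ball (0::'a) R \<in> sets borel" by simp
  have vol: "slab_vol (A i) a y = (SUP n. slab_vol (E n i) a y)" for i a y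
  proof -
    have "{x \<in> A i. \<bar>x \<bullet> y\<bar> < a} = (\<Union>n. {x \<in> E n i. \<bar>x \<bullet> y\<bar> < a})" using UE[of i] by auto
    moreover have "incseq (\<lambda>n. {x \<in> E n i. \<bar>x \<bullet> y\<bar> < a})" using E_inc[of i] by (auto simp: incseq_def)
    ultimately show ?thesis unfolding slab_vol_def by (subst SUP_emeasure_incseq) auto
  qed
  have "slab_product R N \<alpha> A = (\<integral>\<^sup>+ y. (SUP n. indicator (ball 0 R) y * (\<Prod>i<N. slab_vol (E n i) (\<alpha> i) y)) \<partial>lborel)"
    unfolding slab_product_def vol SUP_mult_left_ennreal[symmetric]
    using E_inc by (intro nn_integral_cong arg_cong2[where f = "(*)"] refl SUP_prod_ennreal) (auto simp: incseq_def intro!: slab_vol_mono)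
  also have "\<dots> = (SUP n. slab_product R N \<alpha> (E n))"
    unfolding slab_product_def
  proof (rule nn_integral_monotone_convergence_SUP)
    show "incseq (\<lambda>n y. indicator (ball 0 R) y * (\<Prod>i<N. slab_vol (E n i) (\<alpha> i) y))"
      using E_inc by (auto simp: incseq_def le_fun_def intro!: mult_left_mono prod_mono_ennreal slab_vol_mono)
  qed measurable
  also have "\<dots> \<le> slab_product R N \<alpha> (\<lambda>i. ball (0::'a) (\<rho> i))"
  proof (rule SUP_least)
    fix n
    have E_le: "emeasure lborel (E n i) \<le> emeasure lborel (ball (0::'a) (\<rho> i))" for i
      unfolding eq[symmetric] by (intro emeasure_mono) (auto simp: E_def)
    have "emeasure lborel (E n i) < \<infinity>" for i
      using le_less_trans[OF E_le emeasure_lborel_ball_finite] by simp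
    then have "\<forall>i. \<exists>r\<ge>0. emeasure lborel (ball (0::'a) r) = emeasure lborel (E n i)"
      using emeasure_ball_exists by blast
    then obtain r where r: "\<And>i. 0 \<le> r i" "\<And>i. emeasure lborel (ball (0::'a) (r i)) = emeasure lborel (E n i)" by metis
    have r_le: "r i \<le> \<rho> i" for i using radius_le_if_emeasure_ball_le[where 'a = 'a, of "r i" "\<rho> i"] r \<rho> E_le by simp
    have rn: "r i \<le> real n" for i
    proof -
      have "emeasure lborel (E n i) \<le> emeasure lborel (cball (0::'a) (real n))" by (intro emeasure_mono) (auto simp: E_def)
      also have "\<dots> = emeasure lborel (ball (0::'a) (real n))" by (simp add: emeasure_ball emeasure_cball)
      finally show ?thesis using radius_le_if_emeasure_ball_le[where 'a = 'a, of "r i" "real n"] r by simp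
    qed
    have "slab_product R N \<alpha> (E n) \<le> slab_product R N \<alpha> (\<lambda>i. ball (0::'a) (r i))"
    \<comment> \<open>Adding 1 keeps the enclosing radius positive for n = 0.\<close>
    proof (rule slab_product_le_balls_bounded[OF R \<alpha>, of "real n + 1"])
      show "r i \<le> real n + 1" for i using rn[of i] by simp
    qed (auto simp: r E_def)
    also have "\<dots> \<le> slab_product R N \<alpha> (\<lambda>i. ball (0::'a) (\<rho> i))"
      unfolding slab_product_def by (intro nn_integral_mono mult_left_mono prod_mono_ennreal slab_vol_mono subset_ball r_le) auto
    finally show "slab_product R N \<alpha> (E n) \<le> slab_product R N \<alpha> (\<lambda>i. ball (0::'a) (\<rho> i))" .
  qed
  finally show ?thesis .
qed

subsection \<open>Densities\<close>

lemma nn_integral_exp_tail: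
  fixes s :: real
  shows "(\<integral>\<^sup>+ q. ennreal (exp (- q)) * indicator {s<..} q \<partial>lborel) = ennreal (exp (- s))"
proof -
  have "(\<integral>\<^sup>+ q. ennreal (exp (- q)) * indicator {s<..} q \<partial>lborel) = (\<integral>\<^sup>+ q. ennreal (exp (- q)) * indicator {s..} q \<partial>lborel)"
    using AE_lborel_singleton[of s] by (intro nn_integral_cong_AE) (auto split: split_indicator elim!: eventually_mono)
  also have "\<dots> = ennreal (0 - (- exp (- s)))"
  proof (rule nn_integral_FTC_atLeast)
    show "((\<lambda>q. - exp (- q)) \<longlongrightarrow> (0::real)) at_top"
      using tendsto_minus[OF filterlim_compose[OF exp_at_bot filterlim_uminus_at_bot_at_top]] by simp
    show "DERIV (\<lambda>q. - exp (- q)) x :> exp (- x)" for x :: real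
      by (auto intro!: derivative_eq_intros)
  qed auto
  finally show ?thesis by simp
qed

text \<open>A layer is indexed by a pair: a height of the density, weighted by Lebesgue measure on
  the positive axis, and a threshold q for the exponent, weighted by exp (- q) on the positive
  axis.\<close>

definition layer_weight :: "real \<times> real \<Rightarrow> ennreal" where
  "layer_weight z = indicator {0<..} (fst z) * (indicator {0<..} (snd z) * ennreal (exp (- snd z)))"

lemma layer_weight_measurable [measurable]: "layer_weight \<in> borel_measurable (lborel \<Otimes>\<^sub>M lborel)"
  unfolding layer_weight_def by measurable

text \<open>Turns a threshold q on the exponent into a slab of half-width (c * q) powr (1 /
  p).\<close>

lemma less_powr_inverse_iff:
  fixes u c q p :: real
  assumes "0 < p" "0 < c" "0 < q" "0 \<le> u"
  shows "u < (c * q) powr (1 / p) \<longleftrightarrow> u powr p / c < q"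
proof -
  have cq: "0 < c * q" using assms by simp
  have "u < (c * q) powr (1 / p) \<longleftrightarrow> u powr p < ((c * q) powr (1 / p)) powr p"
    using powr_less_mono2[of p u] powr_mono2[of p "(c * q) powr (1 / p)" u] assms by (force simp: not_le[symmetric])
  also have "((c * q) powr (1 / p)) powr p = c * q" using assms cq by (simp add: powr_powr)
  finally show ?thesis using assms by (simp add: divide_less_eq mult.commute)
qed

text \<open>Since exp (- s) is the integral of exp (- q) over q > s, the exponential is a mixture of
  slab indicators. The family \<open>A\<close> is arbitrary because the formula is applied to the
  superlevel sets of the density and again to the balls of equal volume.\<close>

lemma nn_integral_exp_layers:
  fixes A :: "real \<Rightarrow> 'a::euclidean_space set" and y :: 'a
  assumes p: "0 < p" and c: "0 < c"
    and A[measurable]: "Measurable.pred (borel \<Otimes>\<^sub>M borel) (\<lambda>(t, x). x \<in> A t)"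
  shows "(\<integral>\<^sup>+ x. ennreal (exp (- (\<bar>x \<bullet> y\<bar> powr p / c))) * (\<integral>\<^sup>+ t. indicator {0<..} t * indicator (A t) x \<partial>lborel) \<partial>lborel)
    = (\<integral>\<^sup>+ z. layer_weight z * slab_vol (A (fst z)) ((c * snd z) powr (1 / p)) y \<partial>(lborel \<Otimes>\<^sub>M lborel))"
proof -
  have [measurable]: "(\<lambda>(t, x). indicator (A t) x :: ennreal) \<in> borel_measurable (borel \<Otimes>\<^sub>M borel)"
    unfolding indicator_def by measurable
  have [measurable]: "(\<lambda>(t, x). indicator (A t) x :: ennreal) \<in> borel_measurable (lborel \<Otimes>\<^sub>M lborel)"
    by measurable
  have A1[measurable]: "A t \<in> sets borel" for t
  proof -
    have "Measurable.pred borel (\<lambda>x. x \<in> A t)" by measurable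
    then show ?thesis by (simp add: pred_def)
  qed
  have sv: "slab_vol (A t) a y = (\<integral>\<^sup>+ x. indicator (A t) x * indicator {x. \<bar>x \<bullet> y\<bar> < a} x \<partial>lborel)" for t a
  proof -
    have "slab_vol (A t) a y = (\<integral>\<^sup>+ x. indicator {x \<in> A t. \<bar>x \<bullet> y\<bar> < a} x \<partial>lborel)"
      unfolding slab_vol_def by (rule nn_integral_indicator[symmetric]) simp
    then show ?thesis by (simp add: indicator_def of_bool_conj)
  qed
  have [measurable]: "(\<lambda>z. slab_vol (A (fst z)) ((c * snd z) powr (1 / p)) y) \<in> borel_measurable (lborel \<Otimes>\<^sub>M lborel)"
    unfolding sv by measurable
  have tail: "ennreal (exp (- (\<bar>x \<bullet> y\<bar> powr p / c)))
     = (\<integral>\<^sup>+ q. indicator {0<..} q * ennreal (exp (- q)) * indicator {x. \<bar>x \<bullet> y\<bar> < (c * q) powr (1 / p)} x \<partial>lborel)" for x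
  proof -
    have "indicator {0<..} q * ennreal (exp (- q)) * indicator {x. \<bar>x \<bullet> y\<bar> < (c * q) powr (1 / p)} x
        = ennreal (exp (- q)) * indicator {\<bar>x \<bullet> y\<bar> powr p / c<..} q" for q
    proof (cases "0 < q")
      case True
      then show ?thesis using less_powr_inverse_iff[OF p c True, of "\<bar>x \<bullet> y\<bar>"] by (simp add: indicator_def)
    next
      case False
      have "0 \<le> \<bar>x \<bullet> y\<bar> powr p / c" using c by simp
      then have "\<not> \<bar>x \<bullet> y\<bar> powr p / c < q" using False by linarith
      then show ?thesis using False by simp
    qed
    then show ?thesis by (simp add: nn_integral_exp_tail)
  qed
  have "(\<integral>\<^sup>+ x. ennreal (exp (- (\<bar>x \<bullet> y\<bar> powr p / c))) * (\<integral>\<^sup>+ t. indicator {0<..} t * indicator (A t) x \<partial>lborel) \<partial>lborel)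
     = (\<integral>\<^sup>+ x. \<integral>\<^sup>+ t. indicator {0<..} t * (indicator (A t) x * ennreal (exp (- (\<bar>x \<bullet> y\<bar> powr p / c)))) \<partial>lborel \<partial>lborel)"
    by (intro nn_integral_cong, subst nn_integral_cmult[symmetric]) (auto simp: ac_simps intro!: nn_integral_cong)
  also have "\<dots> = (\<integral>\<^sup>+ t. \<integral>\<^sup>+ x. indicator {0<..} t * (indicator (A t) x * ennreal (exp (- (\<bar>x \<bullet> y\<bar> powr p / c)))) \<partial>lborel \<partial>lborel)"
    by (rule lborel_pair.Fubini'[symmetric]) measurable
  also have "\<dots> = (\<integral>\<^sup>+ t. \<integral>\<^sup>+ q. layer_weight (t, q) * slab_vol (A t) ((c * q) powr (1 / p)) y \<partial>lborel \<partial>lborel)"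
  proof (rule nn_integral_cong)
    fix t :: real
    have "(\<integral>\<^sup>+ x. indicator {0<..} t * (indicator (A t) x * ennreal (exp (- (\<bar>x \<bullet> y\<bar> powr p / c)))) \<partial>lborel)
       = (\<integral>\<^sup>+ x. \<integral>\<^sup>+ q. layer_weight (t, q) * (indicator (A t) x * indicator {x. \<bar>x \<bullet> y\<bar> < (c * q) powr (1 / p)} x) \<partial>lborel \<partial>lborel)"
    proof (rule nn_integral_cong)
      fix x :: 'a
      let ?F = "\<lambda>q. indicator {0<..} q * ennreal (exp (- q)) * indicator {x. \<bar>x \<bullet> y\<bar> < (c * q) powr (1 / p)} x"
      have [measurable]: "?F \<in> borel_measurable borel" unfolding indicator_def by measurable
      have "indicator {0<..} t * (indicator (A t) x * ennreal (exp (- (\<bar>x \<bullet> y\<bar> powr p / c))))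
         = (indicator {0<..} t * indicator (A t) x) * (\<integral>\<^sup>+ q. ?F q \<partial>lborel)"
        unfolding tail by (simp add: mult.assoc)
      also have "\<dots> = (\<integral>\<^sup>+ q. (indicator {0<..} t * indicator (A t) x) * ?F q \<partial>lborel)"
        by (rule nn_integral_cmult[symmetric]) measurable
      also have "\<dots> = (\<integral>\<^sup>+ q. layer_weight (t, q) * (indicator (A t) x * indicator {x. \<bar>x \<bullet> y\<bar> < (c * q) powr (1 / p)} x) \<partial>lborel)"
        by (intro nn_integral_cong) (simp add: layer_weight_def ac_simps)
      finally show "indicator {0<..} t * (indicator (A t) x * ennreal (exp (- (\<bar>x \<bullet> y\<bar> powr p / c))))
        = (\<integral>\<^sup>+ q. layer_weight (t, q) * (indicator (A t) x * indicator {x. \<bar>x \<bullet> y\<bar> < (c * q) powr (1 / p)} x) \<partial>lborel)" .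
    qed
    also have "\<dots> = (\<integral>\<^sup>+ q. \<integral>\<^sup>+ x. layer_weight (t, q) * (indicator (A t) x * indicator {x. \<bar>x \<bullet> y\<bar> < (c * q) powr (1 / p)} x) \<partial>lborel \<partial>lborel)"
      by (rule lborel_pair.Fubini'[symmetric]) measurable
    also have "\<dots> = (\<integral>\<^sup>+ q. layer_weight (t, q) * slab_vol (A t) ((c * q) powr (1 / p)) y \<partial>lborel)"
      unfolding sv by (intro nn_integral_cong nn_integral_cmult) measurable
    finally show "(\<integral>\<^sup>+ x. indicator {0<..} t * (indicator (A t) x * ennreal (exp (- (\<bar>x \<bullet> y\<bar> powr p / c)))) \<partial>lborel)
       = (\<integral>\<^sup>+ q. layer_weight (t, q) * slab_vol (A t) ((c * q) powr (1 / p)) y \<partial>lborel)" .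
  qed
  also have "\<dots> = (\<integral>\<^sup>+ z. layer_weight z * slab_vol (A (fst z)) ((c * snd z) powr (1 / p)) y \<partial>(lborel \<Otimes>\<^sub>M lborel))"
    by (subst lborel.nn_integral_fst[symmetric]) auto
  finally show ?thesis .
qed

text \<open>The power is an N-fold integral over independent layers that share one y. Integrating
  over y first leaves the set functional for fixed heights and thresholds.\<close>

lemma nn_integral_power_layers:
  fixes A :: "real \<Rightarrow> 'a::euclidean_space set"
  assumes p: "0 < p" and c: "0 < c"
    and A[measurable]: "Measurable.pred (borel \<Otimes>\<^sub>M borel) (\<lambda>(t, x). x \<in> A t)"
  shows "(\<integral>\<^sup>+ y. indicator (ball 0 R) y *
      (\<integral>\<^sup>+ x. ennreal (exp (- (\<bar>x \<bullet> y\<bar> powr p / c))) * (\<integral>\<^sup>+ t. indicator {0<..} t * indicator (A t) x \<partial>lborel) \<partial>lborel) ^ N \<partial>lborel)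
    = (\<integral>\<^sup>+ Z. (\<Prod>i<N. layer_weight (Z i)) * slab_product R N (\<lambda>i. (c * snd (Z i)) powr (1 / p)) (\<lambda>i. A (fst (Z i)))
         \<partial>Pi\<^sub>M {..<N} (\<lambda>_. lborel \<Otimes>\<^sub>M lborel))"
proof -
  interpret LL: pair_sigma_finite "lborel :: real measure" "lborel :: real measure" by standard
  interpret PN: product_sigma_finite "\<lambda>_ :: nat. (lborel \<Otimes>\<^sub>M lborel) :: (real \<times> real) measure"
    by standard
  interpret VN: sigma_finite_measure "Pi\<^sub>M {..<N} (\<lambda>_. (lborel \<Otimes>\<^sub>M lborel) :: (real \<times> real) measure)"
    by (rule PN.sigma_finite) simp
  interpret FF: pair_sigma_finite "lborel :: 'a measure" "Pi\<^sub>M {..<N} (\<lambda>_. (lborel \<Otimes>\<^sub>M lborel) :: (real \<times> real) measure)"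
    by standard
  have [measurable]: "ball (0::'a) R \<in> sets borel" by simp
  have sv: "slab_vol (A t) a y = (\<integral>\<^sup>+ x. indicator {x. x \<in> A t \<and> \<bar>x \<bullet> y\<bar> < a} x \<partial>lborel)" for t a y
  proof -
    have "Measurable.pred borel (\<lambda>x. x \<in> A t)" by measurable
    then have [measurable]: "A t \<in> sets borel" by (simp add: pred_def)
    show ?thesis unfolding slab_vol_def by (subst nn_integral_indicator) auto
  qed
  have svm[measurable (raw)]: "(\<lambda>w. slab_vol (A (f w)) (g w) (h w)) \<in> borel_measurable M"
    if [measurable]: "f \<in> borel_measurable M" "g \<in> borel_measurable M" "h \<in> borel_measurable M" for f g h and M :: "'z measure"
    unfolding sv by measurable
  let ?V = "Pi\<^sub>M {..<N} (\<lambda>_. (lborel \<Otimes>\<^sub>M lborel) :: (real \<times> real) measure)"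
  have "(\<integral>\<^sup>+ y. indicator (ball 0 R) y *
      (\<integral>\<^sup>+ x. ennreal (exp (- (\<bar>x \<bullet> y\<bar> powr p / c))) * (\<integral>\<^sup>+ t. indicator {0<..} t * indicator (A t) x \<partial>lborel) \<partial>lborel) ^ N \<partial>lborel)
    = (\<integral>\<^sup>+ y. \<integral>\<^sup>+ Z. indicator (ball 0 R) y * (\<Prod>i<N. layer_weight (Z i) * slab_vol (A (fst (Z i))) ((c * snd (Z i)) powr (1 / p)) y) \<partial>?V \<partial>lborel)"
  proof (rule nn_integral_cong)
    fix y :: 'a
    have "(\<integral>\<^sup>+ z. layer_weight z * slab_vol (A (fst z)) ((c * snd z) powr (1 / p)) y \<partial>(lborel \<Otimes>\<^sub>M lborel)) ^ N
       = (\<integral>\<^sup>+ Z. (\<Prod>i<N. layer_weight (Z i) * slab_vol (A (fst (Z i))) ((c * snd (Z i)) powr (1 / p)) y) \<partial>?V)"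
      by (subst PN.product_nn_integral_prod) auto
    then show "indicator (ball 0 R) y *
      (\<integral>\<^sup>+ x. ennreal (exp (- (\<bar>x \<bullet> y\<bar> powr p / c))) * (\<integral>\<^sup>+ t. indicator {0<..} t * indicator (A t) x \<partial>lborel) \<partial>lborel) ^ N
      = (\<integral>\<^sup>+ Z. indicator (ball 0 R) y * (\<Prod>i<N. layer_weight (Z i) * slab_vol (A (fst (Z i))) ((c * snd (Z i)) powr (1 / p)) y) \<partial>?V)"
      unfolding nn_integral_exp_layers[OF p c A] by (subst nn_integral_cmult) auto
  qed
  also have "\<dots> = (\<integral>\<^sup>+ Z. \<integral>\<^sup>+ y. indicator (ball 0 R) y * (\<Prod>i<N. layer_weight (Z i) * slab_vol (A (fst (Z i))) ((c * snd (Z i)) powr (1 / p)) y) \<partial>lborel \<partial>?V)"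
    by (rule FF.Fubini'[symmetric]) measurable
  also have "\<dots> = (\<integral>\<^sup>+ Z. (\<Prod>i<N. layer_weight (Z i)) * slab_product R N (\<lambda>i. (c * snd (Z i)) powr (1 / p)) (\<lambda>i. A (fst (Z i))) \<partial>?V)"
  proof (rule nn_integral_cong)
    fix Z :: "nat \<Rightarrow> real \<times> real"
    show "(\<integral>\<^sup>+ y. indicator (ball 0 R) y * (\<Prod>i<N. layer_weight (Z i) * slab_vol (A (fst (Z i))) ((c * snd (Z i)) powr (1 / p)) y) \<partial>lborel)
      = (\<Prod>i<N. layer_weight (Z i)) * slab_product R N (\<lambda>i. (c * snd (Z i)) powr (1 / p)) (\<lambda>i. A (fst (Z i)))"
      unfolding slab_product_def by (subst nn_integral_cmult[symmetric]) (auto simp: prod.distrib ac_simps intro!: nn_integral_cong)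
  qed
  finally show ?thesis .
qed

section \<open>The symmetric decreasing rearrangement of a Borel density\<close>

text \<open>An explicit radius, from which measurability in \<open>t\<close> can be read off; the
  choice in \<open>sym_ball\<close> hides it.\<close>

definition level_radius :: "('a::euclidean_space \<Rightarrow> real) \<Rightarrow> real \<Rightarrow> real" where
  "level_radius g t = root DIM('a) (measure lborel {x. t < g x} / unit_ball_vol (real DIM('a)))"

text \<open>Borel rather than Lebesgue measurability, so that Fubini on \<open>lborel\<close>
  applies to the superlevel sets. The rearrangement is a second instance, which makes all results of
  the locale available for both densities.\<close>

locale prob_density =
  fixes g :: "'a::euclidean_space \<Rightarrow> real"
  assumes g_measurable [measurable]: "g \<in> borel_measurable borel"
    and g_nonneg: "0 \<le> g x"
    and g_integral: "(\<integral>\<^sup>+ x. ennreal (g x) \<partial>lborel) = 1"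
begin

lemma markov:
  assumes "0 < t"
  shows "emeasure lborel {x. t < g x} \<le> ennreal (1 / t)"
proof -
  have "ennreal t * emeasure lborel {x. t < g x} = (\<integral>\<^sup>+ x. ennreal t * indicator {x. t < g x} x \<partial>lborel)"
    by (simp add: nn_integral_cmult)
  also have "\<dots> \<le> (\<integral>\<^sup>+ x. ennreal (g x) \<partial>lborel)"
    by (intro nn_integral_mono) (auto split: split_indicator intro!: ennreal_leI)
  finally have "ennreal t * emeasure lborel {x. t < g x} \<le> ennreal t * ennreal (1 / t)"
    using assms by (simp add: g_integral ennreal_mult[symmetric] del: ennreal_mult)
  then show ?thesis using assms by (subst (asm) ennreal_mult_le_mult_iff) auto
qed

lemma level_finite:
  assumes "0 < t"
  shows "emeasure lborel {x. t < g x} = ennreal (measure lborel {x. t < g x})"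
  using le_less_trans[OF markov[OF assms], of \<infinity>] by (intro emeasure_eq_ennreal_measure) (auto simp: less_top)

lemma level_radius_nonneg: "0 \<le> level_radius g t"
  unfolding level_radius_def by (intro real_root_ge_zero divide_nonneg_nonneg) auto

lemma level_radius_power:
  "unit_ball_vol (real DIM('a)) * level_radius g t ^ DIM('a) = measure lborel {x. t < g x}"
proof -
  have "level_radius g t ^ DIM('a) = measure lborel {x. t < g x} / unit_ball_vol (real DIM('a))"
    unfolding level_radius_def by (intro real_root_pow_pos2) auto
  moreover have "unit_ball_vol (real DIM('a)) \<noteq> 0" using unit_ball_vol_pos[of "real DIM('a)"] by (metis less_irrefl of_nat_0_le_iff)
  ultimately show ?thesis by (simp add: field_simps)
qed

lemma emeasure_level_ball:
  assumes "0 < t"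
  shows "emeasure lborel (ball (0::'a) (level_radius g t)) = emeasure lborel {x. t < g x}"
  by (simp add: emeasure_ball level_radius_nonneg level_radius_power level_finite[OF assms])

text \<open>Volume determines a non-negative radius, so the choice in \<open>sym_ball\<close> has a
  single candidate. Positivity of \<open>t\<close> makes the volume finite by Markov's
  inequality.\<close>

lemma sym_ball_level:
  assumes "0 < t"
  shows "sym_ball {x. t < g x} = ball 0 (level_radius g t)"
proof -
  let ?P = "\<lambda>r. 0 \<le> r \<and> emeasure lebesgue (ball (0::'a) r) = emeasure lebesgue {x. t < g x}"
  have "?P (level_radius g t)"
    using emeasure_level_ball[OF assms] level_radius_nonneg by simp
  moreover have "r = level_radius g t" if "?P r" for r
  proof (rule antisym)
    have "emeasure lborel (ball (0::'a) r) = emeasure lborel (ball (0::'a) (level_radius g t))"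
      using that emeasure_level_ball[OF assms] by simp
    then show "r \<le> level_radius g t" "level_radius g t \<le> r"
      using radius_le_if_emeasure_ball_le[where 'a = 'a] that level_radius_nonneg by (metis order_refl)+
  qed
  ultimately have "(SOME r. ?P r) = level_radius g t" by (rule some_equality)
  then show ?thesis unfolding sym_ball_def by simp
qed

lemma level_radius_measurable [measurable]: "level_radius g \<in> borel_measurable borel"
proof -
  have "(\<lambda>t. emeasure lborel {x \<in> space lborel. t < g x}) \<in> borel_measurable borel" by measurable
  then have [measurable]: "(\<lambda>t. measure lborel {x. t < g x}) \<in> borel_measurable borel"
    unfolding measure_def by simp
  show ?thesis unfolding level_radius_def[abs_def] by measurable
qed

text \<open>The rearrangement before its conversion to a real number. It is the form in which the
  layer formula applies; the two agree off the origin, hence almost everywhere.\<close>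

definition profile :: "'a \<Rightarrow> ennreal" where
  "profile x = (\<integral>\<^sup>+ t. indicator {0<..} t * indicator (ball 0 (level_radius g t)) x \<partial>lborel)"

lemma ball_level_pred [measurable]:
  "Measurable.pred (borel \<Otimes>\<^sub>M borel) (\<lambda>(t, x). x \<in> ball (0::'a) (level_radius g t))"
  unfolding mem_ball by measurable

lemma profile_measurable [measurable]: "profile \<in> borel_measurable borel"
proof -
  have [measurable]: "(\<lambda>(x, t). indicator (ball (0::'a) (level_radius g t)) x :: ennreal) \<in> borel_measurable (borel \<Otimes>\<^sub>M borel)"
    unfolding indicator_def mem_ball by measurable
  show ?thesis unfolding profile_def[abs_def] by measurable
qed

text \<open>If x lies in the ball of height t, the ball of radius norm x has volume at most 1 / t by
  Markov's inequality. This bounds the heights that contribute.\<close>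

lemma profile_finite:
  assumes "x \<noteq> 0" shows "profile x < \<infinity>"
proof -
  define v where "v = unit_ball_vol (real DIM('a)) * norm x ^ DIM('a)"
  have "v > 0" using assms by (simp add: v_def)
  have "t \<le> 1 / v" if t: "0 < t" "norm x < level_radius g t" for t
  proof -
    have "v \<le> unit_ball_vol (real DIM('a)) * level_radius g t ^ DIM('a)"
      unfolding v_def using t by (intro mult_left_mono power_mono) auto
    then have "v \<le> measure lborel {x. t < g x}" by (simp add: level_radius_power)
    also have "\<dots> \<le> 1 / t" using markov[OF t(1)] t(1) by (simp add: level_finite ennreal_le_iff)
    finally show ?thesis using t(1) \<open>v > 0\<close> by (simp add: field_simps)
  qed
  then have "profile x \<le> (\<integral>\<^sup>+ t. indicator {0..1 / v} t \<partial>lborel)"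
    unfolding profile_def by (intro nn_integral_mono) (auto split: split_indicator)
  also have "\<dots> < \<infinity>" using \<open>v > 0\<close> by simp
  finally show ?thesis .
qed

lemma sym_rearr_eq: "sym_rearr g x = enn2real (profile x)"
proof -
  have "(\<integral>\<^sup>+ t\<in>{0<..}. indicator (sym_ball {y. t < g y}) x \<partial>lborel) = profile x"
    unfolding profile_def by (intro nn_integral_cong) (auto simp: sym_ball_level split: split_indicator)
  then show ?thesis unfolding sym_rearr_def by simp
qed

lemma sym_rearr_measurable [measurable]: "sym_rearr g \<in> borel_measurable borel"
  unfolding sym_rearr_eq[abs_def] by measurable

lemma sym_rearr_nonneg: "0 \<le> sym_rearr g x"
  by (simp add: sym_rearr_eq)

lemma AE_sym_rearr: "AE x in lborel. ennreal (sym_rearr g x) = profile x"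
proof -
  have "AE x in lborel. x \<noteq> (0::'a)" by (rule AE_lborel_singleton)
  then show ?thesis
    by eventually_elim (use profile_finite in \<open>simp add: sym_rearr_eq\<close>)
qed

lemma nn_integral_sym_rearr: "(\<integral>\<^sup>+ x. ennreal (sym_rearr g x) \<partial>lborel) = 1"
proof -
  have [measurable]: "(\<lambda>(x, t). indicator (ball (0::'a) (level_radius g t)) x :: ennreal) \<in> borel_measurable (borel \<Otimes>\<^sub>M borel)"
    unfolding indicator_def mem_ball by measurable
  have "(\<integral>\<^sup>+ x. ennreal (sym_rearr g x) \<partial>lborel) = (\<integral>\<^sup>+ x. profile x \<partial>lborel)"
    by (intro nn_integral_cong_AE AE_sym_rearr)
  also have "\<dots> = (\<integral>\<^sup>+ t. \<integral>\<^sup>+ x. indicator {0<..} t * indicator (ball (0::'a) (level_radius g t)) x \<partial>lborel \<partial>lborel)"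
    unfolding profile_def by (rule lborel_pair.Fubini'[symmetric]) measurable
  also have "\<dots> = (\<integral>\<^sup>+ t. indicator {0<..} t * emeasure lborel {x \<in> space lborel. ennreal t < ennreal (g x)} \<partial>lborel)"
  proof (rule nn_integral_cong)
    fix t :: real
    have "(\<integral>\<^sup>+ x. indicator {0<..} t * indicator (ball (0::'a) (level_radius g t)) x \<partial>lborel)
        = indicator {0<..} t * emeasure lborel (ball (0::'a) (level_radius g t))"
      by (subst nn_integral_cmult) auto
    then show "(\<integral>\<^sup>+ x. indicator {0<..} t * indicator (ball (0::'a) (level_radius g t)) x \<partial>lborel)
        = indicator {0<..} t * emeasure lborel {x \<in> space lborel. ennreal t < ennreal (g x)}"
      using emeasure_level_ball[of t] by (auto split: split_indicator simp: ennreal_less_iff)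
  qed
  also have "\<dots> = (\<integral>\<^sup>+ x. ennreal (g x) \<partial>lborel)"
    by (intro nn_integral_layer_cake[symmetric] lborel.sigma_finite_measure_axioms) measurable
  finally show ?thesis by (simp add: g_integral)
qed

lemma prob_density_sym_rearr: "prob_density (sym_rearr g)"
  by standard (auto simp: sym_rearr_nonneg nn_integral_sym_rearr)

lemma level_layers: "ennreal (g x) = (\<integral>\<^sup>+ t. indicator {0<..} t * indicator {x. t < g x} x \<partial>lborel)"
proof -
  have "(\<integral>\<^sup>+ t. indicator {0<..} t * indicator {x. t < g x} x \<partial>lborel) = (\<integral>\<^sup>+ t. indicator {0<..<g x} t \<partial>lborel)"
    by (intro nn_integral_cong) (auto split: split_indicator)
  then show ?thesis using g_nonneg[of x] by simp
qed

definition exp_mean :: "real \<Rightarrow> real \<Rightarrow> 'a \<Rightarrow> ennreal" where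
  "exp_mean p c y = (\<integral>\<^sup>+ x. ennreal (exp (- (\<bar>x \<bullet> y\<bar> powr p / c))) * ennreal (g x) \<partial>lborel)"

end

lemma slab_product_cong:
  "(\<And>i. i < N \<Longrightarrow> \<alpha> i = \<alpha>' i \<and> A i = A' i) \<Longrightarrow> slab_product R N \<alpha> A = slab_product R N \<alpha>' A'"
  unfolding slab_product_def by (intro nn_integral_cong arg_cong2[where f = "(*)"] prod.cong) auto

context prob_density
begin

lemma exp_mean_power_le:
  assumes p: "0 < p" and c: "0 < c" and R: "0 < R"
  shows "(\<integral>\<^sup>+ y. indicator (ball 0 R) y * exp_mean p c y ^ N \<partial>lborel)
    \<le> (\<integral>\<^sup>+ y. indicator (ball 0 R) y * prob_density.exp_mean (sym_rearr g) p c y ^ N \<partial>lborel)"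
proof -
  interpret S: prob_density "sym_rearr g" by (rule prob_density_sym_rearr)
  let ?V = "Pi\<^sub>M {..<N} (\<lambda>_. lborel \<Otimes>\<^sub>M lborel :: (real \<times> real) measure)"
  let ?\<alpha> = "\<lambda>Z i. (c * snd (Z i :: real \<times> real)) powr (1 / p)"
  have "(\<integral>\<^sup>+ y. indicator (ball 0 R) y * exp_mean p c y ^ N \<partial>lborel)
    = (\<integral>\<^sup>+ Z. (\<Prod>i<N. layer_weight (Z i)) * slab_product R N (?\<alpha> Z) (\<lambda>i. {x. fst (Z i) < g x}) \<partial>?V)"
    unfolding exp_mean_def level_layers
    by (rule nn_integral_power_layers[OF p c]) measurable
  also have "\<dots> \<le> (\<integral>\<^sup>+ Z. (\<Prod>i<N. layer_weight (Z i)) * slab_product R N (?\<alpha> Z) (\<lambda>i. ball (0::'a) (level_radius g (fst (Z i)))) \<partial>?V)"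
  proof (rule nn_integral_mono)
    fix Z :: "nat \<Rightarrow> real \<times> real"
    show "(\<Prod>i<N. layer_weight (Z i)) * slab_product R N (?\<alpha> Z) (\<lambda>i. {x. fst (Z i) < g x})
      \<le> (\<Prod>i<N. layer_weight (Z i)) * slab_product R N (?\<alpha> Z) (\<lambda>i. ball (0::'a) (level_radius g (fst (Z i))))"
    proof (cases "\<forall>i<N. 0 < fst (Z i)")
      case True
      \<comment> \<open>The set inequality speaks about all natural indices, while positive heights
        are known only below N; beyond N the empty set and radius 0 are a matching pair.\<close>
      define A where "A i = (if i < N then {x. fst (Z i) < g x} else {})" for i
      define r where "r i = (if i < N then level_radius g (fst (Z i)) else 0)" for i
      have "slab_product R N (?\<alpha> Z) (\<lambda>i. {x. fst (Z i) < g x}) = slab_product R N (?\<alpha> Z) A"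
        by (rule slab_product_cong) (simp add: A_def)
      also have "\<dots> \<le> slab_product R N (?\<alpha> Z) (\<lambda>i. ball (0::'a) (r i))"
      proof (rule slab_product_le_balls[OF R])
        show "A i \<in> sets borel" for i by (simp add: A_def)
        show "emeasure lborel (A i) = emeasure lborel (ball (0::'a) (r i))" for i
          using True emeasure_level_ball by (simp add: A_def r_def)
        show "0 \<le> r i" for i by (simp add: r_def level_radius_nonneg)
      qed simp
      also have "\<dots> = slab_product R N (?\<alpha> Z) (\<lambda>i. ball (0::'a) (level_radius g (fst (Z i))))"
        by (rule slab_product_cong) (simp add: r_def)
      finally show ?thesis by (intro mult_left_mono) auto
    next
      \<comment> \<open>A non-positive height, where the superlevel set may have infinite volume,
        carries weight 0.\<close>
      case False
      then obtain i where "i < N" "\<not> 0 < fst (Z i)" by blast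
      then have zero: "(\<Prod>i<N. layer_weight (Z i)) = 0"
        by (intro prod_zero) (auto simp: layer_weight_def intro!: bexI[of _ i])
      show ?thesis unfolding zero by simp
    qed
  qed
  also have "\<dots> = (\<integral>\<^sup>+ y. indicator (ball 0 R) y * (\<integral>\<^sup>+ x. ennreal (exp (- (\<bar>x \<bullet> y\<bar> powr p / c))) * profile x \<partial>lborel) ^ N \<partial>lborel)"
    unfolding profile_def by (rule nn_integral_power_layers[OF p c ball_level_pred, symmetric])
  also have "\<dots> = (\<integral>\<^sup>+ y. indicator (ball 0 R) y * S.exp_mean p c y ^ N \<partial>lborel)"
  proof -
    have "(\<integral>\<^sup>+ x. ennreal (exp (- (\<bar>x \<bullet> y\<bar> powr p / c))) * profile x \<partial>lborel) = S.exp_mean p c y" for y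
      unfolding S.exp_mean_def by (intro nn_integral_cong_AE) (use AE_sym_rearr in \<open>auto elim!: eventually_mono\<close>)
    then show ?thesis by simp
  qed
  finally show ?thesis .
qed

end

subsection \<open>Volumes of star-shaped sets\<close>

definition expneg :: "ennreal \<Rightarrow> ennreal" where
  "expneg z = (if z = \<infinity> then 0 else ennreal (exp (- enn2real z)))"

lemma expneg_measurable [measurable]: "expneg \<in> borel_measurable borel"
  unfolding expneg_def by measurable

lemma expneg_ennreal: "0 \<le> r \<Longrightarrow> expneg (ennreal r) = ennreal (exp (- r))"
  by (simp add: expneg_def)

lemma expneg_le_1: "expneg z \<le> 1"
  by (auto simp: expneg_def)

lemma expneg_tail: "expneg z = (\<integral>\<^sup>+ q. (indicator {0<..} q * ennreal (exp (- q))) * indicator {q. z < ennreal q} q \<partial>lborel)"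
proof (cases z)
  case (real r)
  have "(indicator {0<..} q * ennreal (exp (- q))) * indicator {q. z < ennreal q} q = ennreal (exp (- q)) * indicator {r<..} q" for q
    using real by (cases "0 < q") (auto simp: ennreal_less_iff ennreal_neg split: split_indicator)
  then show ?thesis using real by (simp add: expneg_ennreal nn_integral_exp_tail)
next
  case top
  then show ?thesis by (simp add: expneg_def)
qed

lemma tendsto_expneg:
  assumes T: "(T \<longlongrightarrow> z) F"
  shows "((\<lambda>k. expneg (T k)) \<longlongrightarrow> expneg z) F"
proof (cases z)
  case (real r)
  have "\<forall>\<^sub>F k in F. T k < \<infinity>" using order_tendstoD(2)[OF T, of \<infinity>] real by simp
  then have ev: "\<forall>\<^sub>F k in F. ennreal (exp (- enn2real (T k))) = expneg (T k)"
    by eventually_elim (auto simp: expneg_def)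
  have "((\<lambda>k. enn2real (T k)) \<longlongrightarrow> r) F" using T real by (intro tendsto_enn2real) auto
  then have "((\<lambda>k. ennreal (exp (- enn2real (T k)))) \<longlongrightarrow> ennreal (exp (- r))) F"
    by (intro tendsto_ennrealI tendsto_exp tendsto_minus)
  from Lim_transform_eventually[OF this ev] show ?thesis using real by (simp add: expneg_ennreal)
next
  case top
  show ?thesis
  proof (rule order_tendstoI)
    fix a assume a: "expneg z < a"
    then have "0 < a" using top by (simp add: expneg_def)
    obtain M :: real where M: "0 \<le> M" "ennreal (exp (- M)) < a"
    proof (cases a)
      case (real b)
      then have "b > 0" using \<open>0 < a\<close> by simp
      \<comment> \<open>The shift by 1 gives exp (- M) < b strictly; the maximum keeps
        \<open>M\<close> non-negative, so that \<open>ennreal\<close> does not truncate it.\<close>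
      define M where "M = max 0 (- ln b + 1)"
      have "exp (- M) \<le> exp (ln b - 1)" by (simp add: M_def)
      also have "\<dots> < exp (ln b)" by simp
      finally have "exp (- M) < b" using \<open>b > 0\<close> by simp
      then show ?thesis using that[of M] real by (simp add: M_def ennreal_less_iff)
    next
      case top
      then show ?thesis using that[of 0] by simp
    qed
    have "\<forall>\<^sub>F k in F. ennreal M < T k" using order_tendstoD(1)[OF T, of "ennreal M"] top by simp
    then show "\<forall>\<^sub>F k in F. expneg (T k) < a"
    proof eventually_elim
      case (elim k)
      show ?case
      proof (cases "T k")
        case (real r)
        then have "expneg (T k) \<le> ennreal (exp (- M))" using elim M(1) by (simp add: expneg_ennreal ennreal_less_iff)
        then show ?thesis using M(2) by (rule le_less_trans)
      qed (use \<open>0 < a\<close> in \<open>simp add: expneg_def\<close>)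
    qed
  qed (use top in \<open>simp add: expneg_def\<close>)
qed

text \<open>The case s = 0 forces the value 0 at the origin even if infinite values occur, because 0
  times infinity is 0 in \<open>ennreal\<close>.\<close>

definition homogeneous :: "real \<Rightarrow> ('a::euclidean_space \<Rightarrow> ennreal) \<Rightarrow> bool" where
  "homogeneous p I \<longleftrightarrow> (\<forall>s\<ge>0. \<forall>x. I (s *\<^sub>R x) = ennreal (s powr p) * I x)"

text \<open>On the ray through a unit vector u, the condition norm x < I u powr (- 1 / p) reads norm
  x powr p * I u < 1, which is I x < 1. If I u = 0 the whole ray belongs to the set, if I u is
  infinite only the origin does.\<close>

lemma star_set_radial_from_moment:
  assumes p: "0 < p" and I: "homogeneous p I"
  shows "star_set (\<lambda>u. radial_from_moment p (I u)) = {x. I x < 1}"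
proof (intro set_eqI)
  fix x :: 'a
  have I0: "I 0 = 0" using I[unfolded homogeneous_def, rule_format, of 0 0] by simp
  show "x \<in> star_set (\<lambda>u. radial_from_moment p (I u)) \<longleftrightarrow> x \<in> {x. I x < 1}"
  proof (cases "x = 0")
    case False
    define u where "u = x /\<^sub>R norm x"
    have Ix: "I x = ennreal (norm x powr p) * I u"
      using I[unfolded homogeneous_def, rule_format, of "norm x" u] False by (simp add: u_def)
    have mem: "x \<in> star_set (\<lambda>u. radial_from_moment p (I u)) \<longleftrightarrow> ennreal (norm x) < radial_from_moment p (I u)"
      using False by (simp add: star_set_def u_def)
    show ?thesis
    proof (cases "I u")
      case (real c)
      show ?thesis
      proof (cases "c = 0")
        case True
        then show ?thesis using mem Ix real by (simp add: radial_from_moment_def)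
      next
        case c: False
        then have "c > 0" using real by simp
        have "norm x < c powr (- 1 / p) \<longleftrightarrow> norm x powr p * c < 1"
        proof -
          have "norm x < (1 * (1 / c)) powr (1 / p) \<longleftrightarrow> norm x powr p / 1 < 1 / c"
            using p \<open>c > 0\<close> by (intro less_powr_inverse_iff) auto
          moreover have "(1 * (1 / c)) powr (1 / p) = c powr (- 1 / p)"
            using \<open>c > 0\<close> by (simp add: powr_divide powr_minus_divide)
          ultimately show ?thesis using \<open>c > 0\<close> by (simp add: field_simps)
        qed
        moreover have "I x = ennreal (norm x powr p * c)" using Ix real by (simp add: ennreal_mult)
        moreover have "radial_from_moment p (I u) = ennreal (c powr (- 1 / p))"
          using real \<open>c > 0\<close> by (simp add: radial_from_moment_def)
        ultimately show ?thesis using mem real by (simp add: ennreal_less_iff ennreal_less_one_iff)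
      qed
    next
      case top
      then have "I x = \<infinity>" using Ix False by (simp add: ennreal_mult_top ennreal_eq_0_iff)
      then show ?thesis using mem top by (simp add: radial_from_moment_def)
    qed
  qed (simp add: I0 star_set_def)
qed

text \<open>This is Gamma (1 + n / p), which shows that it is positive and finite and hence can be
  cancelled; the integral is the form in which it arises.\<close>

definition gamma_factor :: "real \<Rightarrow> nat \<Rightarrow> ennreal" where
  "gamma_factor p n = (\<integral>\<^sup>+ q. (indicator {0<..} q * ennreal (exp (- q))) * ennreal ((q powr (1 / p)) ^ n) \<partial>lborel)"

lemma gamma_factor:
  assumes "0 < p"
  shows "gamma_factor p n \<noteq> 0" "gamma_factor p n \<noteq> \<infinity>"
proof -
  have "gamma_factor p n = (\<integral>\<^sup>+ q. ennreal (indicator {0..} q * q powr ((real n / p + 1) - 1) / exp q) \<partial>lborel)"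
    unfolding gamma_factor_def
  proof (rule nn_integral_cong_AE)
    have "AE q in lborel. q \<noteq> (0::real)" by (rule AE_lborel_singleton)
    then show "AE q in lborel. (indicator {0<..} q * ennreal (exp (- q))) * ennreal ((q powr (1 / p)) ^ n)
        = ennreal (indicator {0..} q * q powr ((real n / p + 1) - 1) / exp q)"
    proof eventually_elim
      case (elim q)
      show ?case
      proof (cases "0 < q")
        case True
        have "(q powr (1 / p)) ^ n = q powr (real n / p)"
          using True by (simp add: powr_realpow[symmetric] powr_powr)
        then show ?thesis using True by (simp add: ennreal_mult[symmetric] exp_minus field_simps)
      qed (use elim in auto)
    qed
  qed
  also have "\<dots> = ennreal (Gamma (real n / p + 1))"
    using assms by (intro Gamma_conv_nn_integral_real[symmetric]) (simp add: add_nonneg_pos)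
  finally have "gamma_factor p n = ennreal (Gamma (real n / p + 1))" .
  moreover have "0 < Gamma (real n / p + 1)" using assms by (intro Gamma_real_pos) (simp add: add_nonneg_pos)
  ultimately show "gamma_factor p n \<noteq> 0" "gamma_factor p n \<noteq> \<infinity>" by simp_all
qed

text \<open>Integrating \<open>exp (- I)\<close> over its level sets, each of which is a dilate of \<open>{I < 1}\<close>.\<close>

lemma gamma_factor_mult_emeasure:
  fixes I :: "'a::euclidean_space \<Rightarrow> ennreal"
  assumes p: "0 < p" and I: "homogeneous p I" and [measurable]: "I \<in> borel_measurable borel"
  shows "gamma_factor p DIM('a) * emeasure lebesgue {x. I x < 1} = (\<integral>\<^sup>+ x. expneg (I x) \<partial>lborel)"
proof -
  have level: "emeasure lborel {x. I x < ennreal q} = ennreal ((q powr (1 / p)) ^ DIM('a)) * emeasure lborel {x. I x < 1}"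
    if q: "0 < q" for q :: real
  proof -
    define s where "s = q powr (1 / p)"
    have s: "s > 0" "s powr p = q" using q p by (simp_all add: s_def powr_powr)
    have iff: "I (s *\<^sub>R x) < ennreal q \<longleftrightarrow> I x < 1" for x
    proof -
      have eq: "I (s *\<^sub>R x) = ennreal q * I x" using I s by (simp add: homogeneous_def)
      show ?thesis
      proof (cases "I x")
        case (real c)
        then show ?thesis unfolding eq using q
          by (simp add: ennreal_mult[symmetric] ennreal_less_iff ennreal_less_one_iff)
      next
        case top
        then show ?thesis unfolding eq using q by (simp add: ennreal_mult_top ennreal_eq_0_iff not_le)
      qed
    qed
    have "(lborel :: 'a measure) = density (distr lborel borel (\<lambda>x. 0 + s *\<^sub>R x)) (\<lambda>_. ennreal (\<bar>s\<bar> ^ DIM('a)))"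
      using s by (intro lborel_affine) simp
    then have "emeasure lborel {x. I x < ennreal q} = emeasure (density (distr lborel borel (\<lambda>x. 0 + s *\<^sub>R x)) (\<lambda>_. ennreal (\<bar>s\<bar> ^ DIM('a)))) {x. I x < ennreal q}"
      by simp
    also have "\<dots> = ennreal (\<bar>s\<bar> ^ DIM('a)) * emeasure (distr lborel borel (\<lambda>x. 0 + s *\<^sub>R x)) {x. I x < ennreal q}"
      by (intro emeasure_density_const) simp
    also have "emeasure (distr lborel borel (\<lambda>x. 0 + s *\<^sub>R x)) {x. I x < ennreal q} = emeasure lborel {x. I x < 1}"
      by (subst emeasure_distr) (auto simp: iff vimage_def)
    finally show ?thesis using s by (simp add: s_def)
  qed
  have "(\<integral>\<^sup>+ x. expneg (I x) \<partial>lborel)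
      = (\<integral>\<^sup>+ x. \<integral>\<^sup>+ q. (indicator {0<..} q * ennreal (exp (- q))) * indicator {q. I x < ennreal q} q \<partial>lborel \<partial>lborel)"
    by (subst expneg_tail) simp
  also have "\<dots> = (\<integral>\<^sup>+ q. \<integral>\<^sup>+ x. (indicator {0<..} q * ennreal (exp (- q))) * indicator {q. I x < ennreal q} q \<partial>lborel \<partial>lborel)"
    by (rule lborel_pair.Fubini'[symmetric]) measurable
  also have "\<dots> = (\<integral>\<^sup>+ q. (indicator {0<..} q * ennreal (exp (- q))) * ennreal ((q powr (1 / p)) ^ DIM('a)) * emeasure lborel {x. I x < 1} \<partial>lborel)"
  proof (rule nn_integral_cong)
    fix q :: real
    have "(\<integral>\<^sup>+ x. (indicator {0<..} q * ennreal (exp (- q))) * indicator {q. I x < ennreal q} q \<partial>lborel)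
        = (\<integral>\<^sup>+ x. (indicator {0<..} q * ennreal (exp (- q))) * indicator {x. I x < ennreal q} x \<partial>lborel)"
      by (intro nn_integral_cong) (auto split: split_indicator)
    also have "\<dots> = (indicator {0<..} q * ennreal (exp (- q))) * emeasure lborel {x. I x < ennreal q}"
      by (rule nn_integral_cmult_indicator) simp
    finally show "(\<integral>\<^sup>+ x. (indicator {0<..} q * ennreal (exp (- q))) * indicator {q. I x < ennreal q} q \<partial>lborel)
      = (indicator {0<..} q * ennreal (exp (- q))) * ennreal ((q powr (1 / p)) ^ DIM('a)) * emeasure lborel {x. I x < 1}"
      using level[of q] by (cases "0 < q") (auto simp: mult.assoc)
  qed
  also have "\<dots> = gamma_factor p DIM('a) * emeasure lborel {x. I x < 1}"
    unfolding gamma_factor_def by (rule nn_integral_multc) measurable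
  also have "emeasure lborel {x. I x < 1} = emeasure lebesgue {x. I x < 1}" by simp
  finally show ?thesis by simp
qed

lemma nn_integral_le_if_le_on_balls:
  fixes F G :: "'a::euclidean_space \<Rightarrow> ennreal"
  assumes [measurable]: "F \<in> borel_measurable borel"
    and le: "\<And>R. 0 < R \<Longrightarrow> (\<integral>\<^sup>+ y. indicator (ball 0 R) y * F y \<partial>lborel) \<le> (\<integral>\<^sup>+ y. indicator (ball 0 R) y * G y \<partial>lborel)"
  shows "(\<integral>\<^sup>+ y. F y \<partial>lborel) \<le> (\<integral>\<^sup>+ y. G y \<partial>lborel)"
proof -
  \<comment> \<open>\<open>Suc n\<close> makes every radius positive, as the assumption on balls
    requires.\<close>
  define f where "f n y = indicator (ball 0 (real (Suc n))) y * F y" for n and y :: 'a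
  have [measurable]: "f n \<in> borel_measurable borel" for n
  proof -
    have [measurable]: "ball (0::'a) (real (Suc n)) \<in> sets borel" by simp
    show ?thesis unfolding f_def by measurable
  qed
  have "(SUP n. f n y) = F y" for y
  proof (rule antisym)
    show "(SUP n. f n y) \<le> F y" by (rule SUP_least) (auto simp: f_def split: split_indicator)
    obtain n where "norm y < real (Suc n)" using reals_Archimedean2[of "norm y"] by (metis less_SucI of_nat_less_iff order_less_trans lessI)
    then have "F y = f n y" by (simp add: f_def)
    then show "F y \<le> (SUP n. f n y)" by (metis SUP_upper UNIV_I)
  qed
  then have "(\<integral>\<^sup>+ y. F y \<partial>lborel) = (\<integral>\<^sup>+ y. (SUP n. f n y) \<partial>lborel)" by simp
  also have "\<dots> = (SUP n. \<integral>\<^sup>+ y. f n y \<partial>lborel)"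
  proof (rule nn_integral_monotone_convergence_SUP)
    show "incseq f" by (auto simp: incseq_def le_fun_def f_def split: split_indicator)
  qed simp
  also have "\<dots> \<le> (\<integral>\<^sup>+ y. G y \<partial>lborel)"
  proof (rule SUP_least)
    fix n
    have "(\<integral>\<^sup>+ y. f n y \<partial>lborel) \<le> (\<integral>\<^sup>+ y. indicator (ball 0 (real (Suc n))) y * G y \<partial>lborel)"
      unfolding f_def by (rule le) simp
    also have "\<dots> \<le> (\<integral>\<^sup>+ y. G y \<partial>lborel)"
      by (intro nn_integral_mono) (auto split: split_indicator)
    finally show "(\<integral>\<^sup>+ y. f n y \<partial>lborel) \<le> (\<integral>\<^sup>+ y. G y \<partial>lborel)" .
  qed
  finally show ?thesis .
qed

text \<open>The exponential turns the average over the sample into a product with one factor for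
  each point. The 1 / N of the average stays in each factor, whence the scale c = N in the
  exponential mean.\<close>

lemma gamma_factor_mult_star_set_emp:
  fixes X :: "nat \<Rightarrow> 'a::euclidean_space"
  assumes p: "0 < p" and N: "0 < N"
  shows "gamma_factor p DIM('a) * emeasure lebesgue (Zp_dia_emp p N X)
    = (\<integral>\<^sup>+ y. (\<Prod>i<N. ennreal (exp (- (\<bar>X i \<bullet> y\<bar> powr p / real N)))) \<partial>lborel)"
proof -
  define I where "I y = ennreal ((1 / real N) * (\<Sum>i<N. \<bar>X i \<bullet> y\<bar> powr p))" for y
  have "homogeneous p I"
    unfolding homogeneous_def
  proof (intro allI impI)
    fix s :: real and y :: 'a assume "0 \<le> s"
    then have "(1 / real N) * (\<Sum>i<N. \<bar>X i \<bullet> (s *\<^sub>R y)\<bar> powr p) = s powr p * ((1 / real N) * (\<Sum>i<N. \<bar>X i \<bullet> y\<bar> powr p))"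
      by (simp add: abs_mult powr_mult sum_distrib_left)
    then show "I (s *\<^sub>R y) = ennreal (s powr p) * I y"
      unfolding I_def by (subst ennreal_mult[symmetric]) (auto intro!: sum_nonneg divide_nonneg_nonneg)
  qed
  have [measurable]: "I \<in> borel_measurable borel" unfolding I_def by measurable
  have *: "gamma_factor p DIM('a) * emeasure lebesgue (Zp_dia_emp p N X) = (\<integral>\<^sup>+ y. expneg (I y) \<partial>lborel)"
    unfolding Zp_dia_emp_def I_def[symmetric] star_set_radial_from_moment[OF p \<open>homogeneous p I\<close>]
    by (rule gamma_factor_mult_emeasure[OF p \<open>homogeneous p I\<close>]) measurable
  have "expneg (I y) = (\<Prod>i<N. ennreal (exp (- (\<bar>X i \<bullet> y\<bar> powr p / real N))))" for y
  proof -
    have "expneg (I y) = ennreal (exp (- ((1 / real N) * (\<Sum>i<N. \<bar>X i \<bullet> y\<bar> powr p))))"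
      unfolding I_def by (intro expneg_ennreal mult_nonneg_nonneg sum_nonneg) auto
    also have "- ((1 / real N) * (\<Sum>i<N. \<bar>X i \<bullet> y\<bar> powr p)) = (\<Sum>i<N. - (\<bar>X i \<bullet> y\<bar> powr p / real N))"
      by (simp add: sum_negf sum_divide_distrib)
    finally show ?thesis by (simp add: exp_sum prod_ennreal)
  qed
  then show ?thesis unfolding * by simp
qed

section \<open>Volumes in terms of moments and exponential means\<close>

context prob_density
begin

definition moment :: "real \<Rightarrow> 'a \<Rightarrow> ennreal" where
  "moment p y = (\<integral>\<^sup>+ x. ennreal (\<bar>x \<bullet> y\<bar> powr p * g x) \<partial>lborel)"

lemma moment_measurable [measurable]: "moment p \<in> borel_measurable borel"
  unfolding moment_def by measurable

lemma exp_mean_measurable [measurable]: "exp_mean p c \<in> borel_measurable borel"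
  unfolding exp_mean_def by measurable

lemma homogeneous_moment: "homogeneous p (moment p)"
  unfolding homogeneous_def
proof (intro allI impI)
  fix s :: real and y :: 'a assume "0 \<le> s"
  have "moment p (s *\<^sub>R y) = (\<integral>\<^sup>+ x. ennreal (s powr p) * ennreal (\<bar>x \<bullet> y\<bar> powr p * g x) \<partial>lborel)"
    unfolding moment_def using \<open>0 \<le> s\<close> g_nonneg
    by (intro nn_integral_cong) (simp add: ennreal_mult[symmetric] abs_mult powr_mult mult.assoc)
  then show "moment p (s *\<^sub>R y) = ennreal (s powr p) * moment p y"
    unfolding moment_def by (simp add: nn_integral_cmult)
qed

lemma gamma_factor_mult_Zp_dia:
  assumes p: "0 < p"
  shows "gamma_factor p DIM('a) * emeasure lebesgue (Zp_dia p g) = (\<integral>\<^sup>+ y. expneg (moment p y) \<partial>lborel)"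
proof -
  have "(\<integral>\<^sup>+ x. ennreal (\<bar>x \<bullet> u\<bar> powr p * g x) \<partial>lebesgue) = moment p u" for u
    unfolding moment_def by (rule nn_integral_completion)
  then have "Zp_dia p g = {y. moment p y < 1}"
    unfolding Zp_dia_def using star_set_radial_from_moment[OF p homogeneous_moment] by simp
  then show ?thesis using gamma_factor_mult_emeasure[OF p homogeneous_moment] by simp
qed

lemma gamma_factor_mult_exp_vol_emp:
  assumes p: "0 < p" and N: "0 < N"
  shows "gamma_factor p DIM('a) * exp_vol_emp p N g = (\<integral>\<^sup>+ y. exp_mean p (real N) y ^ N \<partial>lborel)"
proof -
  let ?D = "density lebesgue (\<lambda>x. ennreal (g x))"
  let ?\<phi> = "\<lambda>x y :: 'a. ennreal (exp (- (\<bar>x \<bullet> y\<bar> powr p / real N)))"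
  let ?C = "gamma_factor p DIM('a)"
  have g_leb[measurable]: "g \<in> borel_measurable lebesgue"
    by (rule measurable_completion) simp
  have "emeasure ?D (space ?D) = 1"
    using g_integral by (simp add: emeasure_density nn_integral_completion)
  then interpret D: prob_space ?D by (rule prob_spaceI)
  interpret PD: product_sigma_finite "\<lambda>_ :: nat. ?D" by standard
  interpret S: sigma_finite_measure "sample_space N g"
    unfolding sample_space_def by (rule PD.sigma_finite) simp
  interpret SP: pair_sigma_finite "sample_space N g" "lborel :: 'a measure" by standard
  have \<phi>_leb: "(\<lambda>x. ?\<phi> x y) \<in> borel_measurable lebesgue" for y
    by (rule measurable_completion) measurable
  \<comment> \<open>The samples carry the Lebesgue sigma-algebra, the integrands below are Borel in
    each sample point; the identity mediates between them.\<close>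
  have id_D: "(\<lambda>x. x) \<in> borel_measurable ?D"
    using id_borel_measurable_lebesgue by (simp add: id_def)
  have comp[measurable]: "(\<lambda>X. X i) \<in> borel_measurable (sample_space N g)" if "i \<in> {..<N}" for i
    unfolding sample_space_def using measurable_compose[OF measurable_component_singleton[OF that] id_D] .
  have [measurable]: "(\<lambda>X. \<integral>\<^sup>+ y. (\<Prod>i<N. ?\<phi> (X i) y) \<partial>lborel) \<in> borel_measurable (sample_space N g)"
    by measurable
  \<comment> \<open>Dividing by the constant exhibits the random volume as a measurable function of
    the sample, so that the constant may be pulled through the expectation.\<close>
  have vol: "emeasure lebesgue (Zp_dia_emp p N X) = (\<integral>\<^sup>+ y. (\<Prod>i<N. ?\<phi> (X i) y) \<partial>lborel) / ?C" for X
    unfolding gamma_factor_mult_star_set_emp[OF p N, symmetric]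
    using gamma_factor[OF p, of "DIM('a)"] by (subst mult.commute) (simp add: ennreal_mult_divide_eq)
  have "?C * exp_vol_emp p N g = (\<integral>\<^sup>+ X. ?C * emeasure lebesgue (Zp_dia_emp p N X) \<partial>sample_space N g)"
    unfolding exp_vol_emp_def vol by (rule nn_integral_cmult[symmetric]) measurable
  also have "\<dots> = (\<integral>\<^sup>+ X. \<integral>\<^sup>+ y. (\<Prod>i<N. ?\<phi> (X i) y) \<partial>lborel \<partial>sample_space N g)"
    unfolding gamma_factor_mult_star_set_emp[OF p N] ..
  also have "\<dots> = (\<integral>\<^sup>+ y. \<integral>\<^sup>+ X. (\<Prod>i<N. ?\<phi> (X i) y) \<partial>sample_space N g \<partial>lborel)"
    by (rule SP.Fubini'[symmetric]) measurable
  also have "\<dots> = (\<integral>\<^sup>+ y. exp_mean p (real N) y ^ N \<partial>lborel)"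
  proof (rule nn_integral_cong)
    fix y :: 'a
    note [measurable] = \<phi>_leb[of y]
    have "(\<integral>\<^sup>+ X. (\<Prod>i<N. ?\<phi> (X i) y) \<partial>sample_space N g) = (\<Prod>i<N. \<integral>\<^sup>+ x. ?\<phi> x y \<partial>?D)"
      unfolding sample_space_def
      by (rule PD.product_nn_integral_prod) (simp, unfold measurable_cong_sets[OF sets_density refl], rule \<phi>_leb)
    also have "(\<integral>\<^sup>+ x. ?\<phi> x y \<partial>?D) = (\<integral>\<^sup>+ x. ennreal (g x) * ?\<phi> x y \<partial>lebesgue)"
      by (rule nn_integral_density) measurable
    also have "\<dots> = exp_mean p (real N) y"
      unfolding exp_mean_def by (subst nn_integral_completion) (auto simp: mult.commute)
    finally show "(\<integral>\<^sup>+ X. (\<Prod>i<N. ?\<phi> (X i) y) \<partial>sample_space N g) = exp_mean p (real N) y ^ N" by simp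
  qed
  finally show ?thesis .
qed

section \<open>Large samples\<close>

text \<open>Jensen's inequality for exp (- X / k) with X = \<bar>x \<bullet> y\<bar> powr p, raised
  to the k-th power. An infinite moment makes the left-hand side 0.\<close>

lemma expneg_moment_le:
  assumes k: "0 < k"
  shows "expneg (moment p y) \<le> exp_mean p (real k) y ^ k"
proof (cases "moment p y")
  case (real \<eta>)
  define K where "K = real k"
  have "K > 0" using k by (simp add: K_def)
  \<comment> \<open>The value of the exponential at the mean \<eta>; the tangent w * (1 + (\<eta> -
    X) / K) supports it from below.\<close>
  define w where "w = exp (- (\<eta> / K))"
  have "w > 0" by (simp add: w_def)
  have "ennreal (w + w * \<eta> / K) = (\<integral>\<^sup>+ x. ennreal (w + w * \<eta> / K) * ennreal (g x) \<partial>lborel)"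
    by (simp add: nn_integral_cmult g_integral)
  also have "\<dots> \<le> (\<integral>\<^sup>+ x. ennreal (exp (- (\<bar>x \<bullet> y\<bar> powr p / K))) * ennreal (g x) + ennreal (w / K) * ennreal (\<bar>x \<bullet> y\<bar> powr p * g x) \<partial>lborel)"
  proof (rule nn_integral_mono)
    fix x
    define X where "X = \<bar>x \<bullet> y\<bar> powr p"
    have "1 + (\<eta> / K - X / K) \<le> exp (\<eta> / K - X / K)" by (rule exp_ge_add_one_self)
    then have "w * (1 + (\<eta> / K - X / K)) \<le> w * exp (\<eta> / K - X / K)" using \<open>w > 0\<close> by simp
    also have "\<dots> = exp (- (X / K))" by (simp add: w_def exp_add[symmetric])
    finally have "w + w * \<eta> / K \<le> exp (- (X / K)) + w / K * X" by (simp add: algebra_simps)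
    then have "(w + w * \<eta> / K) * g x \<le> (exp (- (X / K)) + w / K * X) * g x" by (rule mult_right_mono[OF _ g_nonneg])
    then have "ennreal ((w + w * \<eta> / K) * g x) \<le> ennreal (exp (- (X / K)) * g x + w / K * (X * g x))"
      by (intro ennreal_leI) (simp add: algebra_simps)
    moreover have "ennreal (exp (- (X / K)) * g x + w / K * (X * g x))
        = ennreal (exp (- (X / K)) * g x) + ennreal (w / K * (X * g x))"
      using \<open>w > 0\<close> \<open>K > 0\<close> g_nonneg[of x] by (intro ennreal_plus) (auto simp: X_def)
    moreover have "ennreal (exp (- (X / K)) * g x) = ennreal (exp (- (X / K))) * ennreal (g x)"
      using g_nonneg[of x] by (intro ennreal_mult) auto
    moreover have "ennreal (w / K * (X * g x)) = ennreal (w / K) * ennreal (X * g x)"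
      using \<open>w > 0\<close> \<open>K > 0\<close> g_nonneg[of x] by (intro ennreal_mult) (auto simp: X_def)
    moreover have "ennreal ((w + w * \<eta> / K) * g x) = ennreal (w + w * \<eta> / K) * ennreal (g x)"
      using \<open>w > 0\<close> \<open>K > 0\<close> g_nonneg[of x] real by (intro ennreal_mult) auto
    ultimately show "ennreal (w + w * \<eta> / K) * ennreal (g x)
        \<le> ennreal (exp (- (\<bar>x \<bullet> y\<bar> powr p / K))) * ennreal (g x) + ennreal (w / K) * ennreal (\<bar>x \<bullet> y\<bar> powr p * g x)"
      unfolding X_def[symmetric] by (simp only:)
  qed
  also have "\<dots> = exp_mean p K y + ennreal (w / K) * moment p y"
    unfolding exp_mean_def moment_def by (subst nn_integral_add) (auto simp: nn_integral_cmult)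
  also have "ennreal (w / K) * moment p y = ennreal (w * \<eta> / K)"
    using real \<open>w > 0\<close> \<open>K > 0\<close> by (simp add: ennreal_mult[symmetric])
  finally have "ennreal (w * \<eta> / K) + ennreal w \<le> ennreal (w * \<eta> / K) + exp_mean p K y"
    using \<open>w > 0\<close> \<open>K > 0\<close> real by (simp add: ennreal_plus add.commute)
  then have "ennreal w \<le> exp_mean p K y" by (simp add: ennreal_add_left_cancel_le)
  then have "ennreal w ^ k \<le> exp_mean p K y ^ k" by (intro power_mono) auto
  moreover have "ennreal w ^ k = expneg (moment p y)"
  proof -
    have "w ^ k = exp (- \<eta>)" using k by (simp add: w_def K_def exp_of_nat_mult[symmetric])
    then show ?thesis using real \<open>w > 0\<close> by (simp add: ennreal_power expneg_ennreal)
  qed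
  ultimately show ?thesis by (simp add: K_def)
next
  case top
  then show ?thesis by (simp add: expneg_def)
qed

text \<open>The mean of k * (1 - exp (- X / k)) for X = \<bar>x \<bullet> y\<bar> powr p: a quantity
  below X that tends to X, and finite after averaging. It measures how far the exponential mean
  falls short of 1, multiplied by k.\<close>

definition trunc_moment :: "real \<Rightarrow> nat \<Rightarrow> 'a \<Rightarrow> ennreal" where
  "trunc_moment p k y = (\<integral>\<^sup>+ x. ennreal (real k * (1 - exp (- (\<bar>x \<bullet> y\<bar> powr p / real k))) * g x) \<partial>lborel)"

lemma trunc_moment_measurable [measurable]: "trunc_moment p k \<in> borel_measurable borel"
  unfolding trunc_moment_def by measurable

text \<open>If s is the mean of 1 - exp (- X / k), the exponential mean is 1 - s \<le> exp (- s).
  For the moment itself Jensen's inequality points the other way, hence the truncated one.\<close>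

lemma exp_mean_power_le_expneg:
  assumes k: "0 < k"
  shows "exp_mean p (real k) y ^ k \<le> expneg (trunc_moment p k y)"
proof -
  define S where "S = (\<integral>\<^sup>+ x. ennreal ((1 - exp (- (\<bar>x \<bullet> y\<bar> powr p / real k))) * g x) \<partial>lborel)"
  have le1: "exp (- (\<bar>x \<bullet> y\<bar> powr p / real k)) \<le> 1" for x by simp
  have "exp_mean p (real k) y + S = (\<integral>\<^sup>+ x. ennreal (g x) \<partial>lborel)"
    unfolding exp_mean_def S_def
  proof (subst nn_integral_add[symmetric])
    show "(\<integral>\<^sup>+ x. ennreal (exp (- (\<bar>x \<bullet> y\<bar> powr p / real k))) * ennreal (g x) + ennreal ((1 - exp (- (\<bar>x \<bullet> y\<bar> powr p / real k))) * g x) \<partial>lborel)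
       = (\<integral>\<^sup>+ x. ennreal (g x) \<partial>lborel)"
    proof (rule nn_integral_cong)
      fix x
      define a where "a = exp (- (\<bar>x \<bullet> y\<bar> powr p / real k))"
      have "0 \<le> a" "a \<le> 1" using le1[of x] by (auto simp: a_def)
      then have "ennreal a * ennreal (g x) + ennreal ((1 - a) * g x) = ennreal (a * g x + (1 - a) * g x)"
        using g_nonneg[of x] by (simp add: ennreal_mult ennreal_plus)
      then show "ennreal (exp (- (\<bar>x \<bullet> y\<bar> powr p / real k))) * ennreal (g x) + ennreal ((1 - exp (- (\<bar>x \<bullet> y\<bar> powr p / real k))) * g x) = ennreal (g x)"
        unfolding a_def by (simp add: algebra_simps)
    qed
  qed auto
  then have sum: "exp_mean p (real k) y + S = 1" by (simp add: g_integral)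
  then have "S \<le> 1" "exp_mean p (real k) y \<le> 1" by (metis add.commute le_iff_add)+
  then obtain s m where sm: "S = ennreal s" "0 \<le> s" "exp_mean p (real k) y = ennreal m" "0 \<le> m"
    by (cases S; cases "exp_mean p (real k) y") (auto simp: top_unique)
  have "ennreal (m + s) = ennreal 1" using sum sm by (simp add: ennreal_plus)
  then have "m + s = 1" using sm by (subst (asm) ennreal_inj) auto
  then have "m \<le> exp (- s)" using exp_ge_add_one_self[of "- s"] by simp
  then have "m ^ k \<le> exp (- s) ^ k" using sm by (intro power_mono) auto
  also have "exp (- s) ^ k = exp (- (real k * s))" by (simp add: exp_of_nat_mult[symmetric])
  finally have "ennreal (m ^ k) \<le> ennreal (exp (- (real k * s)))" by (rule ennreal_leI)
  moreover have "trunc_moment p k y = ennreal (real k * s)"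
  proof -
    have "trunc_moment p k y = (\<integral>\<^sup>+ x. ennreal (real k) * ennreal ((1 - exp (- (\<bar>x \<bullet> y\<bar> powr p / real k))) * g x) \<partial>lborel)"
      unfolding trunc_moment_def using g_nonneg le1
      by (intro nn_integral_cong) (simp add: ennreal_mult[symmetric] mult.assoc)
    also have "\<dots> = ennreal (real k) * S" unfolding S_def by (rule nn_integral_cmult) measurable
    finally show ?thesis using sm by (simp add: ennreal_mult)
  qed
  ultimately show ?thesis using sm by (simp add: ennreal_power expneg_ennreal)
qed

text \<open>The integrands converge because k * (1 - exp (- X / k)) lies between X / (1 + X / k) and
  X. Fatou's lemma then bounds the limit from below, also for an infinite moment, and the moment
  bounds every term from above.\<close>

lemma tendsto_trunc_moment: "(\<lambda>n. trunc_moment p (Suc n) y) \<longlonglongrightarrow> moment p y"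
proof -
  define u where "u n x = ennreal (real (Suc n) * (1 - exp (- (\<bar>x \<bullet> y\<bar> powr p / real (Suc n)))) * g x)" for n and x :: 'a
  have [measurable]: "u n \<in> borel_measurable borel" for n unfolding u_def by measurable
  have upper: "k * (1 - exp (- (X / k))) \<le> X" if "0 < k" for k X :: real
  proof -
    have "1 - exp (- (X / k)) \<le> X / k" using exp_ge_add_one_self[of "- (X / k)"] by simp
    then show ?thesis using that by (simp add: field_simps)
  qed
  have lower: "X / (1 + X / k) \<le> k * (1 - exp (- (X / k)))" if "0 < k" "0 \<le> X" for k X :: real
  proof -
    have pos: "0 < 1 + X / k" using that by (simp add: add_pos_nonneg)
    have "1 + X / k \<le> exp (X / k)" by (rule exp_ge_add_one_self)
    then have "exp (- (X / k)) \<le> 1 / (1 + X / k)"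
      using pos by (simp add: exp_minus inverse_eq_divide frac_le)
    then have "k * (1 - 1 / (1 + X / k)) \<le> k * (1 - exp (- (X / k)))" using that by (intro mult_left_mono) auto
    moreover have "k * (1 - 1 / (1 + X / k)) = X / (1 + X / k)" using that pos by (simp add: field_simps)
    ultimately show ?thesis by simp
  qed
  have lim: "(\<lambda>n. u n x) \<longlonglongrightarrow> ennreal (\<bar>x \<bullet> y\<bar> powr p * g x)" for x
  proof -
    define X where "X = \<bar>x \<bullet> y\<bar> powr p"
    have "(\<lambda>n. X / real (Suc n)) \<longlonglongrightarrow> 0"
      using LIMSEQ_Suc[OF lim_const_over_n[of X]] by simp
    then have "(\<lambda>n. X / (1 + X / real (Suc n))) \<longlonglongrightarrow> X / (1 + 0)"
      by (intro tendsto_intros) auto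
    then have lim_lower: "(\<lambda>n. X / (1 + X / real (Suc n))) \<longlonglongrightarrow> X" by simp
    have "(\<lambda>n. real (Suc n) * (1 - exp (- (X / real (Suc n))))) \<longlonglongrightarrow> X"
    proof (rule tendsto_sandwich[OF _ _ lim_lower tendsto_const])
      show "\<forall>\<^sub>F n in sequentially. X / (1 + X / real (Suc n)) \<le> real (Suc n) * (1 - exp (- (X / real (Suc n))))"
        by (intro always_eventually allI lower) (auto simp: X_def)
      show "\<forall>\<^sub>F n in sequentially. real (Suc n) * (1 - exp (- (X / real (Suc n)))) \<le> X"
        by (intro always_eventually allI upper) auto
    qed
    then show ?thesis unfolding u_def X_def[symmetric] by (intro tendsto_ennrealI tendsto_mult_right)
  qed
  have T: "trunc_moment p (Suc n) y = (\<integral>\<^sup>+ x. u n x \<partial>lborel)" for n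
    unfolding trunc_moment_def u_def ..
  have "moment p y = (\<integral>\<^sup>+ x. liminf (\<lambda>n. u n x) \<partial>lborel)"
    unfolding moment_def using lim_imp_Liminf[OF trivial_limit_sequentially lim] by simp
  also have "\<dots> \<le> liminf (\<lambda>n. \<integral>\<^sup>+ x. u n x \<partial>lborel)" by (rule nn_integral_liminf) simp
  finally have fatou: "moment p y \<le> liminf (\<lambda>n. trunc_moment p (Suc n) y)" unfolding T .
  have le: "trunc_moment p (Suc n) y \<le> moment p y" for n
    unfolding trunc_moment_def moment_def
    using upper g_nonneg by (intro nn_integral_mono ennreal_leI mult_right_mono) auto
  show ?thesis
  proof (rule order_tendstoI)
    fix a assume "a < moment p y"
    then have "a < liminf (\<lambda>n. trunc_moment p (Suc n) y)" using fatou by simp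
    then show "\<forall>\<^sub>F n in sequentially. a < trunc_moment p (Suc n) y" by (rule less_LiminfD)
  next
    fix a assume "moment p y < a"
    then show "\<forall>\<^sub>F n in sequentially. trunc_moment p (Suc n) y < a" using le by (intro always_eventually allI) (blast intro: le_less_trans)
  qed
qed

text \<open>The two one-sided bounds are used on opposite sides: Jensen's inequality for the density
  and the truncated moment for its rearrangement, with the comparison of k-th powers in between.
  Thus a limit is needed only on the right, where the ball supplies an integrable majorant.\<close>

lemma expneg_moment_integral_le:
  assumes p: "0 < p" and R: "0 < R"
  shows "(\<integral>\<^sup>+ y. indicator (ball 0 R) y * expneg (moment p y) \<partial>lborel)
    \<le> (\<integral>\<^sup>+ y. indicator (ball 0 R) y * expneg (prob_density.moment (sym_rearr g) p y) \<partial>lborel)"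
proof -
  interpret S: prob_density "sym_rearr g" by (rule prob_density_sym_rearr)
  have [measurable]: "ball (0::'a) R \<in> sets borel" by simp
  have le: "(\<integral>\<^sup>+ y. indicator (ball 0 R) y * expneg (moment p y) \<partial>lborel)
      \<le> (\<integral>\<^sup>+ y. indicator (ball 0 R) y * expneg (S.trunc_moment p (Suc n) y) \<partial>lborel)" for n
  proof -
    have "(\<integral>\<^sup>+ y. indicator (ball 0 R) y * expneg (moment p y) \<partial>lborel)
       \<le> (\<integral>\<^sup>+ y. indicator (ball 0 R) y * exp_mean p (real (Suc n)) y ^ Suc n \<partial>lborel)"
      by (intro nn_integral_mono mult_left_mono expneg_moment_le) auto
    also have "\<dots> \<le> (\<integral>\<^sup>+ y. indicator (ball 0 R) y * S.exp_mean p (real (Suc n)) y ^ Suc n \<partial>lborel)"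
      by (rule exp_mean_power_le[OF p _ R]) simp
    also have "\<dots> \<le> (\<integral>\<^sup>+ y. indicator (ball 0 R) y * expneg (S.trunc_moment p (Suc n) y) \<partial>lborel)"
      by (intro nn_integral_mono mult_left_mono S.exp_mean_power_le_expneg) auto
    finally show ?thesis .
  qed
  have "(\<lambda>n. \<integral>\<^sup>+ y. indicator (ball 0 R) y * expneg (S.trunc_moment p (Suc n) y) \<partial>lborel)
    \<longlonglongrightarrow> (\<integral>\<^sup>+ y. indicator (ball 0 R) y * expneg (S.moment p y) \<partial>lborel)"
  proof (rule nn_integral_dominated_convergence)
    show "(\<integral>\<^sup>+ y. indicator (ball (0::'a) R) y \<partial>lborel) < \<infinity>"
      using emeasure_lborel_ball_finite[of "0::'a" R] by simp
    show "AE y in lborel. indicator (ball 0 R) y * expneg (S.trunc_moment p (Suc n) y) \<le> indicator (ball 0 R) y" for n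
      by (intro AE_I2) (auto split: split_indicator simp: expneg_le_1)
    show "AE y in lborel. (\<lambda>n. indicator (ball 0 R) y * expneg (S.trunc_moment p (Suc n) y))
        \<longlonglongrightarrow> indicator (ball 0 R) y * expneg (S.moment p y)"
      using tendsto_expneg[OF S.tendsto_trunc_moment] by (intro AE_I2) (auto split: split_indicator)
  qed measurable
  then show ?thesis using le by (intro LIMSEQ_le_const) auto
qed

lemma rearrangement_inequalities:
  assumes p: "0 < p" and N: "0 < N"
  shows "emeasure lebesgue (Zp_dia p g) \<le> emeasure lebesgue (Zp_dia p (sym_rearr g))"
    and "exp_vol_emp p N g \<le> exp_vol_emp p N (sym_rearr g)"
proof -
  interpret S: prob_density "sym_rearr g" by (rule prob_density_sym_rearr)
  have cancel: "a \<le> b" if "gamma_factor p DIM('a) * a \<le> gamma_factor p DIM('a) * b" for a b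
    using that gamma_factor[OF p, of "DIM('a)"] by (subst (asm) ennreal_mult_le_mult_iff) auto
  show "emeasure lebesgue (Zp_dia p g) \<le> emeasure lebesgue (Zp_dia p (sym_rearr g))"
  proof (rule cancel, unfold gamma_factor_mult_Zp_dia[OF p] S.gamma_factor_mult_Zp_dia[OF p], rule nn_integral_le_if_le_on_balls)
    show "(\<lambda>y. expneg (moment p y)) \<in> borel_measurable borel" by measurable
  qed (rule expneg_moment_integral_le[OF p])
  show "exp_vol_emp p N g \<le> exp_vol_emp p N (sym_rearr g)"
  proof (rule cancel, unfold gamma_factor_mult_exp_vol_emp[OF p N] S.gamma_factor_mult_exp_vol_emp[OF p N], rule nn_integral_le_if_le_on_balls)
    show "(\<lambda>y. exp_mean p (real N) y ^ N) \<in> borel_measurable borel" by measurable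
  qed (use N in \<open>intro exp_mean_power_le[OF p], simp_all\<close>)
qed

end

section \<open>Reduction to Borel densities\<close>

text \<open>Only the volumes of the superlevel sets enter the rearrangement, so the two
  rearrangements agree at every point and not merely almost everywhere.\<close>

lemma sym_rearr_cong_AE:
  assumes [measurable]: "f \<in> borel_measurable lebesgue" "g \<in> borel_measurable lebesgue"
    and eq: "AE x in lebesgue. f x = g x"
  shows "sym_rearr f = sym_rearr g"
proof -
  have "emeasure lebesgue {y. t < f y} = emeasure lebesgue {y. t < g y}" for t
  proof (rule emeasure_eq_AE)
    show "AE x in lebesgue. x \<in> {y. t < f y} \<longleftrightarrow> x \<in> {y. t < g y}"
      using eq by eventually_elim simp
    have "{y \<in> space lebesgue. t < f y} \<in> sets lebesgue" "{y \<in> space lebesgue. t < g y} \<in> sets lebesgue" by measurable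
    then show "{y. t < f y} \<in> sets lebesgue" "{y. t < g y} \<in> sets lebesgue" by simp_all
  qed
  then show ?thesis unfolding sym_rearr_def sym_ball_def by (intro ext) simp
qed

theorem theorem2p1:
  fixes f :: "'a::euclidean_space \<Rightarrow> real" and p :: real and N :: nat
  assumes "f \<in> Pn" and "0 < p" and "p < 1" and "N > DIM('a)"
  shows "emeasure lebesgue (Zp_dia p f) \<le> emeasure lebesgue (Zp_dia p (sym_rearr f))
         \<and> exp_vol_emp p N f \<le> exp_vol_emp p N (sym_rearr f)"
proof -
  have f[measurable]: "f \<in> borel_measurable lebesgue" and f_nonneg: "\<And>x. 0 \<le> f x"
    and f_int: "(\<integral>\<^sup>+ x. ennreal (f x) \<partial>lebesgue) = 1"
    using assms(1) by (auto simp: Pn_def)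
  obtain g' where g'[measurable]: "g' \<in> borel_measurable lborel" and fg': "AE x in lborel. f x = g' x"
    using completion_ex_borel_measurable_real[OF f] by blast
  \<comment> \<open>The Borel representative may be negative on a null set; clipping at 0 restores
    the pointwise sign required by \<open>prob_density\<close>.\<close>
  define g where "g x = max 0 (g' x)" for x
  have [measurable]: "g \<in> borel_measurable borel" using g' unfolding g_def by measurable
  have g_leb[measurable]: "g \<in> borel_measurable lebesgue" by (rule measurable_completion) simp
  have "AE x in lborel. f x = g x"
    using fg'
  proof eventually_elim
    case (elim x)
    then show ?case using f_nonneg[of x] by (simp add: g_def)
  qed
  then have fg: "AE x in lebesgue. f x = g x" by (rule AE_completion)
  have "(\<integral>\<^sup>+ x. ennreal (g x) \<partial>lborel) = (\<integral>\<^sup>+ x. ennreal (g x) \<partial>lebesgue)"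
    by (rule nn_integral_completion[symmetric])
  also have "\<dots> = (\<integral>\<^sup>+ x. ennreal (f x) \<partial>lebesgue)"
    using fg by (intro nn_integral_cong_AE) (auto elim!: eventually_mono)
  finally have "(\<integral>\<^sup>+ x. ennreal (g x) \<partial>lborel) = 1" using f_int by simp
  then interpret prob_density g by unfold_locales (auto simp: g_def)
  have "Zp_dia p f = Zp_dia p g"
  proof -
    have "(\<integral>\<^sup>+ x. ennreal (\<bar>x \<bullet> u\<bar> powr p * f x) \<partial>lebesgue) = (\<integral>\<^sup>+ x. ennreal (\<bar>x \<bullet> u\<bar> powr p * g x) \<partial>lebesgue)" for u
      using fg by (intro nn_integral_cong_AE) (auto elim!: eventually_mono)
    then show ?thesis unfolding Zp_dia_def by simp
  qed
  moreover have "exp_vol_emp p N f = exp_vol_emp p N g"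
  proof -
    have "density lebesgue (\<lambda>x. ennreal (f x)) = density lebesgue (\<lambda>x. ennreal (g x))"
      using fg by (intro density_cong) (auto elim!: eventually_mono)
    then show ?thesis unfolding exp_vol_emp_def sample_space_def by simp
  qed
  moreover have "sym_rearr f = sym_rearr g" by (rule sym_rearr_cong_AE[OF f g_leb fg])
  ultimately show ?thesis using rearrangement_inequalities[OF \<open>0 < p\<close>, of N] assms(4) by simp
qed

end
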